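(* Let $d=5$ and $v(5)=\big(\tfrac{1}{\sqrt{10}},\dots,\tfrac{1}{\sqrt{10}}\big)\in\mathbb{R}^5$. There exists a constant $c_0\neq0$ such that $$\lim_{t\to\infty}\Big|t^{\frac{11}{6}}\,I(v(5),t)\Big|=c_0.$$
   Context: For $d=5$, $v\in\mathbb{R}^d$ and $t\in\mathbb{R}$, $$I(v,t)=\frac{1}{(2\pi)^d}\int_{\mathbb{T}^d}e^{it\phi(v,\xi)}\,\frac{1}{\omega(\xi)}\,d\xi,\qquad \phi(v,\xi)=v\cdot\xi-\omega(\xi),\qquad \omega(\xi)=\Big(\sum_{j=1}^d(2-2\cos\xi_j)\Big)^{1/2},$$ where $\mathbb{T}^d=[-\pi,\pi]^d$. *)

theory Defs
  imports "HOL-Analysis.Analysis"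
begin

definition torus :: "(real ^ 'n) set" where
  "torus = {\<xi>. \<forall>j. - pi \<le> \<xi> $ j \<and> \<xi> $ j \<le> pi}"

definition omega :: "real ^ 'n \<Rightarrow> real" where
  "omega \<xi> = sqrt (\<Sum>j\<in>UNIV. 2 - 2 * cos (\<xi> $ j))"

definition phase :: "real ^ 'n \<Rightarrow> real ^ 'n \<Rightarrow> real" where
  "phase v \<xi> = v \<bullet> \<xi> - omega \<xi>"

(* A Lebesgue (Bochner) integral. At the only zero of omega in the torus, the origin,
   division by zero gives the integrand the value 0; this is a null set. For the dimension
   d = 5 the singularity is of order 1 / norm \<xi>, hence the integrand is
   absolutely integrable. *)
definition osc_int :: "real ^ 'n \<Rightarrow> real \<Rightarrow> complex" where
  "osc_int v t =
     complex_of_real (1 / (2 * pi) ^ CARD('n)) *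
     (LINT \<xi>:torus|lborel. exp (\<i> * complex_of_real (t * phase v \<xi>)) * complex_of_real (1 / omega \<xi>))"

definition v5 :: "real ^ 5" where
  "v5 = (\<chi> j. 1 / sqrt 10)"

end

(* Subordination: exp(-i t w) / w is, up to a constant factor, the improper integral over x > 0 of
   exp(-i (w^2 x^2 + t^2 / (4 x^2))).  As omega^2 is a sum over the coordinates, the integral over
   the torus becomes a one-dimensional integral of the fifth power of an (incomplete) Bessel
   integral J(tau, z) of order tau = t / sqrt 10 at z = 2 x^2.  Van der Corput's estimates bound
   J near the turning point z = tau by tau^(-1/3) (1 + |s|)^(-1/4), where s is the distance to the
   turning point in units of 2 tau^(1/3).  Since 5/4 > 1, dominated convergence applies at this
   scale: the limit is a nonzero multiple of the integral of the fifth power of an Airy function,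
   and the other stationary points need no separate treatment.  That integral is positive: by
   Sturm comparison, each negative arch of the Airy function is dominated by its mirror image in
   the preceding zero. *)
theory Submission
  imports Defs "HOL-Complex_Analysis.Complex_Analysis" "HOL-Probability.Distributions"
    "HOL-Real_Asymp.Real_Asymp"
begin

section \<open>Van der Corput estimates\<close>

text \<open>Why this direction: the outer phase \<open>10 * (x^2 + tau^2 / (4 * x^2))\<close> is
  stationary at \<open>2 * x^2 = tau\<close>. For a diagonal direction this point agrees with the
  turning point of the inner integral exactly when the components are \<open>1 / sqrt 10\<close>, so
  for \<open>v5\<close> the two degeneracies meet. Put \<open>tau = l ^ 3\<close> and
  \<open>x = X * (1 + s / l^2)\<close> with \<open>X = sqrt (tau / 2)\<close>. For fixed
  \<open>s\<close> the outer phase, up to a constant, is then of order \<open>s^2 / l\<close> and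
  drops out of the limit.

  The exponent is a count of powers: each of the five inner integrals contributes
  \<open>1 / l\<close>, the substitution contributes \<open>X / l^2\<close>, of order
  \<open>l^(-1/2)\<close>; the product is of order \<open>l^(-11/2) = tau^(-11/6)\<close>.

  Two obstacles shape the rest. The order \<open>tau\<close> runs through all reals, so the inner
  integral is not a Bessel function and is treated directly as an oscillatory integral over a period
  that has ends. And the limit contains an odd power of an oscillating function, so that its
  integral is nonzero needs an argument of its own.\<close>

lemma van_der_corput_first:
  fixes \<phi> \<phi>' \<phi>'' :: "real \<Rightarrow> real"
  assumes ab: "a \<le> b" and l: "l > 0"
    and d1: "\<And>x. (\<phi> has_real_derivative \<phi>' x) (at x)"
    and d2: "\<And>x. (\<phi>' has_real_derivative \<phi>'' x) (at x)"
    and cont: "continuous_on {a..b} \<phi>''"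
    and lower: "(\<forall>x\<in>{a..b}. l \<le> \<phi>' x) \<or> (\<forall>x\<in>{a..b}. \<phi>' x \<le> -l)"
    and mono: "(\<forall>x\<in>{a..b}. 0 \<le> \<phi>'' x) \<or> (\<forall>x\<in>{a..b}. \<phi>'' x \<le> 0)"
  shows "norm (integral {a..b} (\<lambda>x. cis (\<phi> x))) \<le> 3 / l"
proof -
  have nz: "\<phi>' x \<noteq> 0" if "x \<in> {a..b}" for x using lower l that by force
  have c0: "continuous_on {a..b} \<phi>" "continuous_on {a..b} \<phi>'"
    using d1 d2 DERIV_isCont continuous_at_imp_continuous_on by blast+
  \<comment> \<open>Integration by parts: \<open>H\<close> is the boundary term, and
    \<open>E\<close> is the remainder that carries the derivative of the reciprocal of
    \<open>\<phi>'\<close>.\<close>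
  define H where "H = (\<lambda>x. cis (\<phi> x) * complex_of_real (1 / \<phi>' x) / \<i>)"
  define E where "E = (\<lambda>x. cis (\<phi> x) * complex_of_real (\<phi>'' x / (\<phi>' x)\<^sup>2) / \<i>)"
  have d3: "((\<lambda>x. 1 / \<phi>' x) has_real_derivative - (\<phi>'' x / (\<phi>' x)\<^sup>2)) (at x)" if "x \<in> {a..b}" for x
    using nz[OF that] by (auto intro!: derivative_eq_intros d2 simp: power2_eq_square)
  have H: "(H has_vector_derivative (cis (\<phi> x) - E x)) (at x within {a..b})" if "x \<in> {a..b}" for x
  proof -
    have 1: "((\<lambda>x. cis (\<phi> x)) has_vector_derivative \<phi>' x *\<^sub>R (\<i> * cis (\<phi> x))) (at x)"
      using has_derivative_cis[OF d1[of x, unfolded has_field_derivative_def]]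
      by (simp add: has_vector_derivative_def scaleR_conv_of_real mult_ac)
    have 2: "((\<lambda>x. complex_of_real (1 / \<phi>' x)) has_vector_derivative
                complex_of_real (- (\<phi>'' x / (\<phi>' x)\<^sup>2))) (at x)"
      using has_vector_derivative_of_real[OF d3[OF that]] .
    have "((\<lambda>x. (cis (\<phi> x) * complex_of_real (1 / \<phi>' x)) / \<i>) has_vector_derivative
        (cis (\<phi> x) * complex_of_real (- (\<phi>'' x / (\<phi>' x)\<^sup>2)) +
          (\<phi>' x *\<^sub>R (\<i> * cis (\<phi> x))) * complex_of_real (1 / \<phi>' x)) / \<i>) (at x)"
      by (intro has_vector_derivative_divide has_vector_derivative_mult 1 2)
    moreover have "(cis (\<phi> x) * complex_of_real (- (\<phi>'' x / (\<phi>' x)\<^sup>2)) +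
          (\<phi>' x *\<^sub>R (\<i> * cis (\<phi> x))) * complex_of_real (1 / \<phi>' x)) / \<i> = cis (\<phi> x) - E x"
      using nz[OF that] by (simp add: E_def scaleR_conv_of_real field_simps)
    ultimately show ?thesis unfolding H_def
      by (simp add: has_vector_derivative_at_within)
  qed
  have cE: "continuous_on {a..b} E" unfolding E_def
    using nz by (intro continuous_intros c0 cont) auto
  have cc: "continuous_on {a..b} (\<lambda>x. cis (\<phi> x))"
    by (intro continuous_intros c0)
  have "((\<lambda>x. cis (\<phi> x) - E x) has_integral H b - H a) {a..b}"
    by (rule fundamental_theorem_of_calculus[OF ab H])
  then have "integral {a..b} (\<lambda>x. cis (\<phi> x)) - integral {a..b} E = H b - H a"
    using cE cc by (simp add: integral_diff[symmetric] integrable_continuous_real integral_unique)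
  then have eq: "integral {a..b} (\<lambda>x. cis (\<phi> x)) = H b - H a + integral {a..b} E"
    by (simp add: algebra_simps)
  have "((\<lambda>x. - (\<phi>'' x / (\<phi>' x)\<^sup>2)) has_integral 1 / \<phi>' b - 1 / \<phi>' a) {a..b}"
    by (rule fundamental_theorem_of_calculus[OF ab])
      (simp add: has_real_derivative_iff_has_vector_derivative[symmetric] has_field_derivative_at_within d3)
  from has_integral_neg[OF this]
  have I1: "((\<lambda>x. \<phi>'' x / (\<phi>' x)\<^sup>2) has_integral 1 / \<phi>' a - 1 / \<phi>' b) {a..b}"
    by simp
  \<comment> \<open>Since \<open>\<phi>''\<close> keeps one sign, the norm of \<open>E\<close> is
    itself plus or minus the derivative of \<open>1 / \<phi>'\<close>, and its integral can be
    evaluated exactly.\<close>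
  obtain \<sigma> where \<sigma>: "\<sigma> = 1 \<or> \<sigma> = (-1::real)" "\<And>x. x \<in> {a..b} \<Longrightarrow> \<bar>\<phi>'' x\<bar> = \<sigma> * \<phi>'' x"
    using mono
  proof
    assume "\<forall>x\<in>{a..b}. 0 \<le> \<phi>'' x" then show thesis by (intro that[of 1]) auto
  next
    assume "\<forall>x\<in>{a..b}. \<phi>'' x \<le> 0" then show thesis by (intro that[of "-1"]) auto
  qed
  have I2: "((\<lambda>x. \<sigma> * (\<phi>'' x / (\<phi>' x)\<^sup>2)) has_integral \<sigma> * (1 / \<phi>' a - 1 / \<phi>' b)) {a..b}"
    using has_integral_mult_right[OF I1] .
  have "norm (integral {a..b} E) \<le> integral {a..b} (\<lambda>x. \<sigma> * (\<phi>'' x / (\<phi>' x)\<^sup>2))"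
    by (rule integral_norm_bound_integral)
      (use cE I2 \<sigma>(2) in \<open>auto simp: integrable_continuous_real E_def norm_mult norm_divide norm_power
         abs_mult has_integral_integrable\<close>)
  then have E: "norm (integral {a..b} E) \<le> \<sigma> * (1 / \<phi>' a - 1 / \<phi>' b)"
    using I2 by (simp add: integral_unique)
  have H': "norm (H x) \<le> 1 / l" if "x \<in> {a..b}" for x
  proof -
    have "l \<le> \<bar>\<phi>' x\<bar>" using lower that l by force
    then have "1 / \<bar>\<phi>' x\<bar> \<le> 1 / l" using l by (intro divide_left_mono) auto
    then show ?thesis by (simp add: H_def norm_mult norm_divide)
  qed
  \<comment> \<open>Both reciprocals lie on the same side of 0, so their difference costs only one
    \<open>1 / l\<close>. With the two boundary terms this gives the constant 3.\<close>
  have "(0 \<le> 1 / \<phi>' a \<and> 1 / \<phi>' a \<le> 1 / l \<and> 0 \<le> 1 / \<phi>' b \<and> 1 / \<phi>' b \<le> 1 / l) \<or>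
    (0 \<ge> 1 / \<phi>' a \<and> 1 / \<phi>' a \<ge> - (1 / l) \<and> 0 \<ge> 1 / \<phi>' b \<and> 1 / \<phi>' b \<ge> - (1 / l))"
    using lower
  proof
    assume "\<forall>x\<in>{a..b}. l \<le> \<phi>' x"
    then have "l \<le> \<phi>' a" "l \<le> \<phi>' b" using ab by auto
    then show ?thesis using l by (auto intro!: divide_left_mono)
  next
    assume "\<forall>x\<in>{a..b}. \<phi>' x \<le> -l"
    then have "\<phi>' a \<le> -l" "\<phi>' b \<le> -l" using ab by auto
    then have "1 / l \<ge> 1 / (-\<phi>' a)" "1 / l \<ge> 1 / (-\<phi>' b)" "\<phi>' a \<le> 0" "\<phi>' b \<le> 0" 
      using l by (auto intro!: divide_left_mono mult_pos_pos simp del: minus_divide_right divide_minus_right)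
    then show ?thesis by auto
  qed
  then have "\<bar>1 / \<phi>' a - 1 / \<phi>' b\<bar> \<le> 1 / l" by linarith
  then have "norm (integral {a..b} E) \<le> 1 / l" using E \<sigma>(1) by auto
  moreover have "norm (H b - H a + integral {a..b} E) \<le> norm (H b) + norm (H a) + norm (integral {a..b} E)"
    by (meson norm_triangle_ineq norm_triangle_ineq4 order_trans add_right_mono)
  moreover have "norm (H a) \<le> 1 / l" "norm (H b) \<le> 1 / l" using H' ab by auto
  ultimately show ?thesis unfolding eq by (simp add: field_simps)
qed

lemma norm_integral_cis_le:
  fixes \<phi> :: "real \<Rightarrow> real"
  assumes "a \<le> b" "continuous_on {a..b} \<phi>"
  shows "norm (integral {a..b} (\<lambda>x. cis (\<phi> x))) \<le> b - a"
  using integral_bound[OF assms(1), of "\<lambda>x. cis (\<phi> x)" 1] assms(2)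
  by (auto intro!: continuous_intros)

text \<open>Outside a window of half-width \<open>1 / sqrt l\<close> about the zero of
  \<open>\<phi>'\<close> the derivative is at least \<open>sqrt l\<close> in absolute value, and the
  first-derivative estimate applies; on the window the trivial estimate has the same order. The
  constant is 8 = 3 + 2 + 3.\<close>

lemma van_der_corput_second_pos:
  fixes \<phi> \<phi>' \<phi>'' :: "real \<Rightarrow> real"
  assumes ab: "a \<le> b" and l: "l > 0"
    and d1: "\<And>x. (\<phi> has_real_derivative \<phi>' x) (at x)"
    and d2: "\<And>x. (\<phi>' has_real_derivative \<phi>'' x) (at x)"
    and cont: "continuous_on {a..b} \<phi>''"
    and lower: "\<forall>x\<in>{a..b}. l \<le> \<phi>'' x"
  shows "norm (integral {a..b} (\<lambda>x. cis (\<phi> x))) \<le> 8 / sqrt l"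
proof -
  have c0: "continuous_on S \<phi>" "continuous_on S \<phi>'" for S
    using d1 d2 DERIV_isCont continuous_at_imp_continuous_on by blast+
  have growth: "\<phi>' y - \<phi>' x \<ge> l * (y - x)" if "a \<le> x" "x \<le> y" "y \<le> b" for x y
  proof (cases "x = y")
    case False
    then have "x < y" using that by simp
    from MVT2[OF this, of \<phi>' \<phi>''] d2
    obtain z where "z > x" "z < y" "\<phi>' y - \<phi>' x = (y - x) * \<phi>'' z"
      by blast
    moreover have "(y - x) * \<phi>'' z \<ge> (y - x) * l"
      using lower that calculation by (intro mult_left_mono) auto
    ultimately show ?thesis by (simp add: mult.commute)
  qed auto
  define d where "d = 1 / sqrt l"
  have d: "d > 0" "l * d = sqrt l" "2 * d + 3 / sqrt l + 3 / sqrt l = 8 / sqrt l"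
    using l by (auto simp: d_def field_simps)
  \<comment> \<open>One point covers all three cases: a zero of \<open>\<phi>'\<close> if there is
    one, otherwise the endpoint nearest to where it would be. The sign conditions are vacuous on a
    side of \<open>c\<close> that contains no points.\<close>
  obtain c where c: "a \<le> c" "c \<le> b"
      "\<And>x. a \<le> x \<Longrightarrow> x < c \<Longrightarrow> \<phi>' c \<le> 0" "\<And>x. c < x \<Longrightarrow> x \<le> b \<Longrightarrow> \<phi>' c \<ge> 0"
  proof -
    consider "\<phi>' a \<ge> 0" | "\<phi>' b \<le> 0" | "\<phi>' a \<le> 0" "\<phi>' b \<ge> 0" by linarith
    then show thesis
    proof cases
      case 1 then show thesis using ab by (intro that[of a]) auto
    next
      case 2 then show thesis using ab by (intro that[of b]) auto
    next
      case 3
      then obtain c where "a \<le> c" "c \<le> b" "\<phi>' c = 0" using IVT'[of \<phi>' a 0 b] c0 ab by auto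
      then show thesis by (intro that[of c]) auto
    qed
  qed
  define p where "p = max a (c - d)"
  define q where "q = min b (c + d)"
  have pq: "a \<le> p" "p \<le> q" "q \<le> b" "q - p \<le> 2 * d"
    using c d by (auto simp: p_def q_def)
  have int: "(\<lambda>x. cis (\<phi> x)) integrable_on {u..v}" for u v
    by (intro integrable_continuous_real continuous_intros c0)
  have eq: "integral {a..b} (\<lambda>x. cis (\<phi> x)) = integral {a..p} (\<lambda>x. cis (\<phi> x)) +
     integral {p..q} (\<lambda>x. cis (\<phi> x)) + integral {q..b} (\<lambda>x. cis (\<phi> x))"
    using Henstock_Kurzweil_Integration.integral_combine[of a p b "\<lambda>x. cis (\<phi> x)"]
      Henstock_Kurzweil_Integration.integral_combine[of p q b "\<lambda>x. cis (\<phi> x)"] pq int by (simp add: add.assoc)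
  have "norm (integral {a..p} (\<lambda>x. cis (\<phi> x))) \<le> 3 / sqrt l"
  proof (cases "c - d \<le> a")
    case True then show ?thesis using l by (simp add: p_def)
  next
    case False
    then have p: "p = c - d" by (simp add: p_def)
    have "\<phi>' x \<le> - sqrt l" if "x \<in> {a..p}" for x
    proof -
      have "l * (c - x) \<ge> l * d" using l that p by (intro mult_left_mono) auto
      then show ?thesis using growth[of x c] c(3)[of x] that p d c(1,2) by auto
    qed
    moreover have "\<phi>'' x \<ge> 0" if "x \<in> {a..p}" for x using lower[rule_format, of x] that pq l by auto
    ultimately show ?thesis
      using pq l continuous_on_subset[OF cont]
      by (intro van_der_corput_first[OF _ _ d1 d2]) auto
  qed
  moreover have "norm (integral {q..b} (\<lambda>x. cis (\<phi> x))) \<le> 3 / sqrt l"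
  proof (cases "c + d \<ge> b")
    case True then show ?thesis using l by (simp add: q_def)
  next
    case False
    then have q: "q = c + d" by (simp add: q_def)
    have "\<phi>' x \<ge> sqrt l" if "x \<in> {q..b}" for x
    proof -
      have "l * (x - c) \<ge> l * d" using l that q by (intro mult_left_mono) auto
      then show ?thesis using growth[of c x] c(4)[of x] that q d c(1,2) by auto
    qed
    moreover have "\<phi>'' x \<ge> 0" if "x \<in> {q..b}" for x using lower[rule_format, of x] that pq l by auto
    ultimately show ?thesis
      using pq l continuous_on_subset[OF cont]
      by (intro van_der_corput_first[OF _ _ d1 d2]) auto
  qed
  moreover have "norm (integral {p..q} (\<lambda>x. cis (\<phi> x))) \<le> 2 * d"
    using norm_integral_cis_le[OF pq(2) c0(1)] pq(4) by linarith
  ultimately have "norm (integral {a..b} (\<lambda>x. cis (\<phi> x))) \<le> 3 / sqrt l + 2 * d + 3 / sqrt l"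
    unfolding eq by (meson norm_triangle_ineq add_mono order_trans)
  then show ?thesis using d(3) by linarith
qed

lemma van_der_corput_second:
  fixes \<phi> \<phi>' \<phi>'' :: "real \<Rightarrow> real"
  assumes ab: "a \<le> b" and l: "l > 0"
    and d1: "\<And>x. (\<phi> has_real_derivative \<phi>' x) (at x)"
    and d2: "\<And>x. (\<phi>' has_real_derivative \<phi>'' x) (at x)"
    and cont: "continuous_on {a..b} \<phi>''"
    and lower: "(\<forall>x\<in>{a..b}. l \<le> \<phi>'' x) \<or> (\<forall>x\<in>{a..b}. \<phi>'' x \<le> -l)"
  shows "norm (integral {a..b} (\<lambda>x. cis (\<phi> x))) \<le> 8 / sqrt l"
  using lower
proof
  assume "\<forall>x\<in>{a..b}. l \<le> \<phi>'' x"
  then show ?thesis using assms van_der_corput_second_pos by blast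
next
  assume *: "\<forall>x\<in>{a..b}. \<phi>'' x \<le> -l"
  have "norm (integral {a..b} (\<lambda>x. cis (- \<phi> x))) \<le> 8 / sqrt l"
    by (rule van_der_corput_second_pos[of a b l "\<lambda>x. - \<phi> x" "\<lambda>x. - \<phi>' x" "\<lambda>x. - \<phi>'' x"])
      (use assms * in \<open>auto intro!: DERIV_minus continuous_intros\<close>)
  moreover have "integral {a..b} (\<lambda>x. cis (- \<phi> x)) = cnj (integral {a..b} (\<lambda>x. cis (\<phi> x)))"
    by (simp add: integral_cnj cis_cnj)
  ultimately show ?thesis by simp
qed

section \<open>The integral of the fifth power of an Airy function\<close>

text \<open>Gronwall for the energy \<open>E\<close>: its derivative is
  \<open>2 * w * w' * (1 - k * x)\<close>, hence at most \<open>K * E\<close> in absolute value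
  between \<open>a\<close> and \<open>x\<close>. The weights \<open>exp (- K * x)\<close> and
  \<open>exp (K * x)\<close> serve the two directions.\<close>

lemma airy_ode_zero_unique:
  fixes w w' :: "real \<Rightarrow> real"
  assumes k: "k \<ge> 0"
    and d1: "\<And>x. (w has_real_derivative w' x) (at x)"
    and d2: "\<And>x. (w' has_real_derivative - (k * x * w x)) (at x)"
    and a: "w a = 0" "w' a = 0"
  shows "w x = 0"
proof -
  define E where "E = (\<lambda>x. (w x)\<^sup>2 + (w' x)\<^sup>2)"
  define E' where "E' = (\<lambda>x. 2 * w x * w' x * (1 - k * x))"
  define K where "K = 1 + k * (\<bar>x\<bar> + \<bar>a\<bar>)"
  have dE: "(E has_real_derivative E' y) (at y)" for y
    unfolding E_def E'_def by (auto intro!: derivative_eq_intros d1 d2 simp: algebra_simps)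
  have E0: "E y \<ge> 0" for y by (simp add: E_def)
  have bound: "\<bar>E' y\<bar> \<le> K * E y" if "\<bar>y\<bar> \<le> \<bar>x\<bar> + \<bar>a\<bar>" for y
  proof -
    have "0 \<le> (\<bar>w y\<bar> - \<bar>w' y\<bar>)\<^sup>2" by simp
    then have 1: "2 * \<bar>w y\<bar> * \<bar>w' y\<bar> \<le> E y"
      unfolding E_def by (simp add: power2_diff)
    have "\<bar>k * y\<bar> \<le> k * (\<bar>x\<bar> + \<bar>a\<bar>)"
      unfolding abs_mult using k that by (intro mult_mono) auto
    then have 2: "\<bar>1 - k * y\<bar> \<le> K" unfolding K_def by linarith
    have "\<bar>E' y\<bar> = \<bar>1 - k * y\<bar> * (2 * \<bar>w y\<bar> * \<bar>w' y\<bar>)"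
      by (simp add: E'_def abs_mult)
    also have "\<dots> \<le> K * E y" by (rule mult_mono[OF 2 1]) (use 2 in auto)
    finally show ?thesis .
  qed
  have "E x \<le> 0"
  proof (cases "a \<le> x")
    case True
    have "E x * exp (- K * x) \<le> E a * exp (- K * a)"
    proof (rule DERIV_nonpos_imp_nonincreasing[OF True], intro exI conjI)
      fix y assume y: "a \<le> y" "y \<le> x"
      then have y': "\<bar>y\<bar> \<le> \<bar>x\<bar> + \<bar>a\<bar>" by linarith
      show "((\<lambda>x. E x * exp (- K * x)) has_real_derivative
          E' y * exp (- K * y) + E y * (- K * exp (- K * y))) (at y)"
        by (auto intro!: derivative_eq_intros dE)
      have "(E' y - K * E y) * exp (- K * y) \<le> 0"
        using bound[of y, OF y'] by (intro mult_nonpos_nonneg) auto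
      then show "E' y * exp (- K * y) + E y * (- K * exp (- K * y)) \<le> 0"
        by (simp add: algebra_simps)
    qed
    then show ?thesis using a by (simp add: E_def mult_le_0_iff)
  next
    case False
    then have "x \<le> a" by simp
    then have "E x * exp (K * x) \<le> E a * exp (K * a)"
    proof (rule DERIV_nonneg_imp_nondecreasing, intro exI conjI)
      fix y assume y: "x \<le> y" "y \<le> a"
      then have y': "\<bar>y\<bar> \<le> \<bar>x\<bar> + \<bar>a\<bar>" by linarith
      show "((\<lambda>x. E x * exp (K * x)) has_real_derivative
          E' y * exp (K * y) + E y * (K * exp (K * y))) (at y)"
        by (auto intro!: derivative_eq_intros dE)
      have "(E' y + K * E y) * exp (K * y) \<ge> 0"
        using bound[of y, OF y'] by (intro mult_nonneg_nonneg) auto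
      then show "E' y * exp (K * y) + E y * (K * exp (K * y)) \<ge> 0"
        by (simp add: algebra_simps)
    qed
    then show ?thesis using a by (simp add: E_def mult_le_0_iff)
  qed
  then show ?thesis unfolding E_def by (smt (verit) zero_le_power2 power2_eq_iff_nonneg power_zero_numeral zero_less_power2)
qed

text \<open>Sturm comparison across a zero \<open>a\<close>: to the left of \<open>a\<close> the coefficient \<open>k * x\<close> is smaller
  than at the reflected point, so the arch on the left dominates the arch on the right.\<close>

lemma airy_reflection_le:
  fixes w w' :: "real \<Rightarrow> real"
  assumes k: "k \<ge> 0"
    and d1: "\<And>x. (w has_real_derivative w' x) (at x)"
    and d2: "\<And>x. (w' has_real_derivative - (k * x * w x)) (at x)"
    and a: "w a = 0" "w' a < 0"
    and neg: "\<And>x. a < x \<Longrightarrow> x < b \<Longrightarrow> w x < 0"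
    and u: "0 < u" "u < b - a"
  shows "- w (a + u) \<le> w (a - u)"
proof -
  define \<beta> where "\<beta> = b - a"
  define f where "f = (\<lambda>u. w (a - u))"
  define g where "g = (\<lambda>u. - w (a + u))"
  define f' where "f' = (\<lambda>u. - w' (a - u))"
  define g' where "g' = (\<lambda>u. - w' (a + u))"
  have left: "((\<lambda>u. h (a - u)) has_real_derivative - h' (a - x)) (at x)"
    if "\<And>x. (h has_real_derivative h' x) (at x)" for h h' :: "real \<Rightarrow> real" and x
    using DERIV_chain2[OF that DERIV_diff[OF DERIV_const DERIV_ident], of a x UNIV] by simp
  have right: "((\<lambda>u. h (a + u)) has_real_derivative h' (a + x)) (at x)"
    if "\<And>x. (h has_real_derivative h' x) (at x)" for h h' :: "real \<Rightarrow> real" and x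
    using DERIV_chain2[OF that DERIV_add[OF DERIV_const DERIV_ident], of a x UNIV] by simp
  have df: "(f has_real_derivative f' x) (at x)" for x
    unfolding f_def f'_def by (rule left[OF d1])
  have dg: "(g has_real_derivative g' x) (at x)" for x
    unfolding g_def g'_def by (rule DERIV_minus[OF right[OF d1]])
  have df': "(f' has_real_derivative - (k * (a - x) * f x)) (at x)" for x
    using DERIV_minus[OF left[OF d2]] unfolding f_def f'_def by simp
  have dg': "(g' has_real_derivative - (k * (a + x) * g x)) (at x)" for x
    using DERIV_minus[OF right[OF d2]] unfolding g_def g'_def by simp
  have gpos: "g x > 0" if "0 < x" "x < \<beta>" for x
    using neg[of "a + x"] that by (auto simp: g_def \<beta>_def)
  have z: "f 0 = 0" "g 0 = 0" "f' 0 = - w' a" "g' 0 = - w' a"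
    using a by (auto simp: f_def g_def f'_def g'_def)
  \<comment> \<open>Wronskian of the two reflected arches. Its derivative has the sign of
    \<open>f * g\<close> because the coefficients at \<open>a - x\<close> and \<open>a + x\<close>
    differ by \<open>2 * k * x\<close>; it is the numerator of the derivative of
    \<open>f / g\<close>.\<close>
  define W where "W = (\<lambda>x. f' x * g x - f x * g' x)"
  have dW: "(W has_real_derivative 2 * k * x * (f x * g x)) (at x)" for x
    unfolding W_def
    by (auto intro!: derivative_eq_intros df dg df' dg' simp: algebra_simps)
  define R where "R = (\<lambda>x. f x / g x)"
  have mono: "R x \<le> R y" if xy: "0 < x" "x \<le> y" "y < \<beta>" and fp: "\<And>t. 0 < t \<Longrightarrow> t \<le> y \<Longrightarrow> f t \<ge> 0" for x y
  proof (rule DERIV_nonneg_imp_nondecreasing[OF xy(2)], intro exI conjI)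
    fix t assume t: "x \<le> t" "t \<le> y"
    have gt: "g t > 0" using gpos t xy by auto
    show "(R has_real_derivative W t / (g t)\<^sup>2) (at t)"
      unfolding R_def W_def using gt
      by (auto intro!: derivative_eq_intros df dg simp: power2_eq_square)
    have "W 0 \<le> W t"
    proof (rule DERIV_nonneg_imp_nondecreasing[of 0 t W])
      fix s assume s: "0 \<le> s" "s \<le> t"
      have "f s * g s \<ge> 0"
        using fp[of s] gpos[of s] s t xy z by (cases "s = 0") (auto intro!: mult_nonneg_nonneg less_imp_le)
      then show "\<exists>y. (W has_real_derivative y) (at s) \<and> 0 \<le> y"
        using dW[of s] k s mult_nonneg_nonneg[of "2 * k * s"] by auto
    qed (use t xy in auto)
    then show "W t / (g t)\<^sup>2 \<ge> 0" by (simp add: W_def z)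
  qed
  have fpos: "f x > 0" if x: "0 < x" "x < \<beta>" for x
  proof (rule ccontr)
    assume "\<not> f x > 0"
    then have fx: "f x \<le> 0" by simp
    obtain d where d: "d > 0" "\<And>h. 0 < h \<Longrightarrow> h < d \<Longrightarrow> f 0 < f (0 + h)"
      using DERIV_pos_inc_right[OF df[of 0]] z a by auto
    \<comment> \<open>\<open>f\<close> vanishes at 0 itself, so the search for its first nonpositive
      point starts at some \<open>e\<close> up to which \<open>f\<close> is already known to be
      positive.\<close>
    define e where "e = min (d / 2) x"
    have e: "0 < e" "e \<le> x" "e < d" using d x by (auto simp: e_def)
    define Z where "Z = {y\<in>{e..x}. f y \<le> 0}"
    have "closed Z" unfolding Z_def
      using df by (intro continuous_on_closed_Collect_le continuous_intros)
        (auto intro!: continuous_at_imp_continuous_on DERIV_isCont)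
    then have "compact Z" by (rule compact_eq_bounded_closed[THEN iffD2, OF conjI, rotated])
        (auto simp: Z_def intro: bounded_subset[of "{e..x}"])
    moreover have "x \<in> Z" using fx e by (auto simp: Z_def)
    ultimately obtain c where c: "c \<in> Z" "\<And>y. y \<in> Z \<Longrightarrow> c \<le> y"
      using compact_attains_inf[of Z] by auto
    have c0: "0 < c" "c < \<beta>" "f c \<le> 0" using c e x by (auto simp: Z_def)
    have fp: "f t > 0" if "0 < t" "t < c" for t
    proof (cases "t < e")
      case True then show ?thesis using d(2)[of t] that e z by auto
    next
      case False
      then show ?thesis using c(2)[of t] c(1) that by (force simp: Z_def)
    qed
    \<comment> \<open>\<open>mono\<close> requires \<open>f\<close> to be nonnegative up to the
      right end, which is in doubt only at \<open>c\<close>; so it is applied before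
      \<open>c\<close> and passed to the left limit.\<close>
    have "R (c / 2) \<le> R c"
    proof (rule tendsto_lowerbound)
      have "isCont R c" unfolding R_def
        using gpos[of c] c0 df dg by (intro continuous_intros) (auto intro: DERIV_isCont)
      then show "(R \<longlongrightarrow> R c) (at_left c)"
        by (simp add: continuous_within filterlim_at_split isCont_def)
      show "\<forall>\<^sub>F t in at_left c. R (c / 2) \<le> R t"
        unfolding eventually_at_left_field
      proof (intro exI[of _ "c/2"] conjI allI impI)
        fix t assume t: "c / 2 < t" "t < c"
        show "R (c / 2) \<le> R t" by (rule mono) (use c0 fp t in \<open>auto simp: less_imp_le\<close>)
      qed (use c0 in auto)
    qed simp
    moreover have "R (c / 2) > 0" using fp[of "c/2"] gpos[of "c/2"] c0 by (simp add: R_def)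
    moreover have "R c \<le> 0" using gpos[of c] c0 by (simp add: R_def divide_nonpos_pos)
    ultimately show False by simp
  qed
  \<comment> \<open>Both arches leave the zero \<open>a\<close> with the same slope
    \<open>- w' a\<close>, so their ratio starts at 1 and can only grow.\<close>
  have "(R \<longlongrightarrow> 1) (at_right 0)"
  proof -
    have "((\<lambda>h. (f (0 + h) - f 0) / h) \<longlongrightarrow> - w' a) (at 0)" "((\<lambda>h. (g (0 + h) - g 0) / h) \<longlongrightarrow> - w' a) (at 0)"
      using df[of 0] dg[of 0] z unfolding DERIV_def by auto
    then have "((\<lambda>h. (f h / h) / (g h / h)) \<longlongrightarrow> (- w' a) / (- w' a)) (at 0)"
      using a z by (intro tendsto_divide) auto
    then have "((\<lambda>h. (f h / h) / (g h / h)) \<longlongrightarrow> 1) (at_right 0)"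
      using a filterlim_at_split by auto
    moreover have "\<forall>\<^sub>F h in at_right 0. (f h / h) / (g h / h) = R h"
      unfolding eventually_at_right_field by (rule exI[of _ 1]) (auto simp: R_def)
    ultimately show ?thesis by (simp add: tendsto_cong)
  qed
  then have "1 \<le> R u"
  proof (rule tendsto_upperbound)
    show "\<forall>\<^sub>F t in at_right 0. R t \<le> R u"
      unfolding eventually_at_right_field
    proof (intro exI[of _ u] conjI allI impI)
      fix t assume t: "0 < t" "t < u"
      show "R t \<le> R u" by (rule mono) (use u fpos t in \<open>auto simp: less_imp_le \<beta>_def\<close>)
    qed (use u in auto)
  qed simp
  then show ?thesis using gpos[of u] u by (simp add: R_def f_def g_def \<beta>_def field_simps)
qed

text \<open>Sturm comparison with \<open>sin (x - p)\<close>: for \<open>x\<close> at least 1 the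
  coefficient \<open>k * x\<close> is at least 1, so \<open>w\<close> must change sign within a
  half-period of the sine. \<open>H\<close> is the Wronskian of the two; it would be nondecreasing
  although it is positive at \<open>p\<close> and negative at \<open>p + pi\<close>.\<close>

lemma airy_no_long_negative_arch:
  fixes w w' :: "real \<Rightarrow> real"
  assumes k: "k \<ge> 1"
    and d1: "\<And>x. (w has_real_derivative w' x) (at x)"
    and d2: "\<And>x. (w' has_real_derivative - (k * x * w x)) (at x)"
    and p: "p \<ge> 1"
    and neg: "\<And>x. p \<le> x \<Longrightarrow> x \<le> p + pi \<Longrightarrow> w x < 0"
  shows False
proof -
  define H where "H = (\<lambda>x. w' x * sin (x - p) - w x * cos (x - p))"
  have "H p \<le> H (p + pi)"
  proof (rule DERIV_nonneg_imp_nondecreasing, simp, intro exI conjI)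
    fix x assume x: "p \<le> x" "x \<le> p + pi"
    show "(H has_real_derivative (1 - k * x) * w x * sin (x - p)) (at x)"
      unfolding H_def by (auto intro!: derivative_eq_intros d1 d2 simp: algebra_simps)
    have "1 * 1 \<le> k * x" using k x p by (intro mult_mono) auto
    then have "(1 - k * x) * w x \<ge> 0"
      using neg[of x] x by (intro mult_nonpos_nonpos) auto
    moreover have "sin (x - p) \<ge> 0" using x by (intro sin_ge_zero) auto
    ultimately show "(1 - k * x) * w x * sin (x - p) \<ge> 0" by simp
  qed
  moreover have "H p = - w p" "H (p + pi) = w (p + pi)" by (auto simp: H_def)
  ultimately show False using neg[of p] neg[of "p + pi"] by auto
qed

text \<open>Let \<open>S\<close> be the primitive of \<open>w ^ 5\<close> that vanishes at minus
  infinity. It suffices that \<open>S\<close> never falls below the positive value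
  \<open>S (- M)\<close> on the right half-line. At the first point \<open>b\<close> where it
  reaches a lower value, \<open>b\<close> lies in or at the end of a negative arch; reflecting in
  the zero \<open>a\<close> where that arch begins yields an earlier value that is no larger.
  Working with a first point avoids enumerating the zeros of \<open>w\<close>.\<close>

theorem airy_fifth_power_integral_pos:
  fixes w w' :: "real \<Rightarrow> real"
  assumes k: "k \<ge> 1"
    and d1: "\<And>x. (w has_real_derivative w' x) (at x)"
    and d2: "\<And>x. (w' has_real_derivative - (k * x * w x)) (at x)"
    and pos: "\<And>x. x \<le> 0 \<Longrightarrow> w x > 0"
    and int: "integrable lborel (\<lambda>x. w x ^ 5)"
  shows "0 < (LINT x|lborel. w x ^ 5)"
proof -
  define F where "F = (\<lambda>x. w x ^ 5)"
  have cw: "isCont w x" for x using d1 DERIV_isCont by blast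
  have cwo: "continuous_on A w" for A
    using cw by (simp add: continuous_at_imp_continuous_on)
  have cF: "continuous_on A F" for A unfolding F_def
    by (intro continuous_intros cwo)
  have iF: "set_integrable lborel A F" if "A \<in> sets borel" for A
    unfolding set_integrable_def using int that unfolding F_def by (intro integrable_mult_indicator) auto
  define S where "S = (\<lambda>X. LINT x:{..X}|lborel. F x)"
  have S_diff: "S y = S c + integral {c..y} F" if "c \<le> y" for c y
  proof -
    have "S y = S c + (LINT x:{c<..y}|lborel. F x)"
    proof -
      have "{..y} = {..c} \<union> {c<..y}" using that by auto
      moreover have "{..c} \<inter> {c<..y} = {}" by auto
      ultimately show ?thesis unfolding S_def
        by (simp only: set_integral_Un iF borel_measurable_const atMost_borel greaterThanAtMost_borel)
    qed
    also have "(LINT x:{c<..y}|lborel. F x) = (LINT x:{c..y}|lborel. F x)"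
      unfolding set_lebesgue_integral_def
      by (rule integral_cong_AE) (use AE_lborel_singleton[of c] int in \<open>auto simp: F_def indicator_def\<close>)
    also have "\<dots> = integral {c..y} F"
      using set_borel_integral_eq_integral(2)[OF iF] by simp
    finally show ?thesis .
  qed
  have dS: "(S has_real_derivative w x ^ 5) (at x)" for x
  proof -
    have "((\<lambda>y. S (x - 1) + integral {x-1..y} F) has_real_derivative F x) (at x within {x-1..x+1})"
      using DERIV_add[OF DERIV_const integral_has_real_derivative[OF cF, of x "x-1" "x+1"]] by simp
    then have 1: "((\<lambda>y. S (x - 1) + integral {x-1..y} F) has_real_derivative F x) (at x)"
      by (simp add: at_within_Icc_at)
    have 2: "\<forall>\<^sub>F y in nhds x. S (x - 1) + integral {x-1..y} F = S y"
      by (rule eventually_mono[OF eventually_nhds_in_open[of "{x-1<..}"]]) (auto intro!: S_diff[symmetric])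
    show ?thesis
      using DERIV_cong_ev[OF refl 2 refl, THEN iffD1, OF 1] by (simp add: F_def)
  qed
  have cS: "continuous_on A S" for A
    by (intro continuous_at_imp_continuous_on) (use dS DERIV_isCont in blast)
  have S_mono: "S x \<le> S y" if "x \<le> y" "\<And>t. x < t \<Longrightarrow> t < y \<Longrightarrow> w t \<ge> 0" for x y
  proof (cases "x = y")
    case False
    show ?thesis
    proof (rule DERIV_nonneg_imp_nondecreasing[OF that(1)])
      fix t assume t: "x \<le> t" "t \<le> y"
      have "w t \<ge> 0"
      proof -
        have "closed {t. 0 \<le> w t}"
          by (intro closed_Collect_le continuous_intros cwo)
        moreover have "{x<..<y} \<subseteq> {t. 0 \<le> w t}" using that(2) by auto
        ultimately have "closure {x<..<y} \<subseteq> {t. 0 \<le> w t}" by (rule closure_minimal[rotated])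
        then show ?thesis using t that(1) False by (auto simp: closure_greaterThanLessThan)
      qed
      then show "\<exists>z. (S has_real_derivative z) (at t) \<and> 0 \<le> z" using dS by fastforce
    qed
  qed simp
  \<comment> \<open>If the reflected point falls beyond \<open>- M\<close>, the negative arch is
    longer than \<open>pi + 1\<close>: 1 to reach the region where the coefficient
    \<open>k * x\<close> is at least 1, and \<open>pi\<close> for the comparison with the
    sine.\<close>
  define M where "M = pi + 1"
  have M: "M > 0" using pi_gt_zero unfolding M_def by linarith
  have S_M: "S (- M) > 0"
  proof -
    have 0: "S c \<ge> 0" if "c \<le> 0" for c
      unfolding S_def set_lebesgue_integral_def
      by (intro Bochner_Integration.integral_nonneg) (use that pos in \<open>auto simp: indicator_def F_def intro: less_imp_le\<close>)
    have "S (- M - 1) < S (- M)"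
      by (rule DERIV_pos_imp_increasing[of "- M - 1" "- M"]) (use dS pos M in \<open>force+\<close>)
    then show ?thesis using 0[of "- M - 1"] M by auto
  qed
  have lower: "S X \<ge> S (- M)" if X: "X \<ge> 0" for X
  proof (rule ccontr)
    assume "\<not> S X \<ge> S (- M)"
    then have SX: "S X < S (- M)" by simp
    \<comment> \<open>Its least element \<open>b\<close> is the first point of \<open>{0..X}\<close>
      at which \<open>S\<close> is as low as at \<open>X\<close>.\<close>
    define T where "T = {y\<in>{0..X}. S y \<le> S X}"
    have "closed T" unfolding T_def
      by (intro continuous_on_closed_Collect_le continuous_intros cS)
    then have "compact T" by (rule compact_eq_bounded_closed[THEN iffD2, OF conjI, rotated])
        (auto simp: T_def intro: bounded_subset[of "{0..X}"])
    moreover have "X \<in> T" using X by (auto simp: T_def)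
    ultimately obtain b where b: "b \<in> T" "\<And>y. y \<in> T \<Longrightarrow> b \<le> y"
      using compact_attains_inf[of T] by auto
    have b0: "0 \<le> b" "b \<le> X" "S b \<le> S X" using b by (auto simp: T_def)
    have first: "S y > S b" if "0 \<le> y" "y < b" for y
      using b(2)[of y] that b0 by (force simp: T_def)
    have small: "S y \<ge> S (- M)" if "- M \<le> y" "y \<le> 0" for y
      by (rule S_mono) (use pos that in \<open>auto simp: less_imp_le\<close>)
    have "b \<noteq> 0" using small[of 0] M b0 SX by auto
    then have bp: "b > 0" using b0 by auto
    have not_pos: False if "d > 0" "\<And>h. 0 < h \<Longrightarrow> h < d \<Longrightarrow> w (b - h) \<ge> 0" for d
    proof -
      define y where "y = max (b - d) 0"
      have y: "0 \<le> y" "y < b" "b - d \<le> y" using bp that by (auto simp: y_def)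
      have "S y \<le> S b"
        using that(2)[of "b - t" for t] y by (intro S_mono) force+
      then show False using first[OF y(1,2)] by simp
    qed
    \<comment> \<open>\<open>S\<close> must decrease into its first low point, so \<open>w\<close>
      cannot be nonnegative just before \<open>b\<close>. A double zero at \<open>b\<close> is
      excluded by uniqueness; in every other case the sign to the left of \<open>b\<close> is
      constant.\<close>
    have "\<exists>d>0. \<forall>h. 0 < h \<longrightarrow> h < d \<longrightarrow> w (b - h) < 0"
    proof -
      have wb: "(w \<longlongrightarrow> w b) (nhds b)"
        using cw[of b] by (simp add: isCont_def tendsto_at_iff_tendsto_nhds)
      consider "w b > 0" | "w b < 0" | "w b = 0" "w' b < 0" | "w b = 0" "w' b > 0"
        | "w b = 0" "w' b = 0" by linarith
      then show ?thesis
      proof cases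
        case 1
        obtain d where "d > 0" "\<And>y. dist y b < d \<Longrightarrow> w y > 0"
          using order_tendstoD(1)[OF wb 1] unfolding eventually_nhds_metric by auto
        then show ?thesis using not_pos[of d] by (auto simp: dist_real_def less_imp_le)
      next
        case 2
        obtain d where "d > 0" "\<And>y. dist y b < d \<Longrightarrow> w y < 0"
          using order_tendstoD(2)[OF wb 2] unfolding eventually_nhds_metric by auto
        then show ?thesis by (intro exI[of _ d]) (auto simp: dist_real_def)
      next
        case 3
        then obtain d where "d > 0" "\<And>h. 0 < h \<Longrightarrow> h < d \<Longrightarrow> w b < w (b - h)"
          using DERIV_neg_dec_left[OF d1[of b]] by auto
        then show ?thesis using not_pos[of d] 3 by force
      next
        case 4
        then show ?thesis using DERIV_pos_inc_left[OF d1[of b]] by auto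
      next
        case 5
        then show ?thesis using airy_ode_zero_unique[OF _ d1 d2, of b 0] k pos[of 0] by auto
      qed
    qed
    then obtain d where d: "d > 0" "\<And>h. 0 < h \<Longrightarrow> h < d \<Longrightarrow> w (b - h) < 0" by auto
    define m where "m = max (b - d / 2) (b / 2)"
    have m: "0 < m" "m < b" "b - m < d" using d bp by (auto simp: m_def max_def)
    have wm: "w y < 0" if "m \<le> y" "y < b" for y using d(2)[of "b - y"] m that by auto
    \<comment> \<open>The last nonnegative point before \<open>m\<close> is the zero at which the
      negative arch through \<open>m\<close> begins.\<close>
    define Z where "Z = {y\<in>{0..m}. 0 \<le> w y}"
    have "closed Z" unfolding Z_def
      by (intro continuous_on_closed_Collect_le continuous_intros cwo)
    then have "compact Z" by (rule compact_eq_bounded_closed[THEN iffD2, OF conjI, rotated])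
        (auto simp: Z_def intro: bounded_subset[of "{0..m}"])
    moreover have "0 \<in> Z" using m pos[of 0] by (auto simp: Z_def)
    ultimately obtain a where a: "a \<in> Z" "\<And>y. y \<in> Z \<Longrightarrow> y \<le> a"
      using compact_attains_sup[of Z] by auto
    have a0: "0 \<le> a" "a \<le> m" "0 \<le> w a" using a by (auto simp: Z_def)
    have neg: "w x < 0" if "a < x" "x < b" for x
      using a(2)[of x] wm[of x] that a0 by (force simp: Z_def)
    have wa: "w a = 0"
    proof -
      obtain z where "a \<le> z" "z \<le> m" "w z = 0"
        using IVT2'[of w m 0 a] wm[of m] m a0 cwo by auto
      then show ?thesis using a(2)[of z] a0 by (force simp: Z_def)
    qed
    have w'a: "w' a < 0"
    proof (rule ccontr)
      assume "\<not> w' a < 0"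
      then consider "w' a = 0" | "w' a > 0" by linarith
      then show False
      proof cases
        case 1
        then show ?thesis using airy_ode_zero_unique[OF _ d1 d2 wa, of 0] k pos[of 0] by auto
      next
        case 2
        then obtain e where e: "e > 0" "\<And>h. 0 < h \<Longrightarrow> h < e \<Longrightarrow> w a < w (a + h)"
          using DERIV_pos_inc_right[OF d1[of a]] by auto
        define h where "h = min (e / 2) ((b - a) / 2)"
        have ba: "0 < b - a" using a0 m by auto
        have h0: "0 < h" "h \<le> e / 2" using e(1) ba unfolding h_def by simp_all
        have "h \<le> (b - a) / 2" unfolding h_def by (rule min.cobounded2)
        also have "\<dots> < b - a" using ba by simp
        finally have h: "0 < h" "h < e" "a + h < b" using h0 e(1) by auto
        show False using neg[of "a + h"] e(2)[of h] wa h by auto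
      qed
    qed
    \<comment> \<open>The loss of \<open>S\<close> on the arch from \<open>a\<close> to
      \<open>b\<close> is at most its gain on the mirror image from \<open>2 * a - b\<close> to
      \<open>a\<close>.\<close>
    have refl: "S (2 * a - b) \<le> S b"
    proof -
      have "S (a + 0) - S (a - 0) \<le> S (a + (b - a)) - S (a - (b - a))"
      proof (rule DERIV_nonneg_imp_nondecreasing[of 0 "b - a" "\<lambda>u. S (a + u) - S (a - u)"])
        fix u assume u: "0 \<le> u" "u \<le> b - a"
        have "((\<lambda>u. S (a + u) - S (a - u)) has_real_derivative w (a + u) ^ 5 + w (a - u) ^ 5) (at u)"
          using DERIV_diff[OF DERIV_chain2[OF dS DERIV_add[OF DERIV_const DERIV_ident], of a u UNIV]
            DERIV_chain2[OF dS DERIV_diff[OF DERIV_const DERIV_ident], of a u UNIV]] by simp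
        moreover have "w (a + u) ^ 5 + w (a - u) ^ 5 \<ge> 0"
        proof -
          have le: "- w (a + v) \<le> w (a - v)" if "0 < v" "v < b - a" for v
            using airy_reflection_le[OF _ d1 d2 wa w'a neg that] k by auto
          have "closed {v. - w (a + v) \<le> w (a - v)}"
            by (intro closed_Collect_le continuous_intros continuous_on_compose2[OF cwo, of UNIV]) auto
          moreover have "{0<..<b-a} \<subseteq> {v. - w (a + v) \<le> w (a - v)}" using le by auto
          ultimately have "closure {0<..<b-a} \<subseteq> {v. - w (a + v) \<le> w (a - v)}"
            by (rule closure_minimal[rotated])
          then have "- w (a + u) \<le> w (a - u)"
            using u a0 m by (auto simp: closure_greaterThanLessThan)
          then have "(- w (a + u)) ^ 5 \<le> w (a - u) ^ 5" by (intro power_mono_odd) auto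
          then show ?thesis by simp
        qed
        ultimately show "\<exists>z. ((\<lambda>u. S (a + u) - S (a - u)) has_real_derivative z) (at u) \<and> 0 \<le> z" by blast
      qed (use a0 m in auto)
      then show ?thesis by (simp add: algebra_simps)
    qed
    show False
    proof (cases "2 * a - b \<ge> 0")
      case True
      then show ?thesis using first[of "2 * a - b"] refl a0 m by auto
    next
      case False
      then have "2 * a - b < - M" using small[of "2 * a - b"] refl b0 SX by force
      then have "a + 1 + pi < b" using a0 by (simp add: M_def)
      then show False
        using airy_no_long_negative_arch[OF k d1 d2, of "a + 1"] neg a0 by auto
    qed
  qed
  have "(S \<longlongrightarrow> (LINT x|lborel. F x)) at_top"
    unfolding S_def set_lebesgue_integral_def
  proof (rule integral_dominated_convergence_at_top[where w = "\<lambda>x. \<bar>F x\<bar>"])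
    show "AE x in lborel. ((\<lambda>t. indicat_real {..t} x *\<^sub>R F x) \<longlongrightarrow> F x) at_top"
    proof (rule AE_I2, rule tendsto_eventually)
      fix x :: real
      show "\<forall>\<^sub>F t in at_top. indicat_real {..t} x *\<^sub>R F x = F x"
        using eventually_ge_at_top[of x] by eventually_elim auto
    qed
  qed (use int in \<open>auto simp: F_def indicator_def\<close>)
  then have "S (- M) \<le> (LINT x|lborel. F x)"
    by (rule tendsto_lowerbound) (auto intro!: eventually_at_top_linorderI[of 0] lower)
  then show ?thesis using S_M by (simp add: F_def)
qed

section \<open>Uniform bounds for the Bessel integral\<close>

text \<open>For an integer order this is \<open>2 * pi * \<i> ^ n\<close> times the Bessel function
  of the first kind. For general \<open>\<tau>\<close> it resembles the Anger function, taken over a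
  shifted period. The turning point is \<open>z = \<tau>\<close>, where the stationary points
  \<open>sin \<xi> = \<tau> / z\<close> merge at \<open>pi / 2\<close>.\<close>

definition anger :: "real \<Rightarrow> real \<Rightarrow> complex" where
  "anger \<tau> z = integral {-pi..pi} (\<lambda>\<xi>. cis (\<tau> * \<xi> + z * cos \<xi>))"

lemma anger_vdc_first:
  assumes "a \<le> b" "l > 0" "z \<ge> 0"
    and "(\<forall>x\<in>{a..b}. l \<le> \<tau> - z * sin x) \<or> (\<forall>x\<in>{a..b}. \<tau> - z * sin x \<le> - l)"
    and "(\<forall>x\<in>{a..b}. 0 \<le> cos x) \<or> (\<forall>x\<in>{a..b}. cos x \<le> 0)"
  shows "norm (integral {a..b} (\<lambda>\<xi>. cis (\<tau> * \<xi> + z * cos \<xi>))) \<le> 3 / l"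
proof (rule van_der_corput_first[where \<phi>' = "\<lambda>x. \<tau> - z * sin x" and \<phi>'' = "\<lambda>x. - (z * cos x)"])
  show "(\<forall>x\<in>{a..b}. 0 \<le> - (z * cos x)) \<or> (\<forall>x\<in>{a..b}. - (z * cos x) \<le> 0)"
    using assms(3,5) by (auto simp: mult_le_0_iff)
qed (use assms in \<open>auto intro!: derivative_eq_intros continuous_intros\<close>)

lemma anger_vdc_second:
  assumes "a \<le> b" "l > 0"
    and "(\<forall>x\<in>{a..b}. l\<^sup>2 \<le> z * cos x) \<or> (\<forall>x\<in>{a..b}. z * cos x \<le> - l\<^sup>2)"
  shows "norm (integral {a..b} (\<lambda>\<xi>. cis (\<tau> * \<xi> + z * cos \<xi>))) \<le> 8 / l"
proof -
  have "norm (integral {a..b} (\<lambda>\<xi>. cis (\<tau> * \<xi> + z * cos \<xi>))) \<le> 8 / sqrt (l\<^sup>2)"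
  proof (rule van_der_corput_second[where \<phi>' = "\<lambda>x. \<tau> - z * sin x" and \<phi>'' = "\<lambda>x. - (z * cos x)"])
    show "(\<forall>x\<in>{a..b}. l\<^sup>2 \<le> - (z * cos x)) \<or> (\<forall>x\<in>{a..b}. - (z * cos x) \<le> - l\<^sup>2)"
      using assms(3) by force
  qed (use assms in \<open>auto intro!: derivative_eq_intros continuous_intros\<close>)
  then show ?thesis using assms by simp
qed

lemma norm_integral_split_le:
  fixes f :: "real \<Rightarrow> complex"
  assumes "a \<le> b" "b \<le> c" "continuous_on {a..c} f"
  shows "norm (integral {a..c} f) \<le> norm (integral {a..b} f) + norm (integral {b..c} f)"
proof -
  have "integral {a..c} f = integral {a..b} f + integral {b..c} f"
    using assms by (simp add: Henstock_Kurzweil_Integration.integral_combine integrable_continuous_real)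
  then show ?thesis by (simp add: norm_triangle_ineq)
qed

section \<open>Elementary bounds for sine and cosine\<close>

lemma sin_ge_half: "sin x \<ge> x / 2" if "0 \<le> x" "x \<le> 1" for x :: real
proof -
  have "sin 0 - 0 / 2 \<le> sin x - x / 2"
  proof (rule DERIV_nonneg_imp_nondecreasing[OF that(1), of "\<lambda>x. sin x - x / 2"], intro exI conjI)
    fix t :: real assume t: "0 \<le> t" "t \<le> x"
    show "((\<lambda>x. sin x - x / 2) has_real_derivative cos t - 1 / 2) (at t)"
      by (auto intro!: derivative_eq_intros)
    have "cos (pi / 3) \<le> cos t" using t that pi_gt3 by (intro cos_monotone_0_pi_le) auto
    then show "cos t - 1 / 2 \<ge> 0" by (simp add: cos_60)
  qed
  then show ?thesis by simp
qed

lemma one_minus_cos_le: "1 - cos x \<le> x\<^sup>2 / 2" for x :: real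
proof -
  have "(sin (x / 2))\<^sup>2 \<le> (x / 2)\<^sup>2"
    using abs_le_square_iff[THEN iffD1, OF abs_sin_x_le_abs_x[of "x / 2"]] .
  moreover have "1 - cos x = 2 * (sin (x / 2))\<^sup>2"
    using cos_double_sin[of "x / 2"] by simp
  ultimately show ?thesis by (simp add: power_divide)
qed

text \<open>The three ranges of \<open>r\<close> are the non-stationary one, the one with two well separated
  stationary points, and the Airy range around the degenerate stationary point \<open>pi / 2\<close>.\<close>

lemma anger_bound:
  assumes l: "l \<ge> 1" and r: "r \<ge> 0" and q: "q \<ge> 1" "q ^ 4 = max 1 (l\<^sup>2 * \<bar>r - 1\<bar>)"
  shows "norm (anger (l ^ 3) (l ^ 3 * r\<^sup>2)) \<le> 120 / (l * q)"
proof -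
  \<comment> \<open>With \<open>s = l\<^sup>2 * (r - 1)\<close>, the number \<open>q\<close> is the
    fourth root of \<open>max 1 \<bar>s\<bar>\<close>: the claim is Airy decay
    \<open>\<bar>s\<bar>\<close> to the power -1/4 on the scale \<open>1 / l\<close>.\<close>
  define \<tau> where "\<tau> = l ^ 3"
  define z where "z = \<tau> * r\<^sup>2"
  define f where "f = (\<lambda>\<xi>. cis (\<tau> * \<xi> + z * cos \<xi>))"
  define J where "J = (\<lambda>a b. norm (integral {a..b} f))"
  have cf: "continuous_on A f" for A unfolding f_def by (intro continuous_intros)
  have split: "J a c \<le> J a b + J b c" if "a \<le> b" "b \<le> c" for a b c
    unfolding J_def by (rule norm_integral_split_le[OF that cf])
  have vdc1: "J a b \<le> 3 / k" if "a \<le> b" "k > 0" "z \<ge> 0"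
    "(\<forall>x\<in>{a..b}. k \<le> \<tau> - z * sin x) \<or> (\<forall>x\<in>{a..b}. \<tau> - z * sin x \<le> - k)"
    "(\<forall>x\<in>{a..b}. 0 \<le> cos x) \<or> (\<forall>x\<in>{a..b}. cos x \<le> 0)" for a b k
    unfolding J_def f_def by (rule anger_vdc_first[OF that])
  have vdc2: "J a b \<le> 8 / k" if "a \<le> b" "k > 0"
    "(\<forall>x\<in>{a..b}. k\<^sup>2 \<le> z * cos x) \<or> (\<forall>x\<in>{a..b}. z * cos x \<le> - k\<^sup>2)" for a b k
    unfolding J_def f_def by (rule anger_vdc_second[OF that])
  have \<tau>: "\<tau> \<ge> 1" "\<tau> > 0" using one_le_power[OF l, of 3] l by (auto simp: \<tau>_def)
  have z: "z \<ge> 0" using \<tau> by (simp add: z_def)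
  have lq: "l * q \<ge> 1" using mult_mono[of 1 l 1 q] l q by auto
  have pi3: "pi > 3" "pi < 4" by (rule pi_gt3) (use pi_less_4 in auto)
  have cos_neg: "cos x \<le> 0" if "pi / 2 \<le> \<bar>x\<bar>" "\<bar>x\<bar> \<le> pi" for x
  proof -
    have "cos \<bar>x\<bar> \<le> cos (pi / 2)" using that pi3 by (intro cos_monotone_0_pi_le) auto
    then show ?thesis by simp
  qed
  have cos_pos: "cos x \<ge> 0" if "\<bar>x\<bar> \<le> pi / 2" for x
    using that by (intro cos_ge_zero) auto
  have sin_neg: "sin x \<le> 0" if "- pi \<le> x" "x \<le> 0" for x
    using sin_ge_zero[of "- x"] that by auto
  \<comment> \<open>Pieces without a stationary point cost \<open>1 / \<tau>\<close>; this is
    affordable because \<open>q\<close> is at most \<open>l\<^sup>2\<close> in this range of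
    \<open>r\<close>.\<close>
  have tau_small: "1 / \<tau> \<le> 1 / (l * q)" if "\<bar>r - 1\<bar> \<le> 1"
  proof -
    have l2: "l\<^sup>2 \<ge> 1" using l by (simp add: one_le_power)
    have "l\<^sup>2 * \<bar>r - 1\<bar> \<le> l\<^sup>2 * 1" using that by (intro mult_left_mono) auto
    then have "q ^ 4 \<le> l\<^sup>2" using q(2) l2 by simp
    also have "\<dots> \<le> (l\<^sup>2) ^ 4" using l2 self_le_power[of "l\<^sup>2" 4] by simp
    finally have "q \<le> l\<^sup>2" using power_mono_iff[of q "l\<^sup>2" 4] q(1) by simp
    then have "l * q \<le> \<tau>" using l by (simp add: \<tau>_def power3_eq_cube power2_eq_square)
    then show ?thesis using l q by (intro divide_left_mono mult_pos_pos \<tau>) auto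
  qed
  have "J (-pi) pi \<le> 120 / (l * q)"
  proof -
    consider "r \<le> 1 / 2" | "r \<ge> 2" | "1 / 2 < r" "r < 2" by linarith
    then show ?thesis
    proof cases
      case 1
      have "r\<^sup>2 \<le> (1 / 2)\<^sup>2" using 1 r by (intro power_mono) auto
      then have "r\<^sup>2 \<le> 1 / 4" by (simp add: power2_eq_square)
      then have zt: "z \<le> \<tau> / 4" using \<tau> mult_left_mono[of "r\<^sup>2" "1/4" \<tau>] by (simp add: z_def)
      have dec: "\<tau> * (3 / 4) \<le> \<tau> - z * sin x" for x
      proof -
        have "z * sin x \<le> z * 1" using z by (intro mult_left_mono) auto
        then show ?thesis using zt by simp
      qed
      have "J (-pi) (-pi/2) \<le> 3 / (\<tau> * (3 / 4))" "J (-pi/2) (pi/2) \<le> 3 / (\<tau> * (3 / 4))"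
        "J (pi/2) pi \<le> 3 / (\<tau> * (3 / 4))"
        by (intro vdc1; use \<tau> z dec cos_neg cos_pos in auto)+
      moreover have "J (-pi) pi \<le> J (-pi) (-pi/2) + (J (-pi/2) (pi/2) + J (pi/2) pi)"
        using split[of "-pi" "-pi/2" pi] split[of "-pi/2" "pi/2" pi] pi3 by auto
      ultimately have "J (-pi) pi \<le> 3 * (3 / (\<tau> * (3 / 4)))" by linarith
      also have "\<dots> = 12 * (1 / \<tau>)" by simp
      also have "\<dots> \<le> 12 * (1 / (l * q))" using tau_small 1 r by (intro mult_left_mono) auto
      also have "\<dots> \<le> 120 / (l * q)" using lq by (simp add: divide_right_mono)
      finally show ?thesis .
    next
      case 2
      have l2: "l\<^sup>2 \<ge> 1" using l by (simp add: one_le_power)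
      have r4: "r \<le> r ^ 4" using 2 self_le_power[of r 4] by auto
      have "1 * 1 \<le> l\<^sup>2 * r ^ 4" using l2 2 r4 by (intro mult_mono) auto
      moreover have "l\<^sup>2 * \<bar>r - 1\<bar> \<le> l\<^sup>2 * r ^ 4" using r4 2 by (intro mult_left_mono) auto
      ultimately have "q ^ 4 \<le> l\<^sup>2 * r ^ 4" using q(2) by simp
      also have "\<dots> = (l * r\<^sup>2)\<^sup>2" by (simp add: power_mult_distrib)
      finally have "(q\<^sup>2)\<^sup>2 \<le> (l * r\<^sup>2)\<^sup>2" by simp
      then have "q\<^sup>2 \<le> l * r\<^sup>2" by (rule power2_le_imp_le) (use l in auto)
      then have "l\<^sup>2 * q\<^sup>2 \<le> l\<^sup>2 * (l * r\<^sup>2)" by (intro mult_left_mono) auto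
      then have zq: "(l * q)\<^sup>2 \<le> z"
        by (simp add: z_def \<tau>_def power_mult_distrib power2_eq_square power3_eq_cube mult_ac)
      have zq': "l * q \<le> z" using zq lq self_le_power[of "l * q" 2] by auto
      then have z0: "z > 0" using lq by auto
      have "2 ^ 2 \<le> r ^ 2" using 2 by (intro power_mono) auto
      then have zt: "\<tau> \<le> z / 4" using mult_left_mono[of 4 "r\<^sup>2" \<tau>] \<tau> by (simp add: z_def)
      \<comment> \<open>As \<open>z\<close> is at least \<open>4 * \<tau>\<close>, the equation
        \<open>sin x = \<tau> / z\<close> forces the stationary points to within
        \<open>pi / 6\<close> of 0 or \<open>pi\<close>, where the cosine is at least 1/2 in
        absolute value. Between these zones the sine is at least 1/2 in absolute value, and the
        first derivative of the phase is of order \<open>z\<close>.\<close>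
      have cos6: "(l * q / 2)\<^sup>2 \<le> z * cos x" if "\<bar>x\<bar> \<le> pi / 6" for x
      proof -
        have "cos (pi / 3) \<le> cos \<bar>x\<bar>" using that pi3 by (intro cos_monotone_0_pi_le) auto
        then have "z * (1 / 2) \<le> z * cos x" using z by (intro mult_left_mono) (auto simp: cos_60)
        moreover have "(l * q / 2)\<^sup>2 \<le> z * (1 / 2)" using zq z0 by (simp add: power_divide)
        ultimately show ?thesis by linarith
      qed
      have cos6': "z * cos x \<le> - (l * q / 2)\<^sup>2" if "5 * pi / 6 \<le> \<bar>x\<bar>" "\<bar>x\<bar> \<le> pi" for x
      proof -
        have "(l * q / 2)\<^sup>2 \<le> z * cos (pi - \<bar>x\<bar>)" by (rule cos6) (use that in auto)
        moreover have "cos (pi - \<bar>x\<bar>) = - cos x" by (simp add: cos_diff abs_if)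
        ultimately show ?thesis by simp
      qed
      have sin6: "sin x \<ge> 1 / 2" if "pi / 6 \<le> x" "x \<le> 5 * pi / 6" for x
      proof -
        have "cos (pi / 3) \<le> cos \<bar>pi / 2 - x\<bar>"
          using that pi3 by (intro cos_monotone_0_pi_le) (auto simp: abs_if)
        then show ?thesis by (simp add: cos_60 cos_diff)
      qed
      have pos: "\<tau> - z * sin x \<le> - (z / 4)" if "pi / 6 \<le> x" "x \<le> 5 * pi / 6" for x
      proof -
        have "z * (1 / 2) \<le> z * sin x" using z sin6[OF that] by (intro mult_left_mono) auto
        then show ?thesis using zt by simp
      qed
      have neg: "z / 4 \<le> \<tau> - z * sin x" if "- (5 * pi / 6) \<le> x" "x \<le> - (pi / 6)" for x
      proof -
        have "z * (1 / 2) \<le> z * sin (- x)" using z sin6[of "- x"] that by (intro mult_left_mono) auto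
        then show ?thesis using z \<tau> by simp
      qed
      have a: "J (-pi) (-(5*pi/6)) \<le> 8 / (l * q / 2)" "J (-(pi/6)) (pi/6) \<le> 8 / (l * q / 2)"
        "J (5*pi/6) pi \<le> 8 / (l * q / 2)"
        by (intro vdc2; use lq cos6 cos6' pi3 in auto)+
      have b: "J (-(5*pi/6)) (-(pi/2)) \<le> 3 / (z / 4)" "J (-(pi/2)) (-(pi/6)) \<le> 3 / (z / 4)"
        "J (pi/6) (pi/2) \<le> 3 / (z / 4)" "J (pi/2) (5*pi/6) \<le> 3 / (z / 4)"
        by (intro vdc1; use z0 pos neg cos_pos cos_neg pi3 in auto)+
      have c: "3 / (z / 4) \<le> 12 / (l * q)"
        using zq' z0 lq by (auto intro!: divide_left_mono)
      have "J (-pi) pi \<le> J (-pi) (-(5*pi/6)) + (J (-(5*pi/6)) (-(pi/2)) + (J (-(pi/2)) (-(pi/6)) +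
         (J (-(pi/6)) (pi/6) + (J (pi/6) (pi/2) + (J (pi/2) (5*pi/6) + J (5*pi/6) pi)))))"
        using split[of "-pi" "-(5*pi/6)" pi] split[of "-(5*pi/6)" "-(pi/2)" pi]
          split[of "-(pi/2)" "-(pi/6)" pi] split[of "-(pi/6)" "pi/6" pi] split[of "pi/6" "pi/2" pi]
          split[of "pi/2" "5*pi/6" pi] pi3 by auto
      also have "\<dots> \<le> 3 * (16 / (l * q)) + 4 * (12 / (l * q))" using a b c by simp
      also have "\<dots> \<le> 120 / (l * q)" using lq by (simp add: add_divide_distrib[symmetric] divide_right_mono)
      finally show ?thesis .
    next
      case 3
      \<comment> \<open>A window of half-width \<open>\<delta>\<close> about \<open>pi / 2\<close>
        is cut out. On the rest of \<open>{0..pi}\<close> the second derivative is at least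
        \<open>\<tau> * \<delta> / 8\<close> in absolute value; on the left half of the period the
        phase has derivative at least \<open>\<tau>\<close>.\<close>
      define \<epsilon> where "\<epsilon> = \<bar>r\<^sup>2 - 1\<bar>"
      have r2: "1 / 4 \<le> r\<^sup>2" "r\<^sup>2 \<le> 4"
        using power_mono[of "1/2" r 2] power_mono[of r 2 2] 3 by (auto simp: power2_eq_square)
      have zt: "\<tau> / 4 \<le> z" "z \<le> 4 * \<tau>"
        using mult_left_mono[OF r2(1), of \<tau>] mult_left_mono[OF r2(2), of \<tau>] \<tau> by (auto simp: z_def)
      have ts: "1 / \<tau> \<le> 1 / (l * q)" using tau_small 3 by auto
      have left: "J (-pi) (-(pi/2)) \<le> 3 / \<tau>" "J (-(pi/2)) 0 \<le> 3 / \<tau>"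
        using z \<tau> pi3 sin_neg cos_neg cos_pos by (intro vdc1; force simp: mult_nonneg_nonpos)+
      have side: "J 0 (pi/2 - \<delta>) \<le> 8 / m" "J (pi/2 + \<delta>) pi \<le> 8 / m"
        if d: "0 < \<delta>" "\<delta> \<le> 1" and m: "m > 0" "m\<^sup>2 \<le> \<tau> * \<delta> / 8" for \<delta> m
      proof -
        have "\<tau> * \<delta> / 8 = (\<tau> / 4) * (\<delta> / 2)" by simp
        also have "\<dots> \<le> z * sin \<delta>" using zt \<tau> d sin_ge_half[of \<delta>] by (intro mult_mono) auto
        finally have m2: "m\<^sup>2 \<le> z * sin \<delta>" using m by simp
        have A: "m\<^sup>2 \<le> z * cos x" if "0 \<le> x" "x \<le> pi / 2 - \<delta>" for x
        proof -
          have "cos (pi / 2 - \<delta>) \<le> cos x" using that d pi3 by (intro cos_monotone_0_pi_le) auto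
          then have "z * sin \<delta> \<le> z * cos x" using z by (intro mult_left_mono) (auto simp: cos_diff)
          then show ?thesis using m2 by simp
        qed
        have B: "z * cos x \<le> - m\<^sup>2" if "pi / 2 + \<delta> \<le> x" "x \<le> pi" for x
          using A[of "pi - x"] that d by (auto simp: cos_diff)
        show "J 0 (pi/2 - \<delta>) \<le> 8 / m" "J (pi/2 + \<delta>) pi \<le> 8 / m"
          using A B m d pi3 by (intro vdc2; auto)+
      qed
      have total: "J (-pi) pi \<le> 6 / \<tau> + J 0 (pi/2 - \<delta>) + (J (pi/2 - \<delta>) (pi/2) +
           J (pi/2) (pi/2 + \<delta>)) + J (pi/2 + \<delta>) pi" if "0 < \<delta>" "\<delta> \<le> 1" for \<delta>
        using split[of "-pi" "-(pi/2)" pi] split[of "-(pi/2)" 0 pi] split[of 0 "pi/2 - \<delta>" pi]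
          split[of "pi/2 - \<delta>" "pi/2" pi] split[of "pi/2" "pi/2 + \<delta>" pi] left that pi3 by auto
      show ?thesis
      proof (cases "l\<^sup>2 * \<bar>r - 1\<bar> \<le> 1")
        case True
        then have "q ^ 4 = 1 ^ 4" using q by simp
        then have q1: "q = 1" using q by (simp add: power_eq_iff_eq_base del: power_one)
        have triv: "J a b \<le> b - a" if "a \<le> b" for a b
          unfolding J_def f_def by (rule norm_integral_cis_le[OF that]) (intro continuous_intros)
        \<comment> \<open>In the Airy range \<open>\<delta> = 1 / l\<close> balances the trivial
          bound \<open>2 * \<delta>\<close> on the window against the order
          \<open>1 / sqrt (\<tau> * \<delta>)\<close> outside it.\<close>
        have d: "0 < 1 / l" "1 / l \<le> 1" using l by auto
        have "(l / 3)\<^sup>2 \<le> \<tau> * (1 / l) / 8"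
          using l by (simp add: \<tau>_def power2_eq_square power3_eq_cube)
        then have "J 0 (pi/2 - 1 / l) \<le> 8 / (l / 3)" "J (pi/2 + 1 / l) pi \<le> 8 / (l / 3)"
          using side[OF d, of "l / 3"] l by auto
        moreover have "J (pi/2 - 1/l) (pi/2) \<le> 1 / l" "J (pi/2) (pi/2 + 1/l) \<le> 1 / l"
          using triv[of "pi/2 - 1/l" "pi/2"] triv[of "pi/2" "pi/2 + 1/l"] d by auto
        ultimately have "J (-pi) pi \<le> 6 * (1 / \<tau>) + 24 / l + (1 / l + 1 / l) + 24 / l"
          using total[OF d] by simp
        also have "\<dots> \<le> 6 * (1 / l) + 24 / l + (1 / l + 1 / l) + 24 / l"
          using ts q1 by simp
        also have "\<dots> \<le> 120 / l" using l by (simp add: add_divide_distrib[symmetric] divide_right_mono)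
        finally show ?thesis using q1 by simp
      next
        case False
        then have q4: "q ^ 4 = l\<^sup>2 * \<bar>r - 1\<bar>" using q by simp
        have "\<epsilon> = \<bar>r - 1\<bar> * (r + 1)"
          using r abs_mult[of "r - 1" "r + 1"] by (simp add: \<epsilon>_def power2_eq_square algebra_simps)
        then have eps: "\<bar>r - 1\<bar> \<le> \<epsilon>" using r by (simp add: mult_le_cancel_left1)
        have eq4: "q ^ 4 \<le> l\<^sup>2 * \<epsilon>" unfolding q4 using eps by (intro mult_left_mono) auto
        have "r \<noteq> 1" using False by auto
        then have eps3: "\<epsilon> \<le> 3" "\<epsilon> > 0" using r2 eps by (auto simp: \<epsilon>_def abs_le_iff)
        \<comment> \<open>At \<open>pi / 2\<close> the phase has derivative of size
          \<open>\<tau> * \<epsilon>\<close>, and across the window it varies by at most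
          \<open>2 * \<tau> * \<delta>\<^sup>2\<close>. This choice makes the variation
          \<open>\<tau> * \<epsilon> / 8\<close>, so the derivative cannot vanish on the
          window.\<close>
        define \<delta> where "\<delta> = sqrt \<epsilon> / 4"
        have se: "sqrt \<epsilon> \<le> 2" using real_sqrt_le_mono[of \<epsilon> 4] eps3 by simp
        have d: "0 < \<delta>" "\<delta> \<le> 1" "\<delta>\<^sup>2 = \<epsilon> / 16"
          using eps3 se by (auto simp: \<delta>_def power_divide)
        have "q\<^sup>2 \<le> l * sqrt \<epsilon>"
        proof (rule power2_le_imp_le)
          show "(q\<^sup>2)\<^sup>2 \<le> (l * sqrt \<epsilon>)\<^sup>2" using eq4 eps3 by (simp add: power_mult_distrib)
        qed (use l eps3 in auto)
        then have "l\<^sup>2 * q\<^sup>2 \<le> l\<^sup>2 * (l * sqrt \<epsilon>)" by (intro mult_left_mono) auto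
        then have "(l * q)\<^sup>2 \<le> \<tau> * sqrt \<epsilon>"
          by (simp add: \<tau>_def power_mult_distrib power2_eq_square power3_eq_cube mult_ac)
        moreover have "(l * q / 6)\<^sup>2 = (l * q)\<^sup>2 / 36" "\<tau> * \<delta> / 8 = \<tau> * sqrt \<epsilon> / 32"
          by (simp_all add: \<delta>_def power_divide)
        moreover have "0 \<le> (l * q)\<^sup>2" by simp
        ultimately have "(l * q / 6)\<^sup>2 \<le> \<tau> * \<delta> / 8" by linarith
        then have s: "J 0 (pi/2 - \<delta>) \<le> 8 / (l * q / 6)" "J (pi/2 + \<delta>) pi \<le> 8 / (l * q / 6)"
          using side[OF d(1,2), of "l * q / 6"] lq by auto
        have sn: "0 \<le> z * (1 - sin x)" "z * (1 - sin x) \<le> \<tau> * \<epsilon> / 8" if "\<bar>x - pi / 2\<bar> \<le> \<delta>" for x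
        proof -
          show "0 \<le> z * (1 - sin x)" using z by auto
          have "1 - sin x \<le> (x - pi / 2)\<^sup>2 / 2"
            using one_minus_cos_le[of "x - pi / 2"] by (simp add: cos_diff)
          also have "\<dots> \<le> \<delta>\<^sup>2 / 2" using that power_mono[OF that, of 2] by simp
          finally have "z * (1 - sin x) \<le> (4 * \<tau>) * (\<delta>\<^sup>2 / 2)"
            using z zt \<tau> by (intro mult_mono) auto
          then show "z * (1 - sin x) \<le> \<tau> * \<epsilon> / 8" using d by (simp add: mult.commute)
        qed
        have low: "(\<forall>x\<in>{a..b}. \<tau> * \<epsilon> / 2 \<le> \<tau> - z * sin x) \<or> (\<forall>x\<in>{a..b}. \<tau> - z * sin x \<le> - (\<tau> * \<epsilon> / 2))"
          if "pi / 2 - \<delta> \<le> a" "b \<le> pi / 2 + \<delta>" for a b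
        proof -
          have xx: "\<bar>x - pi / 2\<bar> \<le> \<delta>" if "x \<in> {a..b}" for x using that \<open>pi / 2 - \<delta> \<le> a\<close> \<open>b \<le> pi / 2 + \<delta>\<close> by (auto simp: abs_le_iff)
          have e: "\<tau> - z * sin x = \<tau> * (1 - r\<^sup>2) + z * (1 - sin x)" for x by (simp add: z_def algebra_simps)
          have te: "\<tau> * \<epsilon> > 0" using \<tau> eps3 by simp
          show ?thesis
          proof (cases "r\<^sup>2 \<le> 1")
            case True
            then have "1 - r\<^sup>2 = \<epsilon>" by (simp add: \<epsilon>_def)
            then show ?thesis unfolding e using sn(1)[OF xx] te by fastforce
          next
            case False
            then have "1 - r\<^sup>2 = - \<epsilon>" by (simp add: \<epsilon>_def)
            then show ?thesis unfolding e using sn(2)[OF xx] te by fastforce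
          qed
        qed
        have mid: "J (pi/2 - \<delta>) (pi/2) \<le> 3 / (\<tau> * \<epsilon> / 2)" "J (pi/2) (pi/2 + \<delta>) \<le> 3 / (\<tau> * \<epsilon> / 2)"
          using d \<tau> eps3 z pi3 cos_pos cos_neg low[of "pi/2 - \<delta>" "pi/2"] low[of "pi/2" "pi/2 + \<delta>"]
          by (intro vdc1; auto)+
        have "q \<le> q ^ 4" using q self_le_power[of q 4] by auto
        then have "q \<le> l\<^sup>2 * \<epsilon>" using eq4 by simp
        then have "l * q \<le> \<tau> * \<epsilon>"
          using l mult_left_mono[of q "l\<^sup>2 * \<epsilon>" l] by (simp add: \<tau>_def power2_eq_square power3_eq_cube mult_ac)
        then have "6 / (\<tau> * \<epsilon>) \<le> 6 / (l * q)" using lq by (intro divide_left_mono) auto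
        then have mid': "J (pi/2 - \<delta>) (pi/2) \<le> 6 / (l * q)" "J (pi/2) (pi/2 + \<delta>) \<le> 6 / (l * q)"
          using mid by auto
        have "J (-pi) pi \<le> 6 * (1 / \<tau>) + 48 / (l * q) + (6 / (l * q) + 6 / (l * q)) + 48 / (l * q)"
          using total[OF d(1,2)] s mid' by simp
        also have "\<dots> \<le> 6 * (1 / (l * q)) + 48 / (l * q) + (6 / (l * q) + 6 / (l * q)) + 48 / (l * q)"
          using ts by simp
        also have "\<dots> \<le> 120 / (l * q)" using lq by (simp add: add_divide_distrib[symmetric] divide_right_mono)
        finally show ?thesis .
      qed
    qed
  qed
  then show ?thesis by (simp add: J_def f_def anger_def \<tau>_def z_def)
qed

section \<open>The Airy limit\<close>

text \<open>The integrand of the Airy integral on the horizontal line at height \<open>h\<close>.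
  For positive \<open>h\<close> it decays like a Gaussian, whereas on the real line it has modulus
  1. Its integral over \<open>u\<close> is \<open>2 * pi * c * Ai (- c * \<sigma>)\<close> with
  \<open>c\<close> the cube root of 2.\<close>

definition airy_kernel :: "real \<Rightarrow> real \<Rightarrow> real \<Rightarrow> complex" where
  "airy_kernel h \<sigma> u = exp (\<i> * (Complex u h ^ 3 / 6 - of_real \<sigma> * Complex u h))"

lemma integrable_gaussian_moment:
  assumes c: "c > (0::real)"
  shows "integrable lborel (\<lambda>u. \<bar>u\<bar> ^ k * exp (- (c * u\<^sup>2)))"
proof -
  define \<sigma> where "\<sigma> = sqrt (1 / (2 * c))"
  have s: "\<sigma> > 0" "\<sigma>\<^sup>2 = 1 / (2 * c)" using c by (auto simp: \<sigma>_def)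
  have "integrable lborel (\<lambda>x. normal_density 0 \<sigma> x * \<bar>x - 0\<bar> ^ k)"
    using s by (intro integrable_normal_moment_abs)
  then have "integrable lborel (\<lambda>x. sqrt (2 * pi * \<sigma>\<^sup>2) * (normal_density 0 \<sigma> x * \<bar>x - 0\<bar> ^ k))"
    by (rule integrable_mult_right)
  moreover have "sqrt (2 * pi * \<sigma>\<^sup>2) * (normal_density 0 \<sigma> x * \<bar>x - 0\<bar> ^ k) = \<bar>x\<bar> ^ k * exp (- (c * x\<^sup>2))" for x
    using s c by (simp add: normal_density_def mult.commute)
  ultimately show ?thesis by (simp only:)
qed

lemma norm_airy_kernel:
  "norm (airy_kernel h \<sigma> u) = exp (h ^ 3 / 6 + \<sigma> * h - h / 2 * u\<^sup>2)"
proof -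
  have "Re (\<i> * (Complex u h ^ 3 / 6 - of_real \<sigma> * Complex u h)) = h ^ 3 / 6 + \<sigma> * h - h / 2 * u\<^sup>2"
    by (simp add: power3_eq_cube power2_eq_square field_simps)
  then show ?thesis unfolding airy_kernel_def norm_exp_eq_Re by simp
qed

lemma airy_kernel_measurable [measurable]: "airy_kernel h \<sigma> \<in> borel_measurable borel"
proof -
  have "continuous_on UNIV (airy_kernel h \<sigma>)"
    unfolding airy_kernel_def[abs_def] Complex_eq by (intro continuous_intros) auto
  then show ?thesis by (rule borel_measurable_continuous_onI)
qed

text \<open>The quotient is, up to sign, the sine series shifted by three places, so the limit is
  minus its coefficient at the third power.\<close>

lemma tendsto_sin_cubic: "((\<lambda>z. (z - sin z) / z ^ 3) \<longlongrightarrow> 1 / 6) (at (0::complex))"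
proof -
  define a where "a = (\<lambda>n. sin_coeff (n + 3) :: real)"
  have sums: "(\<lambda>n. of_real (a n) * z ^ n) sums ((sin z - z) / z ^ 3)" if "z \<noteq> 0" for z :: complex
  proof -
    have "(\<lambda>n. sin_coeff n *\<^sub>R z ^ n) sums sin z" by (rule sin_converges)
    then have "(\<lambda>n. sin_coeff (n + 3) *\<^sub>R z ^ (n + 3)) sums (sin z - (\<Sum>i<3. sin_coeff i *\<^sub>R z ^ i))"
      by (rule sums_split_initial_segment)
    also have "(\<Sum>i<3. sin_coeff i *\<^sub>R z ^ i) = z"
      by (simp add: eval_nat_numeral sin_coeff_def)
    finally have "(\<lambda>n. sin_coeff (n + 3) *\<^sub>R z ^ (n + 3) / z ^ 3) sums ((sin z - z) / z ^ 3)"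
      by (rule sums_divide)
    moreover have "sin_coeff (n + 3) *\<^sub>R z ^ (n + 3) / z ^ 3 = of_real (a n) * z ^ n" for n
      unfolding a_def power_add scaleR_conv_of_real using that by simp
    ultimately show ?thesis by (simp only:)
  qed
  have "((\<lambda>z. (sin z - z) / z ^ 3) \<longlongrightarrow> of_real (a 0)) (at (0::complex))"
    by (rule powser_limit_0_strong[of 1 "\<lambda>n. of_real (a n)"]) (simp, rule sums)
  moreover have "a 0 = - 1 / 6" by (simp add: a_def sin_coeff_def fact_numeral)
  ultimately have "((\<lambda>z. - ((sin z - z) / z ^ 3)) \<longlongrightarrow> - of_real (- 1 / 6)) (at (0::complex))"
    by (intro tendsto_minus) simp
  moreover have "- ((sin z - z) / z ^ 3) = (z - sin z) / z ^ 3" for z :: complex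
    by (metis minus_diff_eq minus_divide_left)
  ultimately show ?thesis by simp
qed

lemma tendsto_sin_over: "((\<lambda>z. sin z / z) \<longlongrightarrow> 1) (at (0::complex))"
  using DERIV_sin[of "0::complex"] by (simp add: DERIV_def)

lemma square_one_plus_divide:
  "L \<noteq> 0 \<Longrightarrow> (1 + s / L)\<^sup>2 = 1 + (2 * s + s\<^sup>2 / L) / L" for s L :: real
  by (simp add: power2_eq_square field_simps)

text \<open>Two effects survive multiplication by \<open>l ^ 3\<close>: the cubic remainder of the
  sine at \<open>p / l\<close>, and the detuning from the turning point, since the square is
  \<open>1 + E / l\<^sup>2\<close> with \<open>E\<close> tending to \<open>2 * s\<close>. The terms
  linear in \<open>p / l\<close> cancel otherwise.\<close>

lemma tendsto_scaled_phase:
  fixes p :: complex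
  assumes p: "p \<noteq> 0"
  shows "((\<lambda>l::real. of_real (l ^ 3) * (p / of_real l - of_real ((1 + s / l\<^sup>2)\<^sup>2) * sin (p / of_real l)))
     \<longlongrightarrow> p ^ 3 / 6 - of_real (2 * s) * p) at_top"
proof -
  have inv: "((\<lambda>l::real. 1 / l) \<longlongrightarrow> 0) at_top" by real_asymp
  have z0: "((\<lambda>l::real. p / of_real l) \<longlongrightarrow> 0) at_top"
    using tendsto_mult[OF tendsto_const[of p] tendsto_of_real[OF inv, where 'a = complex]] by simp
  have z: "filterlim (\<lambda>l::real. p / of_real l) (at 0) at_top"
    unfolding filterlim_at using z0 p
    by (auto intro!: eventually_mono[OF eventually_gt_at_top[of 0]])
  define f where "f = (\<lambda>l::real. p ^ 3 * ((p / of_real l - sin (p / of_real l)) / (p / of_real l) ^ 3)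
     - of_real (2 * s + s\<^sup>2 / l\<^sup>2) * (p * (sin (p / of_real l) / (p / of_real l))))"
  have "((\<lambda>l::real. 2 * s + s\<^sup>2 / l\<^sup>2) \<longlongrightarrow> 2 * s) at_top" by real_asymp
  then have "(f \<longlongrightarrow> p ^ 3 * (1 / 6) - of_real (2 * s) * (p * 1)) at_top"
    unfolding f_def
    by (intro tendsto_intros filterlim_compose[OF tendsto_sin_cubic z] filterlim_compose[OF tendsto_sin_over z])
  moreover have "\<forall>\<^sub>F l::real in at_top. f l =
      of_real (l ^ 3) * (p / of_real l - of_real ((1 + s / l\<^sup>2)\<^sup>2) * sin (p / of_real l))"
    using eventually_gt_at_top[of 0]
  proof eventually_elim
    case (elim l)
    define L P S E where "L = complex_of_real l" and "P = p / L" and "S = sin P"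
      and "E = complex_of_real (2 * s + s\<^sup>2 / l\<^sup>2)"
    have L0: "L \<noteq> 0" using elim by (simp add: L_def)
    have 1: "complex_of_real ((1 + s / l\<^sup>2)\<^sup>2) = 1 + E / L\<^sup>2"
      using square_one_plus_divide[of "l\<^sup>2" s] elim by (simp add: E_def L_def)
    have 2: "p ^ 3 * ((P - S) / P ^ 3) = L ^ 3 * (P - S)" "p * (S / P) = L * S"
      using p L0 by (simp_all add: P_def power_divide)
    have "f l = L ^ 3 * (P - S) - E * (L * S)"
      unfolding f_def L_def[symmetric] S_def[symmetric] E_def[symmetric] P_def[symmetric] 2 ..
    also have "\<dots> = L ^ 3 * (P - (1 + E / L\<^sup>2) * S)"
      using L0 by (simp add: algebra_simps power2_eq_square power3_eq_cube)
    also have "L ^ 3 = complex_of_real (l ^ 3)" by (simp add: L_def)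
    finally show ?case unfolding 1 L_def[symmetric] P_def[symmetric] S_def[symmetric] .
  qed
  ultimately show ?thesis by (simp add: tendsto_cong)
qed

lemma sinh_upper: "(exp d - exp (- d)) / 2 \<le> d + d ^ 3" if "0 \<le> d" "d \<le> 1" for d :: real
proof -
  define g where "g = (\<lambda>d::real. d + d ^ 3 - (exp d - exp (- d)) / 2)"
  have "g 0 \<le> g d"
  proof (rule DERIV_nonneg_imp_nondecreasing[OF that(1)], intro exI conjI)
    fix t assume t: "0 \<le> t" "t \<le> d"
    show "(g has_real_derivative 1 + 3 * t\<^sup>2 - (exp t + exp (- t)) / 2) (at t)"
      unfolding g_def by (auto intro!: derivative_eq_intros)
    have 1: "exp t \<le> 1 + t + t\<^sup>2" using exp_bound[of t] t that by auto
    have "exp (- t) \<le> 1 / (1 + t)"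
      using exp_ge_add_one_self[of t] t by (simp add: exp_minus field_simps)
    also have "\<dots> \<le> 1 - t + t\<^sup>2"
    proof -
      have "1 \<le> (1 - t + t\<^sup>2) * (1 + t)" using t by (simp add: algebra_simps power2_eq_square)
      then show ?thesis using t by (simp add: divide_le_eq)
    qed
    finally have "exp t + exp (- t) \<le> 2 + 2 * t\<^sup>2" using 1 by simp
    also have "\<dots> \<le> 2 + 6 * t\<^sup>2" by simp
    finally show "0 \<le> 1 + 3 * t\<^sup>2 - (exp t + exp (- t)) / 2" by simp
  qed
  then show ?thesis by (simp add: g_def)
qed

text \<open>The contour is raised to the height \<open>h / l\<close> comparable to the width of the critical region.\<close>

lemma norm_scaled_phase_le:
  fixes h s :: real
  assumes h: "h > 0"
  obtains K where "\<And>l u. 1 \<le> l \<Longrightarrow> h \<le> l \<Longrightarrow> \<bar>u\<bar> \<le> l * (pi / 2) \<Longrightarrow>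
     norm (exp (\<i> * (of_real (l ^ 3) * (Complex u h / of_real l -
        of_real ((1 + s / l\<^sup>2)\<^sup>2) * sin (Complex u h / of_real l))))) \<le> exp (K - h / 8 * u\<^sup>2)"
proof
  define c where "c = 2 * \<bar>s\<bar> + s\<^sup>2"
  \<comment> \<open>\<open>K / l ^ 3\<close> is the excess of \<open>y * sinh d\<close> over
    \<open>d\<close>, bounded uniformly in \<open>l\<close>; it is all the growth that the raised
    contour can cause.\<close>
  define K where "K = h ^ 3 + c * h + c * h ^ 3"
  fix l u :: real assume l: "1 \<le> l" "h \<le> l" and u: "\<bar>u\<bar> \<le> l * (pi / 2)"
  define y where "y = (1 + s / l\<^sup>2)\<^sup>2"
  define \<eta> where "\<eta> = u / l"
  define d where "d = h / l"
  have c: "c \<ge> 0" by (simp add: c_def)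
  have z: "Complex u h / of_real l = Complex \<eta> d" using l by (simp add: \<eta>_def d_def complex_eq_iff)
  have d: "0 < d" "d \<le> 1" using l h by (auto simp: d_def)
  have \<eta>: "\<bar>\<eta>\<bar> \<le> pi / 2" using u l by (simp add: \<eta>_def abs_divide field_simps)
  have "Im (Complex \<eta> d - of_real y * sin (Complex \<eta> d)) = d - y * (cos \<eta> * ((exp d - exp (- d)) / 2))"
    by (simp add: Im_sin)
  then have norm: "norm (exp (\<i> * (of_real (l ^ 3) * (Complex \<eta> d - of_real y * sin (Complex \<eta> d))))) =
     exp (- (l ^ 3 * (d - y * (cos \<eta> * ((exp d - exp (- d)) / 2)))))"
    unfolding norm_exp_eq_Re by (simp del: of_real_power minus_complex.sel)
  have l2: "l\<^sup>2 \<ge> 1" using l by (simp add: one_le_power)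
  have y: "0 \<le> y" "y \<le> 1 + c / l\<^sup>2"
  proof -
    have "y = 1 + (2 * s + s\<^sup>2 / l\<^sup>2) / l\<^sup>2"
      using square_one_plus_divide[of "l\<^sup>2" s] l by (simp add: y_def)
    moreover have "s\<^sup>2 / l\<^sup>2 \<le> s\<^sup>2" using l l2 divide_left_mono[of 1 "l\<^sup>2" "s\<^sup>2"] by simp
    moreover have "(2 * s + s\<^sup>2 / l\<^sup>2) / l\<^sup>2 \<le> c / l\<^sup>2"
      unfolding c_def using calculation(2) by (intro divide_right_mono) auto
    ultimately show "y \<le> 1 + c / l\<^sup>2" by simp
  qed (simp add: y_def)
  have sh: "(exp d - exp (- d)) / 2 \<le> d + d ^ 3" "0 \<le> (exp d - exp (- d)) / 2"
    using sinh_upper[of d] d by auto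
  have "y * ((exp d - exp (- d)) / 2) \<le> (1 + c / l\<^sup>2) * (d + d ^ 3)"
    using y sh c by (intro mult_mono) auto
  also have "\<dots> = h / l + (h ^ 3 + c * h + c * h ^ 3 / l\<^sup>2) / l ^ 3"
    by (simp add: d_def power_divide ring_distribs add_divide_distrib power2_eq_square power3_eq_cube mult_ac)
  also have "\<dots> \<le> h / l + K / l ^ 3"
  proof -
    have "c * h ^ 3 / l\<^sup>2 \<le> c * h ^ 3"
      using l l2 c h divide_left_mono[of 1 "l\<^sup>2" "c * h ^ 3"] by simp
    then show ?thesis unfolding K_def using l by (intro add_left_mono divide_right_mono) auto
  qed
  finally have 1: "y * ((exp d - exp (- d)) / 2) \<le> h / l + K / l ^ 3" .
  have c0: "0 \<le> cos \<eta>" using \<eta> by (intro cos_ge_zero) auto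
  have K0: "K \<ge> 0" using c h by (simp add: K_def)
  have "- (l ^ 3 * (d - y * (cos \<eta> * ((exp d - exp (- d)) / 2)))) =
     l ^ 3 * (cos \<eta> * (y * ((exp d - exp (- d)) / 2)) - h / l)" by (simp add: d_def algebra_simps)
  also have "\<dots> \<le> l ^ 3 * (cos \<eta> * (h / l + K / l ^ 3) - h / l)"
    using 1 c0 l by (intro mult_left_mono diff_right_mono) auto
  also have "\<dots> = K * cos \<eta> - l\<^sup>2 * h * (1 - cos \<eta>)"
  proof -
    have "l ^ 3 * (h / l) = l\<^sup>2 * h" "l ^ 3 * (K / l ^ 3) = K"
      using l by (simp_all add: power2_eq_square power3_eq_cube)
    moreover have "l ^ 3 * (C * (A + B) - A) = C * (l ^ 3 * B) - (l ^ 3 * A) * (1 - C)" for A B C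
      by (simp add: algebra_simps)
    ultimately show ?thesis by (simp only: mult.commute)
  qed
  \<comment> \<open>The Gaussian comes from \<open>1 - cos \<eta>\<close>, which is at least
    \<open>\<eta>\<^sup>2 / 8\<close> on the whole half-period, with
    \<open>l * \<eta> = u\<close>.\<close>
  also have "\<dots> \<le> K * 1 - l\<^sup>2 * h * (\<eta>\<^sup>2 / 8)"
  proof -
    have "\<bar>\<eta>\<bar> / 2 / 2 \<le> sin (\<bar>\<eta>\<bar> / 2)" using \<eta> pi_less_4 by (intro sin_ge_half) auto
    then have "(\<bar>\<eta>\<bar> / 2 / 2)\<^sup>2 \<le> (sin (\<bar>\<eta>\<bar> / 2))\<^sup>2" by (intro power_mono) auto
    moreover have "cos \<eta> = 1 - 2 * (sin (\<bar>\<eta>\<bar> / 2))\<^sup>2" using cos_double_sin[of "\<bar>\<eta>\<bar> / 2"] by simp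
    ultimately have "\<eta>\<^sup>2 / 8 \<le> 1 - cos \<eta>" by (simp add: power_divide)
    then show ?thesis using K0 h l by (intro diff_mono mult_left_mono) auto
  qed
  also have "\<dots> = K - h / 8 * u\<^sup>2" using l by (simp add: \<eta>_def power_divide)
  finally show "norm (exp (\<i> * (of_real (l ^ 3) * (Complex u h / of_real l -
        of_real ((1 + s / l\<^sup>2)\<^sup>2) * sin (Complex u h / of_real l))))) \<le> exp (K - h / 8 * u\<^sup>2)"
    unfolding z y_def[symmetric] norm by simp
qed

text \<open>The height 1 is a normalization; \<open>integral_airy_kernel\<close> shows that every
  positive height gives the same value.\<close>

definition airy_int :: "real \<Rightarrow> complex" where
  "airy_int \<sigma> = (LINT u|lborel. airy_kernel 1 \<sigma> u)"

text \<open>Contour shifts below are telescoping differences of one global primitive.\<close>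

lemma entire_primitive:
  fixes f :: "complex \<Rightarrow> complex"
  assumes "f holomorphic_on UNIV"
  obtains F where "\<And>z. (F has_field_derivative f z) (at z)"
  using holomorphic_convex_primitive'[of UNIV f] assms by auto

text \<open>Controls the sides of a shifted contour: \<open>F\<close> is a primitive of the
  integrand, \<open>e\<close> a unit direction, and the decay is integrated over the
  half-line.\<close>

lemma norm_vertical_increment_le:
  fixes F f :: "complex \<Rightarrow> complex"
  assumes F: "\<And>z. (F has_field_derivative f z) (at z)" and k: "k > 0" and d: "d \<ge> 0"
    and cont: "continuous_on UNIV f" and e: "norm e = 1"
    and le: "\<And>v. 0 \<le> v \<Longrightarrow> v \<le> d \<Longrightarrow> norm (f (a + of_real v * e)) \<le> exp (- (k * v))"
  shows "norm (F (a + of_real d * e) - F a) \<le> 1 / k"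
proof -
  have I1: "((\<lambda>v. e * f (a + of_real v * e)) has_integral F (a + of_real d * e) - F (a + of_real 0 * e)) {0..d}"
  proof (rule fundamental_theorem_of_calculus[OF d])
    fix v :: real
    have "((\<lambda>v. a + of_real v * e) has_vector_derivative e) (at v within {0..d})"
      by (auto intro!: derivative_eq_intros)
    from field_vector_diff_chain_within[OF this has_field_derivative_at_within[OF F]]
    show "((\<lambda>v. F (a + of_real v * e)) has_vector_derivative e * f (a + of_real v * e)) (at v within {0..d})"
      by (simp add: o_def)
  qed
  have I2: "((\<lambda>v. exp (- (k * v))) has_integral (- exp (- (k * d)) / k) - (- exp (- (k * 0)) / k)) {0..d}"
    by (rule fundamental_theorem_of_calculus[OF d])
      (use k in \<open>auto intro!: derivative_eq_intros simp flip: has_real_derivative_iff_has_vector_derivative\<close>)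
  have "norm (integral {0..d} (\<lambda>v. e * f (a + of_real v * e))) \<le> integral {0..d} (\<lambda>v. exp (- (k * v)))"
    by (rule Henstock_Kurzweil_Integration.integral_norm_bound_integral[OF has_integral_integrable[OF I1]
      has_integral_integrable[OF I2]]) (use le e in \<open>auto simp: norm_mult\<close>)
  then have "norm (F (a + of_real d * e) - F (a + of_real 0 * e)) \<le> (- exp (- (k * d)) / k) - (- exp (- (k * 0)) / k)"
    unfolding integral_unique[OF I1] integral_unique[OF I2] .
  also have "\<dots> \<le> 1 / k" using k by (simp add: divide_simps)
  finally show ?thesis by simp
qed

text \<open>On \<open>{-pi..0}\<close> the phase has no stationary point. The segment from 0 to
  \<open>pi\<close> is raised to height \<open>h / l\<close>, where dominated convergence applies.
  The left half costs \<open>6 / \<tau>\<close> and the two vertical sides \<open>1 / \<tau>\<close>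
  each, which after multiplication by \<open>l\<close> leaves the error
  \<open>8 / l\<^sup>2\<close>.\<close>

lemma tendsto_anger:
  assumes h: "h > 0"
  shows "((\<lambda>l. of_real l * cis (- (l ^ 3 * (pi / 2))) * anger (l ^ 3) (l ^ 3 * (1 + s / l\<^sup>2)\<^sup>2))
     \<longlongrightarrow> (LINT u|lborel. airy_kernel h (2 * s) u)) at_top"
proof -
  define G where "G = (\<lambda>l u. exp (\<i> * (of_real (l ^ 3) * (Complex u h / of_real l -
        of_real ((1 + s / l\<^sup>2)\<^sup>2) * sin (Complex u h / of_real l)))))"
  define T where "T = (\<lambda>l. LINT u|lborel. indicator {- (l * (pi / 2))..l * (pi / 2)} u *\<^sub>R G l u)"
  obtain K where K: "\<And>l u. 1 \<le> l \<Longrightarrow> h \<le> l \<Longrightarrow> \<bar>u\<bar> \<le> l * (pi / 2) \<Longrightarrow>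
     norm (G l u) \<le> exp (K - h / 8 * u\<^sup>2)"
    using norm_scaled_phase_le[OF h, of s] unfolding G_def by blast
  have T_lim: "(T \<longlongrightarrow> (LINT u|lborel. airy_kernel h (2 * s) u)) at_top"
    unfolding T_def
  proof (rule integral_dominated_convergence_at_top[where w = "\<lambda>u. exp K * (\<bar>u\<bar> ^ 0 * exp (- (h / 8 * u\<^sup>2)))"])
    show "integrable lborel (\<lambda>u. exp K * (\<bar>u\<bar> ^ 0 * exp (- (h / 8 * u\<^sup>2))))"
      using h by (intro integrable_mult_right integrable_gaussian_moment) auto
    show "\<forall>\<^sub>F l in at_top. AE u in lborel. norm (indicator {- (l * (pi / 2))..l * (pi / 2)} u *\<^sub>R G l u)
        \<le> exp K * (\<bar>u\<bar> ^ 0 * exp (- (h / 8 * u\<^sup>2)))"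
      using eventually_ge_at_top[of "max 1 h"]
    proof eventually_elim
      case (elim l)
      show ?case
      proof (rule AE_I2)
        fix u
        show "norm (indicator {- (l * (pi / 2))..l * (pi / 2)} u *\<^sub>R G l u)
          \<le> exp K * (\<bar>u\<bar> ^ 0 * exp (- (h / 8 * u\<^sup>2)))"
        proof (cases "u \<in> {- (l * (pi / 2))..l * (pi / 2)}")
          case True
          then have "\<bar>u\<bar> \<le> l * (pi / 2)" unfolding abs_le_iff by auto
          then have "norm (G l u) \<le> exp (K - h / 8 * u\<^sup>2)" using K[of l u] elim by simp
          also have "\<dots> = exp K * (\<bar>u\<bar> ^ 0 * exp (- (h / 8 * u\<^sup>2)))"
            by (simp add: mult_exp_exp)
          finally show ?thesis using True by simp
        qed simp
      qed
    qed
    show "AE u in lborel. ((\<lambda>l. indicator {- (l * (pi / 2))..l * (pi / 2)} u *\<^sub>R G l u) \<longlongrightarrow> airy_kernel h (2 * s) u) at_top"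
    proof (rule AE_I2)
      fix u :: real
      have "((\<lambda>l. G l u) \<longlongrightarrow> airy_kernel h (2 * s) u) at_top"
        unfolding G_def airy_kernel_def
        using h by (intro tendsto_intros tendsto_scaled_phase) (auto simp: complex_eq_iff)
      moreover have "\<forall>\<^sub>F l in at_top. G l u = indicator {- (l * (pi / 2))..l * (pi / 2)} u *\<^sub>R G l u"
        using eventually_ge_at_top[of "\<bar>u\<bar>"]
      proof eventually_elim
        case (elim l)
        have "\<bar>u\<bar> * 1 \<le> l * (pi / 2)" using elim pi_gt3 by (intro mult_mono) auto
        then have "u \<in> {- (l * (pi / 2))..l * (pi / 2)}" using abs_le_D1 abs_le_D2 by force
        then show ?case by simp
      qed
      ultimately show "((\<lambda>l. indicator {- (l * (pi / 2))..l * (pi / 2)} u *\<^sub>R G l u) \<longlongrightarrow> airy_kernel h (2 * s) u) at_top"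
        by (rule Lim_transform_eventually)
    qed
  qed (use airy_kernel_measurable in \<open>auto simp: G_def Complex_eq\<close>)
  have close: "norm (of_real l * cis (- (l ^ 3 * (pi / 2))) * anger (l ^ 3) (l ^ 3 * (1 + s / l\<^sup>2)\<^sup>2) - T l) \<le> 8 / l\<^sup>2"
    if l: "l \<ge> 1" for l
  proof -
    define \<tau> where "\<tau> = l ^ 3"
    define y where "y = (1 + s / l\<^sup>2)\<^sup>2"
    have \<tau>: "\<tau> > 0" using l by (simp add: \<tau>_def)
    have y: "y \<ge> 0" by (simp add: y_def)
    define f where "f = (\<lambda>z. exp (\<i> * of_real \<tau> * (z + of_real y * cos z)))"
    have fh: "f holomorphic_on UNIV" unfolding f_def by (intro holomorphic_intros)
    then have cf: "continuous_on UNIV f" by (rule holomorphic_on_imp_continuous_on)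
    obtain F where F: "\<And>z. (F has_field_derivative f z) (at z)" using entire_primitive[OF fh] by blast
    define g where "g = (\<lambda>\<xi>. cis (\<tau> * \<xi> + \<tau> * y * cos \<xi>))"
    have cg: "continuous_on A g" for A unfolding g_def by (intro continuous_intros)
    have gf: "f (of_real x) = g x" for x
      by (simp add: f_def g_def cis_conv_exp cos_of_real algebra_simps)
    have anger: "anger \<tau> (\<tau> * y) = integral {-pi..0} g + integral {0..pi} g"
      unfolding anger_def g_def[symmetric]
      by (rule Henstock_Kurzweil_Integration.integral_combine[symmetric]) (auto intro!: integrable_continuous_real cg)
    have left: "norm (integral {-pi..0} g) \<le> 6 / \<tau>"
    proof -
      have sin_neg: "\<tau> \<le> \<tau> - \<tau> * y * sin x" if "- pi \<le> x" "x \<le> 0" for x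
        using sin_ge_zero[of "- x"] that \<tau> y mult_nonneg_nonpos[of "\<tau> * y" "sin x"] by auto
      have cneg: "cos x \<le> 0" if "- pi \<le> x" "x \<le> - (pi / 2)" for x
        using cos_monotone_0_pi_le[of "pi / 2" "- x"] that by auto
      have cpos: "cos x \<ge> 0" if "- (pi / 2) \<le> x" "x \<le> 0" for x
        using that by (intro cos_ge_zero) auto
      have "norm (integral {-pi..-(pi/2)} g) \<le> 3 / \<tau>" "norm (integral {-(pi/2)..0} g) \<le> 3 / \<tau>"
        unfolding g_def using \<tau> y sin_neg cneg cpos by (intro anger_vdc_first; force)+
      then show ?thesis
        using norm_integral_split_le[of "-pi" "-(pi/2)" 0 g] cg by simp
    qed
    have mid: "integral {0..pi} g = F (of_real pi) - F 0"
    proof -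
      have "(g has_integral F (of_real pi) - F (of_real 0)) {0..pi}"
      proof (rule fundamental_theorem_of_calculus)
        fix x
        show "((\<lambda>x. F (of_real x)) has_vector_derivative g x) (at x within {0..pi})"
          using has_vector_derivative_real_field[OF has_field_derivative_at_within[OF F]] by (simp add: gf)
      qed simp
      then show ?thesis by (simp add: integral_unique)
    qed
    \<comment> \<open>The cosine is real on the vertical lines through 0 and \<open>pi\<close>, so
      only the linear term of the exponent contributes and the decay rate there is exactly
      \<open>\<tau>\<close>.\<close>
    have s1: "norm (F (of_real pi + of_real (h / l) * \<i>) - F (of_real pi)) \<le> 1 / \<tau>"
      using F \<tau> _ cf
    proof (rule norm_vertical_increment_le)
      fix v :: real assume "0 \<le> v"
      show "norm (f (of_real pi + of_real v * \<i>)) \<le> exp (- (\<tau> * v))"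
        unfolding f_def norm_exp_eq_Re by (simp add: Im_cos)
    qed (use h l in auto)
    have s2: "norm (F (0 + of_real (h / l) * \<i>) - F 0) \<le> 1 / \<tau>"
      using F \<tau> _ cf
    proof (rule norm_vertical_increment_le)
      fix v :: real assume "0 \<le> v"
      show "norm (f (0 + of_real v * \<i>)) \<le> exp (- (\<tau> * v))"
        unfolding f_def norm_exp_eq_Re by (simp add: Im_cos)
    qed (use h l in auto)
    \<comment> \<open>Parametrizes the top side, centred above the degenerate point
      \<open>pi / 2\<close> in units of \<open>1 / l\<close>; the shift by \<open>pi / 2\<close>
      turns the cosine into minus a sine.\<close>
    define P where "P = (\<lambda>u. of_real (pi / 2) + Complex u h / of_real l)"
    have fP: "f (P u) = cis (\<tau> * (pi / 2)) * G l u" for u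
    proof -
      define Z where "Z = Complex u h / of_real l"
      have "cos (of_real (pi / 2) + Z) = - sin Z" unfolding cos_add cos_of_real sin_of_real by simp
      then have "f (P u) = exp (\<i> * of_real (\<tau> * (pi / 2)) + \<i> * (of_real \<tau> * (Z - of_real y * sin Z)))"
        unfolding f_def P_def Z_def[symmetric] by (simp add: algebra_simps)
      then show ?thesis
        by (simp only: exp_add G_def cis_conv_exp Z_def y_def \<tau>_def)
    qed
    have "(LINT u|lborel. indicator {- (l * (pi / 2))..l * (pi / 2)} u *\<^sub>R (f (P u) / of_real l)) =
        F (P (l * (pi / 2))) - F (P (- (l * (pi / 2))))"
    proof (rule integral_FTC_atLeastAtMost)
      fix u :: real
      have "(P has_vector_derivative 1 / of_real l) (at u within {- (l * (pi / 2))..l * (pi / 2)})"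
        unfolding P_def Complex_eq by (auto intro!: derivative_eq_intros)
      from field_vector_diff_chain_within[OF this has_field_derivative_at_within[OF F]]
      show "((\<lambda>u. F (P u)) has_vector_derivative f (P u) / of_real l) (at u within {- (l * (pi / 2))..l * (pi / 2)})"
        by (simp add: o_def)
    next
      show "continuous_on {- (l * (pi / 2))..l * (pi / 2)} (\<lambda>u. f (P u) / of_real l)"
        unfolding f_def P_def Complex_eq using l by (intro continuous_intros) auto
    qed (use l in auto)
    moreover have "P (l * (pi / 2)) = of_real pi + of_real (h / l) * \<i>" "P (- (l * (pi / 2))) = 0 + of_real (h / l) * \<i>"
      using l by (auto simp: P_def complex_eq_iff)
    moreover have "(LINT u|lborel. indicator {- (l * (pi / 2))..l * (pi / 2)} u *\<^sub>R (f (P u) / of_real l)) =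
       cis (\<tau> * (pi / 2)) / of_real l * T l"
    proof -
      have "indicator {- (l * (pi / 2))..l * (pi / 2)} u *\<^sub>R (f (P u) / of_real l) =
        (cis (\<tau> * (pi / 2)) / of_real l) * (indicator {- (l * (pi / 2))..l * (pi / 2)} u *\<^sub>R G l u)" for u
        unfolding fP by (simp add: scaleR_conv_of_real)
      then show ?thesis unfolding T_def by (simp only: integral_mult_right_zero)
    qed
    ultimately have T: "cis (\<tau> * (pi / 2)) / of_real l * T l =
        F (of_real pi + of_real (h / l) * \<i>) - F (0 + of_real (h / l) * \<i>)" by simp
    define A where "A = integral {-pi..0} g"
    define B1 where "B1 = F (of_real pi + of_real (h / l) * \<i>) - F (of_real pi)"
    define B2 where "B2 = F (0 + of_real (h / l) * \<i>) - F 0"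
    have "anger \<tau> (\<tau> * y) = A - B1 + B2 + cis (\<tau> * (pi / 2)) / of_real l * T l"
      unfolding anger mid T by (simp add: A_def B1_def B2_def)
    then have "of_real l * cis (- (\<tau> * (pi / 2))) * anger \<tau> (\<tau> * y) - T l =
        of_real l * cis (- (\<tau> * (pi / 2))) * (A - B1 + B2) +
        (of_real l / of_real l) * (cis (- (\<tau> * (pi / 2))) * cis (\<tau> * (pi / 2))) * T l - T l"
      by (simp only: ring_distribs times_divide_eq_right times_divide_eq_left mult_ac)
    also have "\<dots> = of_real l * cis (- (\<tau> * (pi / 2))) * (A - B1 + B2)"
      using l by (simp add: cis_mult)
    finally have "norm (of_real l * cis (- (\<tau> * (pi / 2))) * anger \<tau> (\<tau> * y) - T l) = l * norm (A - B1 + B2)"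
      using l by (simp add: norm_mult)
    also have "norm (A - B1 + B2) \<le> norm A + norm B1 + norm B2"
      by (meson norm_triangle_ineq norm_triangle_ineq4 order_trans add_right_mono)
    then have "norm (A - B1 + B2) \<le> 6 / \<tau> + 1 / \<tau> + 1 / \<tau>"
      using left s1 s2 unfolding A_def B1_def B2_def by linarith
    then have "l * norm (A - B1 + B2) \<le> l * (8 / \<tau>)" using l by (intro mult_left_mono) (auto simp: add_divide_distrib[symmetric])
    also have "\<dots> = 8 / l\<^sup>2" using l by (simp add: \<tau>_def power2_eq_square power3_eq_cube)
    finally show ?thesis unfolding \<tau>_def y_def .
  qed
  have "((\<lambda>l. of_real l * cis (- (l ^ 3 * (pi / 2))) * anger (l ^ 3) (l ^ 3 * (1 + s / l\<^sup>2)\<^sup>2) - T l) \<longlongrightarrow> 0) at_top"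
  proof (rule Lim_null_comparison)
    show "\<forall>\<^sub>F l in at_top. norm (of_real l * cis (- (l ^ 3 * (pi / 2))) * anger (l ^ 3) (l ^ 3 * (1 + s / l\<^sup>2)\<^sup>2) - T l) \<le> 8 / l\<^sup>2"
      using eventually_ge_at_top[of 1] by eventually_elim (rule close)
    show "((\<lambda>l::real. 8 / l\<^sup>2) \<longlongrightarrow> 0) at_top" by real_asymp
  qed
  from tendsto_add[OF this T_lim] show ?thesis by simp
qed

text \<open>The function whose limit is taken in \<open>tendsto_anger\<close> does not involve the
  height, so uniqueness of limits gives independence of \<open>h\<close> without another contour
  argument.\<close>

lemma integral_airy_kernel:
  assumes "h > 0"
  shows "(LINT u|lborel. airy_kernel h \<sigma> u) = airy_int \<sigma>"
  using tendsto_unique[OF _ tendsto_anger[OF assms, of "\<sigma> / 2"] tendsto_anger[of 1 "\<sigma> / 2"]]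
  by (simp add: airy_int_def)

section \<open>The limit function solves the Airy equation\<close>

text \<open>Dominated convergence for difference quotients along sequences; the mean value theorem
  bounds them by \<open>g\<close> once the sequence is within distance 1 of
  \<open>x0\<close>.\<close>

lemma has_real_derivative_lebesgue_integral:
  fixes f f' :: "real \<Rightarrow> 'a \<Rightarrow> real"
  assumes d: "\<And>x u. ((\<lambda>x. f x u) has_real_derivative f' x u) (at x)"
    and int: "\<And>x. integrable M (f x)"
    and meas: "f' x0 \<in> borel_measurable M"
    and g: "integrable M g"
    and bound: "\<And>x u. \<bar>x - x0\<bar> \<le> 1 \<Longrightarrow> \<bar>f' x u\<bar> \<le> g u"
  shows "((\<lambda>x. LINT u|M. f x u) has_real_derivative (LINT u|M. f' x0 u)) (at x0)"
  unfolding has_field_derivative_iff tendsto_at_iff_sequentially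
proof (intro allI impI)
  fix X :: "nat \<Rightarrow> real"
  assume X: "\<forall>i. X i \<in> UNIV - {x0}" "X \<longlonglongrightarrow> x0"
  have Xne: "X i \<noteq> x0" for i using X(1) by auto
  have "\<forall>\<^sub>F i in sequentially. dist (X i) x0 < 1"
    using X(2) by (rule tendstoD) simp
  then obtain N where N: "\<And>i. i \<ge> N \<Longrightarrow> \<bar>X i - x0\<bar> \<le> 1"
    unfolding eventually_sequentially by (auto simp: dist_real_def intro: less_imp_le)
  have "(\<lambda>i. LINT u|M. (f (X (i + N)) u - f x0 u) / (X (i + N) - x0)) \<longlonglongrightarrow> (LINT u|M. f' x0 u)"
  proof (rule integral_dominated_convergence[where w = g])
    show "AE u in M. (\<lambda>i. (f (X (i + N)) u - f x0 u) / (X (i + N) - x0)) \<longlonglongrightarrow> f' x0 u"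
    proof (rule AE_I2)
      fix u
      have "((\<lambda>y. (f y u - f x0 u) / (y - x0)) \<longlongrightarrow> f' x0 u) (at x0)"
        using d[of u x0] unfolding has_field_derivative_iff .
      then have "((\<lambda>y. (f y u - f x0 u) / (y - x0)) \<circ> X) \<longlonglongrightarrow> f' x0 u"
        using X unfolding tendsto_at_iff_sequentially by blast
      then show "(\<lambda>i. (f (X (i + N)) u - f x0 u) / (X (i + N) - x0)) \<longlonglongrightarrow> f' x0 u"
        unfolding o_def by (rule LIMSEQ_ignore_initial_segment)
    qed
    show "AE u in M. norm ((f (X (i + N)) u - f x0 u) / (X (i + N) - x0)) \<le> g u" for i
    proof (rule AE_I2)
      fix u
      define y where "y = X (i + N)"
      have y: "y \<noteq> x0" "\<bar>y - x0\<bar> \<le> 1" using Xne N by (auto simp: y_def)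
      obtain z where z: "\<bar>z - x0\<bar> \<le> 1" "f y u - f x0 u = (y - x0) * f' z u"
      proof (cases "x0 < y")
        case True
        from MVT2[OF this d[of u]] obtain z where "x0 < z" "z < y" "f y u - f x0 u = (y - x0) * f' z u" by blast
        then show thesis using y by (intro that[of z]) auto
      next
        case False
        then have "y < x0" using y by simp
        from MVT2[OF this d[of u]] obtain z where "y < z" "z < x0" "f x0 u - f y u = (x0 - y) * f' z u" by blast
        then show thesis using y by (intro that[of z]) (auto simp: algebra_simps)
      qed
      then show "norm ((f (X (i + N)) u - f x0 u) / (X (i + N) - x0)) \<le> g u"
        using bound[of z u] y unfolding y_def[symmetric] by (simp add: abs_mult)
    qed
  qed (use g meas int in auto)
  moreover have "(LINT u|M. (f y u - f x0 u) / (y - x0)) = ((LINT u|M. f y u) - (LINT u|M. f x0 u)) / (y - x0)" for y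
    using int by simp
  ultimately have "(\<lambda>i. ((LINT u|M. f (X (i + N)) u) - (LINT u|M. f x0 u)) / (X (i + N) - x0)) \<longlonglongrightarrow> (LINT u|M. f' x0 u)"
    by (simp only:)
  then show "((\<lambda>y. ((LINT u|M. f y u) - (LINT u|M. f x0 u)) / (y - x0)) \<circ> X) \<longlonglongrightarrow> (LINT u|M. f' x0 u)"
    unfolding o_def by (rule LIMSEQ_offset)
qed

text \<open>Differentiating the kernel in \<open>\<sigma>\<close> produces the factor
  \<open>- \<i> * Complex u 1\<close>, so this is the \<open>k\<close>-th derivative of
  \<open>airy_moment 0\<close>. The real part makes it a real function, as the comparison arguments
  require.\<close>

definition airy_moment :: "nat \<Rightarrow> real \<Rightarrow> real" where
  "airy_moment k \<sigma> = (LINT u|lborel. Re ((- \<i> * Complex u 1) ^ k * airy_kernel 1 \<sigma> u))"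

lemma integrable_poly_gaussian:
  "integrable lborel (\<lambda>u. exp c * ((1 + \<bar>u\<bar>) ^ k * exp (- (1 / 2 * u\<^sup>2))))" for c :: real
proof (rule Bochner_Integration.integrable_bound)
  show "integrable lborel (\<lambda>u. exp c * (2 ^ k * (\<bar>u\<bar> ^ 0 * exp (- (1 / 2 * u\<^sup>2)) + \<bar>u\<bar> ^ k * exp (- (1 / 2 * u\<^sup>2)))))"
    by (intro integrable_mult_right Bochner_Integration.integrable_add integrable_gaussian_moment) auto
  have "(1 + a) ^ k \<le> 2 ^ k * (a ^ 0 + a ^ k)" if "a \<ge> 0" for a :: real
  proof (cases "a \<le> 1")
    case True
    then have "(1 + a) ^ k \<le> 2 ^ k" using that by (intro power_mono) auto
    also have "\<dots> \<le> 2 ^ k * (a ^ 0 + a ^ k)" using that by simp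
    finally show ?thesis .
  next
    case False
    then have "(1 + a) ^ k \<le> (2 * a) ^ k" by (intro power_mono) auto
    also have "\<dots> \<le> 2 ^ k * (a ^ 0 + a ^ k)" by (simp add: power_mult_distrib)
    finally show ?thesis .
  qed
  from mult_right_mono[OF this]
  have "(1 + \<bar>u\<bar>) ^ k * exp (- (1 / 2 * u\<^sup>2)) \<le> 2 ^ k * (\<bar>u\<bar> ^ 0 + \<bar>u\<bar> ^ k) * exp (- (1 / 2 * u\<^sup>2))" for u :: real
    by simp
  then have le: "(1 + \<bar>u\<bar>) ^ k * exp (- (1 / 2 * u\<^sup>2)) \<le> 2 ^ k * (\<bar>u\<bar> ^ 0 * exp (- (1 / 2 * u\<^sup>2)) + \<bar>u\<bar> ^ k * exp (- (1 / 2 * u\<^sup>2)))" for u :: real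
    by (simp only: ring_distribs mult.assoc)
  show "AE u in lborel. norm (exp c * ((1 + \<bar>u\<bar>) ^ k * exp (- (1 / 2 * u\<^sup>2))))
     \<le> norm (exp c * (2 ^ k * (\<bar>u\<bar> ^ 0 * exp (- (1 / 2 * u\<^sup>2)) + \<bar>u\<bar> ^ k * exp (- (1 / 2 * u\<^sup>2)))))"
    using mult_left_mono[OF le, of "exp c"] by (intro AE_I2) (simp add: abs_mult)
qed measurable

lemma airy_moment_integrand_le:
  assumes "\<bar>x - \<sigma>\<bar> \<le> 1"
  shows "norm ((- \<i> * Complex u 1) ^ k * airy_kernel 1 x u) \<le>
    exp (1 / 6 + \<sigma> + 1) * ((1 + \<bar>u\<bar>) ^ k * exp (- (1 / 2 * u\<^sup>2)))"
proof -
  have "norm (Complex u 1) \<le> 1 + \<bar>u\<bar>"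
    using norm_triangle_ineq[of "of_real u" \<i>] by (simp add: Complex_eq)
  then have 1: "norm (Complex u 1) ^ k \<le> (1 + \<bar>u\<bar>) ^ k" by (intro power_mono) auto
  have "norm (airy_kernel 1 x u) = exp (1 / 6 + x) * exp (- (1 / 2 * u\<^sup>2))"
    by (simp add: norm_airy_kernel mult_exp_exp)
  also have "\<dots> \<le> exp (1 / 6 + \<sigma> + 1) * exp (- (1 / 2 * u\<^sup>2))"
    using assms by (intro mult_right_mono) auto
  finally have "norm (Complex u 1) ^ k * norm (airy_kernel 1 x u) \<le> (1 + \<bar>u\<bar>) ^ k * (exp (1 / 6 + \<sigma> + 1) * exp (- (1 / 2 * u\<^sup>2)))"
    using 1 by (intro mult_mono) auto
  then show ?thesis by (simp add: norm_mult norm_power mult_ac)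
qed

lemma airy_moment_integrand_measurable [measurable]:
  "(\<lambda>u. (- \<i> * Complex u 1) ^ k * airy_kernel 1 x u) \<in> borel_measurable lborel"
  unfolding Complex_eq by measurable

lemma integrable_airy_moment:
  "integrable lborel (\<lambda>u. (- \<i> * Complex u 1) ^ k * airy_kernel 1 x u)"
proof (rule Bochner_Integration.integrable_bound[OF integrable_poly_gaussian[of "1/6 + x + 1" k]])
  show "AE u in lborel. norm ((- \<i> * Complex u 1) ^ k * airy_kernel 1 x u)
     \<le> norm (exp (1 / 6 + x + 1) * ((1 + \<bar>u\<bar>) ^ k * exp (- (1 / 2 * u\<^sup>2))))"
    using airy_moment_integrand_le[of x x] by (intro AE_I2) (auto simp: abs_mult)
qed (rule airy_moment_integrand_measurable)

lemma airy_moment_derivative: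
  "(airy_moment k has_real_derivative airy_moment (Suc k) \<sigma>) (at \<sigma>)"
proof -
  have "((\<lambda>\<sigma>. LINT u|lborel. Re ((- \<i> * Complex u 1) ^ k * airy_kernel 1 \<sigma> u)) has_real_derivative
     (LINT u|lborel. Re ((- \<i> * Complex u 1) ^ Suc k * airy_kernel 1 \<sigma> u))) (at \<sigma>)"
  proof (rule has_real_derivative_lebesgue_integral[where g = "\<lambda>u. exp (1 / 6 + \<sigma> + 1) * ((1 + \<bar>u\<bar>) ^ Suc k * exp (- (1 / 2 * u\<^sup>2)))"])
    fix x u
    have "((\<lambda>z. exp (\<i> * (Complex u 1 ^ 3 / 6 - z * Complex u 1))) has_field_derivative
       (- \<i> * Complex u 1) * airy_kernel 1 x u) (at (of_real x))"
      unfolding airy_kernel_def by (auto intro!: derivative_eq_intros)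
    from DERIV_cmult[OF this, of "(- \<i> * Complex u 1) ^ k"]
    have "((\<lambda>x. (- \<i> * Complex u 1) ^ k * airy_kernel 1 x u) has_vector_derivative
       (- \<i> * Complex u 1) ^ k * ((- \<i> * Complex u 1) * airy_kernel 1 x u)) (at x)"
      unfolding airy_kernel_def by (rule has_vector_derivative_real_field)
    from bounded_linear.has_vector_derivative[OF bounded_linear_Re this]
    show "((\<lambda>x. Re ((- \<i> * Complex u 1) ^ k * airy_kernel 1 x u)) has_real_derivative
       Re ((- \<i> * Complex u 1) ^ Suc k * airy_kernel 1 x u)) (at x)"
      by (simp add: has_real_derivative_iff_has_vector_derivative mult_ac)
    show "integrable lborel (\<lambda>u. Re ((- \<i> * Complex u 1) ^ k * airy_kernel 1 x u))"
      by (intro integrable_Re integrable_airy_moment)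
    show "\<bar>Re ((- \<i> * Complex u 1) ^ Suc k * airy_kernel 1 x u)\<bar> \<le>
       exp (1 / 6 + \<sigma> + 1) * ((1 + \<bar>u\<bar>) ^ Suc k * exp (- (1 / 2 * u\<^sup>2)))" if "\<bar>x - \<sigma>\<bar> \<le> 1"
      using order_trans[OF abs_Re_le_cmod airy_moment_integrand_le[OF that]] .
  qed (rule integrable_poly_gaussian borel_measurable_integrable[OF integrable_Re[OF integrable_airy_moment]])+
  then show ?thesis unfolding airy_moment_def[abs_def] .
qed

text \<open>The \<open>u\<close>-derivative of the kernel integrates to 0, because the kernel
  vanishes at both ends. Written in moments, this is the Airy equation.\<close>

lemma airy_moment_2: "airy_moment 2 \<sigma> = - (2 * \<sigma> * airy_moment 0 \<sigma>)"
proof -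
  define E where "E = airy_kernel 1 \<sigma>"
  define E' where "E' = (\<lambda>u. (\<i> * ((Complex u 1)\<^sup>2 / 2 - of_real \<sigma>)) * E u)"
  have dE: "(E has_vector_derivative E' u) (at u within A)" for u A
  proof -
    have "((\<lambda>z. exp (\<i> * ((z + \<i>) ^ 3 / 6 - of_real \<sigma> * (z + \<i>)))) has_field_derivative
      (\<i> * ((of_real u + \<i>)\<^sup>2 / 2 - of_real \<sigma>)) * exp (\<i> * ((of_real u + \<i>) ^ 3 / 6 - of_real \<sigma> * (of_real u + \<i>)))) (at (of_real u) )"
      by (auto intro!: derivative_eq_intros)
    from has_vector_derivative_at_within[OF has_vector_derivative_real_field[OF this]]
    show ?thesis unfolding E_def E'_def airy_kernel_def[abs_def] Complex_eq by simp
  qed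
  have E'_eq: "E' u = - \<i> / 2 * ((- \<i> * Complex u 1) ^ 2 * E u) - \<i> * of_real \<sigma> * ((- \<i> * Complex u 1) ^ 0 * E u)" for u
    by (simp add: E'_def power2_eq_square algebra_simps)
  note i2 = integrable_airy_moment[of 2 \<sigma>, folded E_def] and i0 = integrable_airy_moment[of 0 \<sigma>, folded E_def]
  have iE': "integrable lborel E'"
    unfolding E'_eq by (intro Bochner_Integration.integrable_diff integrable_mult_right i2 i0)
  have cE': "continuous_on A E'" for A
    unfolding E'_def E_def airy_kernel_def[abs_def] Complex_eq by (intro continuous_intros) auto
  have "((\<lambda>n. LINT u|lborel. indicator {-n..n} u *\<^sub>R E' u) \<longlongrightarrow> (LINT u|lborel. E' u)) at_top"
  proof (rule integral_dominated_convergence_at_top[where w = "\<lambda>u. norm (E' u)"])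
    show "AE u in lborel. ((\<lambda>n. indicator {-n..n} u *\<^sub>R E' u) \<longlongrightarrow> E' u) at_top"
    proof (rule AE_I2, rule tendsto_eventually)
      fix u :: real
      show "\<forall>\<^sub>F n in at_top. indicator {-n..n} u *\<^sub>R E' u = E' u"
        using eventually_ge_at_top[of "\<bar>u\<bar>"] by eventually_elim (auto simp: indicator_def)
    qed
  qed (use iE' in \<open>auto simp: indicator_def\<close>)
  moreover have "\<forall>\<^sub>F n in at_top. (LINT u|lborel. indicator {-n..n} u *\<^sub>R E' u) = E n - E (- n)"
    using eventually_ge_at_top[of 0]
    by eventually_elim (auto intro!: integral_FTC_atLeastAtMost dE cE')
  ultimately have L1: "((\<lambda>n. E n - E (- n)) \<longlongrightarrow> (LINT u|lborel. E' u)) at_top"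
    by (rule Lim_transform_eventually)
  have L2: "((\<lambda>n. E n - E (- n)) \<longlongrightarrow> 0 - 0) at_top"
  proof (rule tendsto_diff; rule tendsto_norm_zero_cancel)
    have "((\<lambda>n::real. exp (- (1 / 2 * n\<^sup>2))) \<longlongrightarrow> 0) at_top" by real_asymp
    from tendsto_mult_right_zero[OF this, of "exp (1 ^ 3 / 6 + \<sigma> * 1)"]
    show "((\<lambda>n. norm (E n)) \<longlongrightarrow> 0) at_top" "((\<lambda>n. norm (E (- n))) \<longlongrightarrow> 0) at_top"
      unfolding E_def norm_airy_kernel by (simp_all add: mult_exp_exp)
  qed
  from tendsto_unique[OF _ L1 L2] have "(LINT u|lborel. E' u) = 0" by simp
  moreover have "(LINT u|lborel. E' u) = - \<i> / 2 * (LINT u|lborel. (- \<i> * Complex u 1) ^ 2 * E u)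
     - \<i> * of_real \<sigma> * (LINT u|lborel. (- \<i> * Complex u 1) ^ 0 * E u)"
    unfolding E'_eq
    by (subst Bochner_Integration.integral_diff[OF integrable_mult_right integrable_mult_right])
      (use i2 i0 in \<open>simp_all only: integral_mult_right_zero\<close>)
  \<comment> \<open>The factors \<open>\<i>\<close> in front of the two integrals turn their real
    parts into imaginary ones.\<close>
  ultimately have "Im (- \<i> / 2 * (LINT u|lborel. (- \<i> * Complex u 1) ^ 2 * E u)
     - \<i> * of_real \<sigma> * (LINT u|lborel. (- \<i> * Complex u 1) ^ 0 * E u)) = 0" by simp
  then have "Re (LINT u|lborel. (- \<i> * Complex u 1) ^ 2 * E u) = - (2 * \<sigma> * Re (LINT u|lborel. (- \<i> * Complex u 1) ^ 0 * E u))"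
    by (simp add: field_simps)
  then show ?thesis
    unfolding airy_moment_def using integral_Re[OF i2] integral_Re[OF i0] by (simp add: E_def)
qed

text \<open>The contour is symmetric under reflection in the imaginary axis, under which the kernel
  is conjugated.\<close>

lemma airy_int_eq_moment: "airy_int \<sigma> = of_real (airy_moment 0 \<sigma>)"
proof -
  have "cnj (airy_kernel 1 \<sigma> u) = airy_kernel 1 \<sigma> (- u)" for u
  proof -
    have "Complex (- u) 1 = - cnj (Complex u 1)" by (simp add: complex_eq_iff)
    then show ?thesis unfolding airy_kernel_def exp_cnj
      by (simp add: power3_eq_cube algebra_simps)
  qed
  then have "cnj (airy_int \<sigma>) = (LINT u|lborel. airy_kernel 1 \<sigma> (- u))"
    unfolding airy_int_def by (simp flip: Bochner_Integration.integral_cnj)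
  also have "\<dots> = airy_int \<sigma>"
    unfolding airy_int_def using lborel_integral_real_affine[of "-1" "airy_kernel 1 \<sigma>" 0] by simp
  finally have "Im (airy_int \<sigma>) = 0" by (simp add: complex_eq_iff)
  moreover have "Re (airy_int \<sigma>) = airy_moment 0 \<sigma>"
    unfolding airy_int_def airy_moment_def using integral_Re[OF integrable_airy_moment[of 0 \<sigma>]] by simp
  ultimately show ?thesis by (simp add: complex_eq_iff)
qed

text \<open>At \<open>- h\<^sup>2 / 2\<close> the contour at height \<open>h\<close> passes through the saddle point.\<close>

lemma airy_kernel_saddle:
  "airy_kernel h (- (h\<^sup>2 / 2)) u = of_real (exp (- (h ^ 3 / 3))) * (cis (u ^ 3 / 6) * of_real (exp (- (h / 2 * u\<^sup>2))))"
proof -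
  have "\<i> * (Complex u h ^ 3 / 6 - of_real (- (h\<^sup>2 / 2)) * Complex u h) =
      of_real (- (h ^ 3 / 3)) + (\<i> * of_real (u ^ 3 / 6) + of_real (- (h / 2 * u\<^sup>2)))"
    by (simp add: complex_eq_iff power2_eq_square power3_eq_cube field_simps)
  then show ?thesis unfolding airy_kernel_def by (simp only: exp_add cis_conv_exp exp_of_real)
qed

text \<open>Steepest descent: on the contour through the saddle point only a Gaussian and a cubic
  phase remain. With height \<open>h = k\<^sup>2\<close> and \<open>u = v / k\<close> the Gaussian
  becomes standard and the cubic phase tends to 0.\<close>

lemma airy_moment_0_pos_far: "\<forall>\<^sub>F k in at_top. airy_moment 0 (- ((k\<^sup>2)\<^sup>2 / 2)) > 0"
proof -
  define J where "J = (\<lambda>k. LINT v|lborel. cis (v ^ 3 / (6 * k ^ 3)) * of_real (exp (- (1 / 2 * v\<^sup>2))))"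
  have meas: "(\<lambda>v. cis (v ^ 3 / (6 * k ^ 3)) * complex_of_real (exp (- (v\<^sup>2 / 2)))) \<in> borel_measurable borel" for k
    unfolding cis_conv_exp by measurable
  have "(J \<longlongrightarrow> (LINT v|lborel. 1 * complex_of_real (exp (- (1 / 2 * v\<^sup>2))))) at_top"
    unfolding J_def
  proof (rule integral_dominated_convergence_at_top[where w = "\<lambda>v::real. \<bar>v\<bar> ^ 0 * exp (- (1 / 2 * v\<^sup>2))"])
    show "integrable lborel (\<lambda>v::real. \<bar>v\<bar> ^ 0 * exp (- (1 / 2 * v\<^sup>2)))"
      by (rule integrable_gaussian_moment) simp
    show "AE v in lborel. ((\<lambda>k. cis (v ^ 3 / (6 * k ^ 3)) * complex_of_real (exp (- (1 / 2 * v\<^sup>2)))) \<longlongrightarrow>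
        1 * complex_of_real (exp (- (1 / 2 * v\<^sup>2)))) at_top"
    proof (rule AE_I2)
      fix v :: real
      have "((\<lambda>k. v ^ 3 / (6 * k ^ 3)) \<longlongrightarrow> 0) at_top" by real_asymp
      then have "((\<lambda>k. cis (v ^ 3 / (6 * k ^ 3))) \<longlongrightarrow> cis 0) at_top" by (intro tendsto_intros)
      then show "((\<lambda>k. cis (v ^ 3 / (6 * k ^ 3)) * complex_of_real (exp (- (1 / 2 * v\<^sup>2)))) \<longlongrightarrow>
        1 * complex_of_real (exp (- (1 / 2 * v\<^sup>2)))) at_top"
        by (intro tendsto_mult tendsto_const) simp
    qed
  qed (auto simp: norm_mult intro!: meas)
  moreover have "(LINT v|lborel. 1 * complex_of_real (exp (- (1 / 2 * v\<^sup>2)))) = of_real (sqrt (2 * pi))"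
  proof -
    have "(LINT v|lborel. exp (- (1 / 2 * v\<^sup>2))) = (LINT v|lborel. sqrt (2 * pi) * std_normal_density v)"
      by (intro Bochner_Integration.integral_cong) (auto simp: std_normal_density_def)
    then show ?thesis by simp
  qed
  ultimately have "((\<lambda>k. Re (J k)) \<longlongrightarrow> sqrt (2 * pi)) at_top"
    using tendsto_Re[of J "of_real (sqrt (2 * pi))"] by simp
  then have "\<forall>\<^sub>F k in at_top. Re (J k) > 0"
    by (rule order_tendstoD) simp
  then show ?thesis
    using eventually_gt_at_top[of 0]
  proof eventually_elim
    case (elim k)
    define h where "h = k\<^sup>2"
    have h: "h > 0" using elim by (simp add: h_def)
    have "airy_int (- (h\<^sup>2 / 2)) = (LINT u|lborel. airy_kernel h (- (h\<^sup>2 / 2)) u)"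
      using integral_airy_kernel[OF h] by simp
    also have "\<dots> = of_real (exp (- (h ^ 3 / 3))) * (LINT u|lborel. cis (u ^ 3 / 6) * of_real (exp (- (h / 2 * u\<^sup>2))))"
      unfolding airy_kernel_saddle by simp
    also have "(LINT u|lborel. cis (u ^ 3 / 6) * complex_of_real (exp (- (h / 2 * u\<^sup>2)))) = of_real (1 / k) * J k"
    proof -
      have "cis ((0 + 1 / k * v) ^ 3 / 6) * complex_of_real (exp (- (h / 2 * (0 + 1 / k * v)\<^sup>2))) =
         cis (v ^ 3 / (6 * k ^ 3)) * of_real (exp (- (1 / 2 * v\<^sup>2)))" for v
        using elim by (simp add: h_def power_divide mult.commute)
      then show ?thesis
        using elim lborel_integral_real_affine[of "1 / k" "\<lambda>u. cis (u ^ 3 / 6) * complex_of_real (exp (- (h / 2 * u\<^sup>2)))" 0]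
        by (simp add: J_def scaleR_conv_of_real)
    qed
    finally have "airy_moment 0 (- (h\<^sup>2 / 2)) = exp (- (h ^ 3 / 3)) * (1 / k * Re (J k))"
      unfolding airy_int_eq_moment by (simp add: complex_eq_iff)
    then show ?case using elim by (simp add: h_def)
  qed
qed

text \<open>On the negative half-line the equation makes the square of \<open>w\<close> convex, and
  it is bounded there; a convex function bounded towards minus infinity is nondecreasing. So
  \<open>w\<close> cannot return to 0 after a point far to the left where it is positive.\<close>

lemma airy_moment_0_pos:
  assumes "x \<le> 0"
  shows "airy_moment 0 x > 0"
proof -
  define w where "w = airy_moment 0"
  define w' where "w' = airy_moment 1"
  have d1: "(w has_real_derivative w' y) (at y)" for y
    unfolding w_def w'_def using airy_moment_derivative[of 0] by simp
  have d2: "(w' has_real_derivative - (2 * y * w y)) (at y)" for y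
    unfolding w_def w'_def using airy_moment_derivative[of 1] airy_moment_2 by (simp add: numeral_2_eq_2)
  define B where "B = (LINT (u::real)|lborel. exp (1 / 6 + 0 + 1 :: real) * ((1 + \<bar>u\<bar>) ^ 0 * exp (- (1 / 2 * u\<^sup>2))))"
  have B: "\<bar>w y\<bar> \<le> B" if "y \<le> 0" for y
  proof -
    have "\<bar>w y\<bar> \<le> (LINT u|lborel. \<bar>Re ((- \<i> * Complex u 1) ^ 0 * airy_kernel 1 y u)\<bar>)"
      unfolding w_def airy_moment_def by (rule integral_abs_bound)
    also have "\<dots> \<le> B" unfolding B_def
    proof (rule integral_mono)
      fix u :: real
      have "\<bar>Re ((- \<i> * Complex u 1) ^ 0 * airy_kernel 1 y u)\<bar> \<le> norm (airy_kernel 1 y u)"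
        using abs_Re_le_cmod by simp
      also have "\<dots> = exp (1 / 6 + y) * exp (- (1 / 2 * u\<^sup>2))"
        by (simp add: norm_airy_kernel mult_exp_exp)
      also have "\<dots> \<le> exp (1 / 6 + 0 + 1 :: real) * ((1 + \<bar>u\<bar>) ^ 0 * exp (- (1 / 2 * u\<^sup>2)))"
        using that by (simp add: mult_right_mono)
      finally show "\<bar>Re ((- \<i> * Complex u 1) ^ 0 * airy_kernel 1 y u)\<bar> \<le> exp (1 / 6 + 0 + 1 :: real) * ((1 + \<bar>u\<bar>) ^ 0 * exp (- (1 / 2 * u\<^sup>2)))" .
    qed (intro integrable_abs integrable_Re integrable_airy_moment integrable_poly_gaussian)+
    finally show ?thesis .
  qed
  define q where "q = (\<lambda>y. 2 * w y * w' y)"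
  have dq: "((\<lambda>y. (w y)\<^sup>2) has_real_derivative q y) (at y)" for y
    unfolding q_def by (auto intro!: derivative_eq_intros d1)
  have q_mono: "q a \<le> q b" if "a \<le> b" "b \<le> 0" for a b
  proof (rule DERIV_nonneg_imp_nondecreasing[OF that(1)], intro exI conjI)
    fix y assume y: "a \<le> y" "y \<le> b"
    show "(q has_real_derivative 2 * (w' y)\<^sup>2 - 4 * y * (w y)\<^sup>2) (at y)"
      unfolding q_def by (auto intro!: derivative_eq_intros d1 d2 simp: power2_eq_square algebra_simps)
    have "y * (w y)\<^sup>2 \<le> 0" using y that by (intro mult_nonpos_nonneg) auto
    then show "0 \<le> 2 * (w' y)\<^sup>2 - 4 * y * (w y)\<^sup>2"
      using zero_le_power2[of "w' y"] by linarith
  qed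
  have q_nonneg: "q b \<ge> 0" if b: "b \<le> 0" for b
  proof (rule ccontr)
    assume "\<not> q b \<ge> 0"
    then have qb: "q b < 0" by simp
    \<comment> \<open>Going left by \<open>t\<close> along the tangent with negative slope
      \<open>q b\<close> gains \<open>B\<^sup>2 + 1\<close>, more than the bound on the square of
      \<open>w\<close> permits.\<close>
    define t where "t = (B\<^sup>2 + 1) / (- q b)"
    have "0 < B\<^sup>2 + 1" by (simp add: add_nonneg_pos)
    then have "t > 0" unfolding t_def using qb by (intro divide_pos_pos) auto
    moreover have "q b * t = - (B\<^sup>2 + 1)" using qb by (simp add: t_def)
    ultimately have t: "t > 0" "q b * t = - (B\<^sup>2 + 1)" .
    have "(w b)\<^sup>2 - q b * b \<le> (w (b - t))\<^sup>2 - q b * (b - t)"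
    proof (rule DERIV_nonpos_imp_nonincreasing[of "b - t" b "\<lambda>y. (w y)\<^sup>2 - q b * y"])
      fix y assume y: "b - t \<le> y" "y \<le> b"
      have "((\<lambda>y. (w y)\<^sup>2 - q b * y) has_real_derivative q y - q b) (at y)"
        by (rule DERIV_diff[OF dq DERIV_cmult_Id])
      then show "\<exists>z. ((\<lambda>y. (w y)\<^sup>2 - q b * y) has_real_derivative z) (at y) \<and> z \<le> 0"
        using q_mono[OF y(2) b] by force
    qed (use t in auto)
    then have "(w (b - t))\<^sup>2 \<ge> (w b)\<^sup>2 - q b * t" by (simp add: algebra_simps)
    moreover have "\<bar>w (b - t)\<bar> \<le> B" using B[of "b - t"] t b by simp
    then have "(w (b - t))\<^sup>2 \<le> B\<^sup>2" by (metis abs_ge_zero power2_abs power_mono)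
    ultimately show False using t(2) zero_le_power2[of "w b"] by linarith
  qed
  obtain c where c: "c \<le> x" "w c > 0"
  proof -
    have "\<forall>\<^sub>F k in at_top. - ((k\<^sup>2)\<^sup>2 / 2) \<le> x" by real_asymp
    then have "\<forall>\<^sub>F k in at_top. - ((k\<^sup>2)\<^sup>2 / 2) \<le> x \<and> w (- ((k\<^sup>2)\<^sup>2 / 2)) > 0"
      using airy_moment_0_pos_far unfolding w_def by eventually_elim simp
    then show thesis using that eventually_happens[of _ "at_top :: real filter"] by force
  qed
  have sq: "(w c)\<^sup>2 \<le> (w y)\<^sup>2" if "c \<le> y" "y \<le> x" for y
  proof (rule DERIV_nonneg_imp_nondecreasing[OF that(1)])
    fix z assume "c \<le> z" "z \<le> y"
    then show "\<exists>r. ((\<lambda>y. (w y)\<^sup>2) has_real_derivative r) (at z) \<and> 0 \<le> r"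
      using dq[of z] q_nonneg[of z] that assms by auto
  qed
  have "w x > 0"
  proof (rule ccontr)
    assume "\<not> w x > 0"
    then obtain z where "c \<le> z" "z \<le> x" "w z = 0"
      using IVT2'[of w x 0 c] c d1 by (auto intro!: continuous_at_imp_continuous_on DERIV_isCont)
    then show False using sq[of z] c by simp
  qed
  then show ?thesis by (simp add: w_def)
qed

lemma airy_moment_0_fifth_power_pos:
  assumes "integrable lborel (\<lambda>x. airy_moment 0 x ^ 5)"
  shows "0 < (LINT x|lborel. airy_moment 0 x ^ 5)"
proof (rule airy_fifth_power_integral_pos[where k = 2 and w' = "airy_moment 1"])
  show "(airy_moment 0 has_real_derivative airy_moment 1 x) (at x)" for x
    using airy_moment_derivative[of 0] by simp
  show "(airy_moment 1 has_real_derivative - (2 * x * airy_moment 0 x)) (at x)" for x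
    using airy_moment_derivative[of 1] airy_moment_2 by (simp add: numeral_2_eq_2)
qed (use assms airy_moment_0_pos in auto)

section \<open>The rescaled one-dimensional integral\<close>

text \<open>Passes from gauge integrals of powers, which are available in closed form, to Borel
  integrability; the absolute integral lives on the completed measure, so Borel measurability is
  used to descend.\<close>

lemma integrable_lborel_nonneg_has_integral:
  fixes f :: "real \<Rightarrow> real"
  assumes "(f has_integral I) S" "\<And>x. x \<in> S \<Longrightarrow> f x \<ge> 0" "f \<in> borel_measurable borel" "S \<in> sets borel"
  shows "set_integrable lborel S f"
proof -
  have "f absolutely_integrable_on S"
    using assms(1,2) by (intro nonnegative_absolutely_integrable_1) (auto simp: integrable_on_def)
  moreover have "(\<lambda>x. indicator S x *\<^sub>R f x) \<in> borel_measurable lborel"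
    using assms(3,4) by measurable
  ultimately show ?thesis
    unfolding set_integrable_def by (subst (asm) integrable_completion) auto
qed

lemma integrable_max_powr:
  assumes "e < -1"
  shows "integrable lborel (\<lambda>s::real. max 1 \<bar>s\<bar> powr e)"
proof -
  have 1: "integrable lborel (\<lambda>s::real. indicator {1..} s *\<^sub>R (s powr e))"
    using integrable_lborel_nonneg_has_integral[OF has_integral_powr_to_inf[OF assms, of 1]]
    unfolding set_integrable_def by simp
  have 2: "integrable lborel (\<lambda>s::real. indicator {1..} (- s) *\<^sub>R ((- s) powr e))"
    using lborel_integrable_real_affine[OF 1, of "-1" 0] by simp
  have 3: "integrable lborel (\<lambda>s::real. indicator {-1..1} s :: real)"
    by (intro integrable_real_indicator) auto
  show ?thesis
  proof (rule Bochner_Integration.integrable_bound)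
    show "integrable lborel (\<lambda>s. indicator {1..} s *\<^sub>R (s powr e) + indicator {1..} (- s) *\<^sub>R ((- s) powr e) + indicator {-1..1} s)"
      by (intro Bochner_Integration.integrable_add 1 2 3)
    show "AE s in lborel. norm (max 1 \<bar>s\<bar> powr e) \<le> norm (indicator {1..} s *\<^sub>R (s powr e) + indicator {1..} (- s) *\<^sub>R ((- s) powr e) + indicator {-1..1} s)"
      by (intro AE_I2) (auto simp: indicator_def max_def abs_if)
  qed measurable
qed

lemma continuous_on_anger: "continuous_on A (anger \<tau>)"
proof -
  have "continuous_on UNIV (\<lambda>z. integral (cbox (-pi) pi) (\<lambda>\<xi>. cis (\<tau> * \<xi> + z * cos \<xi>)))"
    by (rule integral_continuous_on_param) (auto intro!: continuous_intros simp: case_prod_unfold)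
  then show ?thesis unfolding anger_def[abs_def]
    using continuous_on_subset by auto
qed

lemma anger_measurable [measurable]: "anger \<tau> \<in> borel_measurable borel"
  by (rule borel_measurable_continuous_onI[OF continuous_on_anger])

text \<open>The factor \<open>l\<close> and the phase at \<open>pi / 2\<close> are removed so that a
  nontrivial limit exists; \<open>s\<close> measures the distance of \<open>r\<close> from 1 in
  units of \<open>1 / l\<^sup>2\<close>.\<close>

definition scaled_anger :: "real \<Rightarrow> real \<Rightarrow> complex" where
  "scaled_anger l s = of_real l * cis (- (l ^ 3 * (pi / 2))) * anger (l ^ 3) (l ^ 3 * (1 + s / l\<^sup>2)\<^sup>2)"

text \<open>The factor \<open>l\<close> cancels the \<open>1 / l\<close> of
  \<open>anger_bound\<close>, and the fifth power turns the decay exponent 1/4 into 5/4, which is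
  integrable at infinity.\<close>

lemma norm_scaled_anger_le:
  assumes "l \<ge> 1" "1 + s / l\<^sup>2 \<ge> 0"
  shows "norm (scaled_anger l s) ^ 5 \<le> 120 ^ 5 * max 1 \<bar>s\<bar> powr (- (5 / 4))"
proof -
  define q where "q = max 1 \<bar>s\<bar> powr (1 / 4)"
  have q: "q \<ge> 1" unfolding q_def by (rule ge_one_powr_ge_zero) auto
  have q4: "q ^ 4 = max 1 \<bar>s\<bar>" unfolding q_def by (subst powr_power) auto
  have "l\<^sup>2 * \<bar>(1 + s / l\<^sup>2) - 1\<bar> = \<bar>s\<bar>" using assms(1) by (simp add: abs_divide)
  then have "norm (anger (l ^ 3) (l ^ 3 * (1 + s / l\<^sup>2)\<^sup>2)) \<le> 120 / (l * q)"
    using anger_bound[OF assms q] q4 by simp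
  from mult_left_mono[OF this, of l] have "norm (scaled_anger l s) \<le> 120 / q"
    using assms(1) by (simp add: scaled_anger_def norm_mult)
  then have "norm (scaled_anger l s) ^ 5 \<le> (120 / q) ^ 5" by (intro power_mono) auto
  also have "\<dots> = 120 ^ 5 * max 1 \<bar>s\<bar> powr (- (5 / 4))"
  proof -
    have "q ^ 5 = max 1 \<bar>s\<bar> powr (5 / 4)"
      unfolding q_def by (subst powr_power) auto
    then show ?thesis
      by (simp only: power_divide powr_minus_divide times_divide_eq_right mult_1_right)
  qed
  finally show ?thesis .
qed

lemma tendsto_scaled_anger: "((\<lambda>l. scaled_anger l s) \<longlongrightarrow> of_real (airy_moment 0 (2 * s))) at_top"
  using tendsto_anger[of 1 s] unfolding scaled_anger_def airy_int_eq_moment[symmetric] airy_int_def by simp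

lemma eventually_one_plus_pos: "\<forall>\<^sub>F l in at_top. 1 + s / l\<^sup>2 > (0::real)"
proof -
  have "((\<lambda>l::real. 1 + s / l\<^sup>2) \<longlongrightarrow> 1) at_top" by real_asymp
  then show ?thesis by (rule order_tendstoD) simp
qed

text \<open>\<open>line_integrand\<close> in the variable \<open>s\<close>, without the constant
  phases and powers of \<open>l\<close>. The indicator expresses \<open>x > 0\<close>, and the
  \<open>cis\<close> factor is the outer phase after completing the square.\<close>

definition scaled_integrand :: "real \<Rightarrow> real \<Rightarrow> complex" where
  "scaled_integrand l s = indicator {0<..} (1 + s / l\<^sup>2) *\<^sub>R
     (cis (- (5 * l ^ 3 * ((1 + s / l\<^sup>2) - 1 / (1 + s / l\<^sup>2))\<^sup>2)) * scaled_anger l s ^ 5)"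

lemma scaled_integrand_measurable [measurable]: "scaled_integrand l \<in> borel_measurable borel"
  unfolding scaled_integrand_def[abs_def] scaled_anger_def cis_conv_exp by measurable

lemma norm_scaled_integrand_le:
  assumes "l \<ge> 1"
  shows "norm (scaled_integrand l s) \<le> 120 ^ 5 * max 1 \<bar>s\<bar> powr (- (5 / 4))"
  using norm_scaled_anger_le[OF assms, of s]
  by (cases "1 + s / l\<^sup>2 > 0") (auto simp: scaled_integrand_def norm_mult norm_power)

lemma integrable_scaled_integrand:
  assumes "l \<ge> 1"
  shows "integrable lborel (scaled_integrand l)"
proof (rule Bochner_Integration.integrable_bound)
  show "integrable lborel (\<lambda>s::real. 120 ^ 5 * max 1 \<bar>s\<bar> powr (- (5 / 4)))"
    by (intro integrable_mult_right integrable_max_powr) simp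
  show "AE s in lborel. norm (scaled_integrand l s) \<le> norm (120 ^ 5 * max 1 \<bar>s\<bar> powr (- (5 / 4)))"
    using norm_scaled_integrand_le[OF assms] by (intro AE_I2) simp
qed simp

text \<open>The outer phase is quadratic about \<open>r = 1\<close>, which is also the turning
  point: \<open>r - 1 / r\<close> is of order \<open>s / l\<^sup>2\<close>, so the phase is of order
  \<open>s\<^sup>2 / l\<close> and disappears.\<close>

lemma tendsto_scaled_integrand:
  "((\<lambda>l. scaled_integrand l s) \<longlongrightarrow> of_real (airy_moment 0 (2 * s) ^ 5)) at_top"
proof -
  have r: "((\<lambda>l::real. 1 + s / l\<^sup>2) \<longlongrightarrow> 1) at_top" by real_asymp
  have "((\<lambda>l. 5 * (s\<^sup>2 / l) * (1 + 1 / (1 + s / l\<^sup>2))\<^sup>2) \<longlongrightarrow> 5 * 0 * (1 + 1 / 1)\<^sup>2) at_top"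
  proof (intro tendsto_intros r)
    show "((\<lambda>l. s\<^sup>2 / l) \<longlongrightarrow> 0) at_top" by real_asymp
  qed simp
  moreover have "\<forall>\<^sub>F l in at_top. 5 * (s\<^sup>2 / l) * (1 + 1 / (1 + s / l\<^sup>2))\<^sup>2 =
      5 * l ^ 3 * ((1 + s / l\<^sup>2) - 1 / (1 + s / l\<^sup>2))\<^sup>2"
    using eventually_one_plus_pos[of s] eventually_gt_at_top[of 0]
  proof eventually_elim
    case (elim l)
    define r where "r = 1 + s / l\<^sup>2"
    have "r - 1 / r = (s / l\<^sup>2) * (1 + 1 / r)"
      using elim(1) unfolding r_def[symmetric]
    proof -
      assume "0 < r"
      then have "r - 1 / r = (r - 1) * (1 + 1 / r)" by (simp add: field_simps)
      then show ?thesis by (simp add: r_def)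
    qed
    then show ?case unfolding r_def[symmetric] using elim(2)
      by (simp add: power_mult_distrib power_divide power2_eq_square power3_eq_cube)
  qed
  ultimately have "((\<lambda>l. 5 * l ^ 3 * ((1 + s / l\<^sup>2) - 1 / (1 + s / l\<^sup>2))\<^sup>2) \<longlongrightarrow> 0) at_top"
    by (simp add: tendsto_cong)
  then have "((\<lambda>l. cis (- (5 * l ^ 3 * ((1 + s / l\<^sup>2) - 1 / (1 + s / l\<^sup>2))\<^sup>2)) * scaled_anger l s ^ 5)
      \<longlongrightarrow> cis (- 0) * of_real (airy_moment 0 (2 * s)) ^ 5) at_top"
    by (intro tendsto_intros tendsto_scaled_anger)
  moreover have "\<forall>\<^sub>F l in at_top. cis (- (5 * l ^ 3 * ((1 + s / l\<^sup>2) - 1 / (1 + s / l\<^sup>2))\<^sup>2)) * scaled_anger l s ^ 5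
      = scaled_integrand l s"
    using eventually_one_plus_pos[of s] by eventually_elim (simp add: scaled_integrand_def)
  ultimately show ?thesis by (simp add: tendsto_cong)
qed

lemma airy_moment_0_measurable [measurable]: "airy_moment 0 \<in> borel_measurable borel"
  using airy_moment_derivative[of 0]
  by (intro borel_measurable_continuous_onI continuous_at_imp_continuous_on) (auto intro: DERIV_isCont)

lemma tendsto_integral_scaled_integrand:
  "((\<lambda>l. LINT s|lborel. scaled_integrand l s) \<longlongrightarrow> of_real (LINT s|lborel. airy_moment 0 (2 * s) ^ 5)) at_top"
proof -
  have "((\<lambda>l. LINT s|lborel. scaled_integrand l s) \<longlongrightarrow> (LINT s|lborel. complex_of_real (airy_moment 0 (2 * s) ^ 5))) at_top"
  proof (rule integral_dominated_convergence_at_top[where w = "\<lambda>s. 120 ^ 5 * max 1 \<bar>s\<bar> powr (- (5 / 4))"])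
    show "integrable lborel (\<lambda>s::real. 120 ^ 5 * max 1 \<bar>s\<bar> powr (- (5 / 4)))"
      by (intro integrable_mult_right integrable_max_powr) simp
    show "\<forall>\<^sub>F l in at_top. AE s in lborel. norm (scaled_integrand l s) \<le> 120 ^ 5 * max 1 \<bar>s\<bar> powr (- (5 / 4))"
      using eventually_ge_at_top[of 1] by eventually_elim (intro AE_I2 norm_scaled_integrand_le)
    show "AE s in lborel. ((\<lambda>l. scaled_integrand l s) \<longlongrightarrow> complex_of_real (airy_moment 0 (2 * s) ^ 5)) at_top"
      by (intro AE_I2 tendsto_scaled_integrand)
  qed simp_all
  then show ?thesis by (simp only: integral_complex_of_real)
qed

text \<open>The decay of the Airy function is inherited from the uniform majorant of
  \<open>scaled_integrand\<close> by passing to the limit; this supplies the integrability that the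
  positivity theorem assumes.\<close>

lemma airy_fifth_power_integral_nonzero: "(LINT s|lborel. airy_moment 0 (2 * s) ^ 5) > 0"
proof -
  have le: "\<bar>airy_moment 0 (2 * s) ^ 5\<bar> \<le> 120 ^ 5 * max 1 \<bar>s\<bar> powr (- (5 / 4))" for s
  proof (rule tendsto_upperbound)
    have "((\<lambda>l. norm (scaled_integrand l s)) \<longlongrightarrow> norm (complex_of_real (airy_moment 0 (2 * s) ^ 5))) at_top"
      by (intro tendsto_norm tendsto_scaled_integrand)
    then show "((\<lambda>l. norm (scaled_integrand l s)) \<longlongrightarrow> \<bar>airy_moment 0 (2 * s) ^ 5\<bar>) at_top"
      by (simp only: norm_of_real)
    show "\<forall>\<^sub>F l in at_top. norm (scaled_integrand l s) \<le> 120 ^ 5 * max 1 \<bar>s\<bar> powr (- (5 / 4))"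
      using eventually_ge_at_top[of 1] by eventually_elim (rule norm_scaled_integrand_le)
  qed simp
  have "integrable lborel (\<lambda>s. airy_moment 0 (2 * s) ^ 5)"
  proof (rule Bochner_Integration.integrable_bound)
    show "integrable lborel (\<lambda>s::real. 120 ^ 5 * max 1 \<bar>s\<bar> powr (- (5 / 4)))"
      by (intro integrable_mult_right integrable_max_powr) simp
    show "AE s in lborel. norm (airy_moment 0 (2 * s) ^ 5) \<le> norm (120 ^ 5 * max 1 \<bar>s\<bar> powr (- (5 / 4)))"
      using le by (intro AE_I2) simp
  qed measurable
  then have int: "integrable lborel (\<lambda>s. airy_moment 0 s ^ 5)"
    using lborel_integrable_real_affine_iff[of 2 "\<lambda>s. airy_moment 0 s ^ 5" 0] by simp
  have "(LINT s|lborel. airy_moment 0 s ^ 5) = 2 * (LINT s|lborel. airy_moment 0 (2 * s) ^ 5)"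
    using lborel_integral_real_affine[of 2 "\<lambda>s. airy_moment 0 s ^ 5" 0] by simp
  then show ?thesis using airy_moment_0_fifth_power_pos[OF int] by simp
qed

section \<open>Fresnel integrals and subordination\<close>

text \<open>On the ray through \<open>1 - \<i>\<close> the integrand becomes the real Gaussian
  \<open>exp (- (2 * v\<^sup>2))\<close>, hence \<open>\<kappa>\<close> is \<open>1 - \<i>\<close>
  times a positive number. Oddness carries the limit to minus infinity.\<close>

lemma fresnel_primitive:
  obtains \<Phi> :: "real \<Rightarrow> complex" and \<kappa> :: complex and B :: real where
    "\<And>u. (\<Phi> has_vector_derivative cis (- (u\<^sup>2))) (at u)"
    "(\<Phi> \<longlongrightarrow> \<kappa>) at_top" "(\<Phi> \<longlongrightarrow> - \<kappa>) at_bot" "\<kappa> \<noteq> 0" "\<And>u. norm (\<Phi> u) \<le> B"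
proof -
  define f where "f = (\<lambda>z::complex. exp (- (\<i> * z\<^sup>2)))"
  have fh: "f holomorphic_on UNIV" unfolding f_def by (intro holomorphic_intros)
  then have cf: "continuous_on UNIV f" by (rule holomorphic_on_imp_continuous_on)
  obtain F where F: "\<And>z. (F has_field_derivative f z) (at z)" using entire_primitive[OF fh] by blast
  define \<Phi> where "\<Phi> = (\<lambda>u::real. F (of_real u) - F 0)"
  have d: "(\<Phi> has_vector_derivative cis (- (u\<^sup>2))) (at u)" for u
  proof -
    have "((\<lambda>u. F (of_real u)) has_vector_derivative f (of_real u)) (at u)"
      by (rule has_vector_derivative_real_field[OF F])
    then have "(\<Phi> has_vector_derivative f (of_real u) - 0) (at u)"
      unfolding \<Phi>_def by (intro has_vector_derivative_diff has_vector_derivative_const)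
    then show ?thesis by (simp add: f_def cis_conv_exp)
  qed
  define c where "c = (LINT v|lborel. indicator {0..} v *\<^sub>R exp (- (2 * v\<^sup>2)) :: real)"
  have ig: "integrable lborel (\<lambda>v::real. exp (- (2 * v\<^sup>2)))"
    using integrable_gaussian_moment[of 2 0] by simp
  have c: "c > 0"
  proof -
    have "exp (- 2) = (LINT (v::real)|lborel. indicator {0..1} v *\<^sub>R exp (- 2) :: real)"
      by (simp add: content_real)
    also have "\<dots> \<le> c" unfolding c_def
    proof (rule integral_mono)
      show "integrable lborel (\<lambda>v::real. indicator {0..1} v *\<^sub>R exp (- 2) :: real)"
        by (intro integrable_scaleR_left integrable_real_indicator) auto
      show "integrable lborel (\<lambda>v::real. indicator {0..} v *\<^sub>R exp (- (2 * v\<^sup>2)) :: real)"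
        by (intro integrable_mult_indicator ig) auto
      fix v :: real
      show "indicator {0..1} v *\<^sub>R exp (- 2) \<le> (indicator {0..} v *\<^sub>R exp (- (2 * v\<^sup>2)) :: real)"
        using power_mono[of v 1 2] by (auto simp: indicator_def)
    qed
    finally show ?thesis using exp_gt_zero[of "-2 :: real"] by linarith
  qed
  define \<kappa> where "\<kappa> = (1 - \<i>) * of_real c"
  have "((\<lambda>U. LINT v|lborel. indicator {0..U} v *\<^sub>R ((1 - \<i>) * of_real (exp (- (2 * v\<^sup>2))))) \<longlongrightarrow>
      (LINT v|lborel. (1 - \<i>) * of_real (indicator {0..} v *\<^sub>R exp (- (2 * v\<^sup>2))))) at_top"
  proof (rule integral_dominated_convergence_at_top[where w = "\<lambda>v. norm (1 - \<i>) * exp (- (2 * v\<^sup>2))"])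
    show "AE v in lborel. ((\<lambda>U. indicator {0..U} v *\<^sub>R ((1 - \<i>) * complex_of_real (exp (- (2 * v\<^sup>2))))) \<longlongrightarrow>
      (1 - \<i>) * complex_of_real (indicator {0..} v *\<^sub>R exp (- (2 * v\<^sup>2)))) at_top"
    proof (rule AE_I2, rule tendsto_eventually)
      fix v :: real
      show "\<forall>\<^sub>F U in at_top. indicator {0..U} v *\<^sub>R ((1 - \<i>) * complex_of_real (exp (- (2 * v\<^sup>2)))) =
        (1 - \<i>) * complex_of_real (indicator {0..} v *\<^sub>R exp (- (2 * v\<^sup>2)))"
        using eventually_ge_at_top[of v] by eventually_elim (auto simp: indicator_def)
    qed
  qed (use ig in \<open>auto simp: indicator_def norm_mult\<close>)
  moreover have "(LINT v|lborel. (1 - \<i>) * complex_of_real (indicator {0..} v *\<^sub>R exp (- (2 * v\<^sup>2)))) = \<kappa>"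
    unfolding \<kappa>_def c_def by (simp only: integral_mult_right_zero integral_complex_of_real)
  moreover have "\<forall>\<^sub>F U in at_top. (LINT v|lborel. indicator {0..U} v *\<^sub>R ((1 - \<i>) * complex_of_real (exp (- (2 * v\<^sup>2))))) =
      F (of_real U * (1 - \<i>)) - F 0"
    using eventually_ge_at_top[of 0]
  proof eventually_elim
    case (elim U)
    have "(LINT v|lborel. indicator {0..U} v *\<^sub>R ((1 - \<i>) * complex_of_real (exp (- (2 * v\<^sup>2))))) =
       F (of_real U * (1 - \<i>)) - F (of_real 0 * (1 - \<i>))"
    proof (rule integral_FTC_atLeastAtMost[OF elim])
      fix v
      have "((\<lambda>v. of_real v * (1 - \<i>)) has_vector_derivative 1 - \<i>) (at v within {0..U})"
        by (auto intro!: derivative_eq_intros)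
      from field_vector_diff_chain_within[OF this has_field_derivative_at_within[OF F]]
      have "((\<lambda>v. F (of_real v * (1 - \<i>))) has_vector_derivative (1 - \<i>) * f (of_real v * (1 - \<i>))) (at v within {0..U})"
        by (simp add: o_def)
      moreover have "f (of_real v * (1 - \<i>)) = of_real (exp (- (2 * v\<^sup>2)))"
      proof -
        have "- (\<i> * (of_real v * (1 - \<i>))\<^sup>2) = complex_of_real (- (2 * v\<^sup>2))"
          by (simp add: complex_eq_iff power2_eq_square)
        then show ?thesis by (simp only: f_def exp_of_real)
      qed
      ultimately show "((\<lambda>v. F (of_real v * (1 - \<i>))) has_vector_derivative (1 - \<i>) * of_real (exp (- (2 * v\<^sup>2)))) (at v within {0..U})"
        by simp
    qed (intro continuous_intros)
    then show ?case by simp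
  qed
  ultimately have diag: "((\<lambda>U. F (of_real U * (1 - \<i>)) - F 0) \<longlongrightarrow> \<kappa>) at_top"
    by (simp add: tendsto_cong)
  \<comment> \<open>The vertical segment from \<open>U\<close> to the ray has length
    \<open>U\<close>; the integrand decays along it at rate \<open>2 * U\<close>, so the segment
    contributes at most \<open>1 / (2 * U)\<close>.\<close>
  have "((\<lambda>U. F (of_real U * (1 - \<i>)) - F (of_real U)) \<longlongrightarrow> 0) at_top"
  proof (rule Lim_null_comparison)
    show "\<forall>\<^sub>F U in at_top. norm (F (of_real U * (1 - \<i>)) - F (of_real U)) \<le> 1 / (2 * U)"
      using eventually_gt_at_top[of 0]
    proof eventually_elim
      case (elim U)
      have "norm (F (of_real U + of_real U * (- \<i>)) - F (of_real U)) \<le> 1 / (2 * U)"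
        using F _ _ cf
      proof (rule norm_vertical_increment_le)
        fix v :: real assume "0 \<le> v"
        show "norm (f (of_real U + of_real v * (- \<i>))) \<le> exp (- (2 * U * v))"
          unfolding f_def norm_exp_eq_Re by (simp add: power2_eq_square algebra_simps)
      qed (use elim in auto)
      then show ?case by (simp add: algebra_simps)
    qed
    show "((\<lambda>U::real. 1 / (2 * U)) \<longlongrightarrow> 0) at_top" by real_asymp
  qed
  from tendsto_diff[OF diag this] have top: "(\<Phi> \<longlongrightarrow> \<kappa>) at_top" by (simp add: \<Phi>_def)
  have odd: "\<Phi> (- u) = - \<Phi> u" for u
  proof -
    have "((\<lambda>u. \<Phi> u + \<Phi> (- u)) has_vector_derivative 0) (at x)" for x
    proof -
      have "((\<lambda>u. \<Phi> (- u)) has_vector_derivative (- 1) *\<^sub>R cis (- ((- x)\<^sup>2))) (at x)"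
        using vector_diff_chain_at[OF has_vector_derivative_minus[OF has_vector_derivative_id] d] by (simp add: o_def)
      from has_vector_derivative_add[OF d this] show ?thesis by simp
    qed
    then have "(\<lambda>u. \<Phi> u + \<Phi> (- u)) u = (\<lambda>u. \<Phi> u + \<Phi> (- u)) 0"
      using has_vector_derivative_zero_constant[of UNIV "\<lambda>u. \<Phi> u + \<Phi> (- u)"] by (metis UNIV_I convex_UNIV)
    then have "\<Phi> u + \<Phi> (- u) = 0" by (simp add: \<Phi>_def)
    then show ?thesis by (simp add: add_eq_0_iff)
  qed
  have bot: "(\<Phi> \<longlongrightarrow> - \<kappa>) at_bot"
    unfolding at_bot_mirror filterlim_filtermap using tendsto_minus[OF top] by (simp add: odd)
  have "\<forall>\<^sub>F u in at_top. norm (\<Phi> u) < norm \<kappa> + 1"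
    by (rule order_tendstoD(2)[OF tendsto_norm[OF top]]) simp
  then obtain N where N: "\<And>u. u \<ge> N \<Longrightarrow> norm (\<Phi> u) < norm \<kappa> + 1"
    unfolding eventually_at_top_linorder by auto
  have "continuous_on {0..max 0 N} \<Phi>"
    using d by (intro continuous_at_imp_continuous_on ballI has_vector_derivative_continuous)
  then have "bounded (\<Phi> ` {0..max 0 N})"
    by (intro compact_imp_bounded compact_continuous_image) auto
  then obtain B where B: "\<forall>z\<in>\<Phi> ` {0..max 0 N}. norm z \<le> B"
    unfolding bounded_iff by blast
  have pos: "norm (\<Phi> u) \<le> max B (norm \<kappa> + 1)" if "u \<ge> 0" for u
  proof (cases "u \<le> max 0 N")
    case True
    then have "norm (\<Phi> u) \<le> B" using B that by auto
    then show ?thesis by (rule max.coboundedI1)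
  next
    case False
    then have "N \<le> u" using max.cobounded2[of N 0] by linarith
    then have "norm (\<Phi> u) \<le> norm \<kappa> + 1" by (rule less_imp_le[OF N])
    then show ?thesis by (rule max.coboundedI2)
  qed
  have "norm (\<Phi> u) \<le> max B (norm \<kappa> + 1)" for u
    using pos[of u] pos[of "- u"] odd[of u] by (cases "u \<ge> 0") auto
  moreover have "\<kappa> \<noteq> 0" using c by (auto simp: \<kappa>_def complex_eq_iff)
  ultimately show thesis using that d top bot by blast
qed

text \<open>The antiderivative is the analogue of the one for
  \<open>exp (- (a\<^sup>2 x\<^sup>2 + b\<^sup>2 / x\<^sup>2))\<close> in terms of the error function.\<close>

lemma subordination:
  obtains \<kappa> :: complex and B :: real where "\<kappa> \<noteq> 0"
    "\<And>w t a b. \<lbrakk>w > 0; t > 0; 0 < a; a \<le> b\<rbrakk> \<Longrightarrow>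
       norm (integral {a..b} (\<lambda>x. cis (- (w\<^sup>2 * x\<^sup>2 + t\<^sup>2 / (4 * x\<^sup>2))))) \<le> B / w"
    "\<And>w t. \<lbrakk>w > 0; t > 0\<rbrakk> \<Longrightarrow>
       ((\<lambda>n. integral {1/n..n} (\<lambda>x. cis (- (w\<^sup>2 * x\<^sup>2 + t\<^sup>2 / (4 * x\<^sup>2))))) \<longlongrightarrow> \<kappa> * cis (- (w * t)) / of_real w) at_top"
proof -
  obtain \<Phi> :: "real \<Rightarrow> complex" and \<kappa> B where \<Phi>:
    "\<And>u. (\<Phi> has_vector_derivative cis (- (u\<^sup>2))) (at u)"
    "(\<Phi> \<longlongrightarrow> \<kappa>) at_top" "(\<Phi> \<longlongrightarrow> - \<kappa>) at_bot" "\<kappa> \<noteq> 0" "\<And>u. norm (\<Phi> u) \<le> B"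
    using fresnel_primitive by blast
  \<comment> \<open>The squares of the two arguments are the exponent shifted by minus and plus
    \<open>w * t\<close>; the factor \<open>cis (2 * w * t)\<close> aligns the phases, and the inner
    derivatives then add up to the constant \<open>2 * w\<close>.\<close>
  define V where "V = (\<lambda>w t x. \<Phi> (w * x - t / (2 * x)) + cis (2 * w * t) * \<Phi> (w * x + t / (2 * x)))"
  have formula: "integral {a..b} (\<lambda>x. cis (- (w\<^sup>2 * x\<^sup>2 + t\<^sup>2 / (4 * x\<^sup>2)))) =
      cis (- (w * t)) / of_real (2 * w) * (V w t b - V w t a)"
    if "w > 0" "t > 0" "0 < a" "a \<le> b" for w t a b
  proof -
    have "((\<lambda>x. cis (- (w\<^sup>2 * x\<^sup>2 + t\<^sup>2 / (4 * x\<^sup>2)))) has_integral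
       cis (- (w * t)) / of_real (2 * w) * V w t b - cis (- (w * t)) / of_real (2 * w) * V w t a) {a..b}"
    proof (rule fundamental_theorem_of_calculus[OF that(4)])
      fix x assume "x \<in> {a..b}"
      then have x: "x > 0" using that by auto
      define E where "E = w\<^sup>2 * x\<^sup>2 + t\<^sup>2 / (4 * x\<^sup>2)"
      have d1: "((\<lambda>x. w * x - t / (2 * x)) has_vector_derivative w + t / (2 * x\<^sup>2)) (at x)"
        unfolding has_real_derivative_iff_has_vector_derivative[symmetric]
        using x by (auto intro!: derivative_eq_intros simp: power2_eq_square)
      have d2: "((\<lambda>x. w * x + t / (2 * x)) has_vector_derivative w - t / (2 * x\<^sup>2)) (at x)"
        unfolding has_real_derivative_iff_has_vector_derivative[symmetric]
        using x by (auto intro!: derivative_eq_intros simp: power2_eq_square)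
      have u: "(w * x - t / (2 * x))\<^sup>2 = E - w * t" "(w * x + t / (2 * x))\<^sup>2 = E + w * t"
        using x by (auto simp: E_def power2_eq_square field_simps)
      have "((\<lambda>x. \<Phi> (w * x - t / (2 * x))) has_vector_derivative (w + t / (2 * x\<^sup>2)) *\<^sub>R cis (- (E - w * t))) (at x)"
           "((\<lambda>x. \<Phi> (w * x + t / (2 * x))) has_vector_derivative (w - t / (2 * x\<^sup>2)) *\<^sub>R cis (- (E + w * t))) (at x)"
        using vector_diff_chain_at[OF d1 \<Phi>(1)] vector_diff_chain_at[OF d2 \<Phi>(1)] unfolding o_def u by auto
      then have "((\<lambda>x. cis (- (w * t)) / of_real (2 * w) * V w t x) has_vector_derivative
         cis (- (w * t)) / of_real (2 * w) * ((w + t / (2 * x\<^sup>2)) *\<^sub>R cis (- (E - w * t)) +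
           cis (2 * w * t) * ((w - t / (2 * x\<^sup>2)) *\<^sub>R cis (- (E + w * t))))) (at x)"
        unfolding V_def by (intro has_vector_derivative_mult_right has_vector_derivative_add)
      also have "(w + t / (2 * x\<^sup>2)) *\<^sub>R cis (- (E - w * t)) +
           cis (2 * w * t) * ((w - t / (2 * x\<^sup>2)) *\<^sub>R cis (- (E + w * t))) = of_real (2 * w) * cis (- (E - w * t))"
      proof -
        have "cis (2 * w * t) * cis (- (E + w * t)) = cis (- (E - w * t))"
          by (simp add: cis_mult algebra_simps)
        then have "cis (2 * w * t) * ((w - t / (2 * x\<^sup>2)) *\<^sub>R cis (- (E + w * t))) =
            (w - t / (2 * x\<^sup>2)) *\<^sub>R cis (- (E - w * t))" by (simp only: mult_scaleR_right)
        then have "(w + t / (2 * x\<^sup>2)) *\<^sub>R cis (- (E - w * t)) +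
           cis (2 * w * t) * ((w - t / (2 * x\<^sup>2)) *\<^sub>R cis (- (E + w * t))) =
           ((w + t / (2 * x\<^sup>2)) + (w - t / (2 * x\<^sup>2))) *\<^sub>R cis (- (E - w * t))"
          by (simp only: scaleR_add_left)
        also have "(w + t / (2 * x\<^sup>2)) + (w - t / (2 * x\<^sup>2)) = 2 * w" by simp
        finally show ?thesis by (simp add: scaleR_conv_of_real)
      qed
      also have "cis (- (w * t)) / of_real (2 * w) * (of_real (2 * w) * cis (- (E - w * t))) = cis (- E)"
        using that by (simp add: cis_mult)
      finally show "((\<lambda>x. cis (- (w * t)) / of_real (2 * w) * V w t x) has_vector_derivative
         cis (- (w\<^sup>2 * x\<^sup>2 + t\<^sup>2 / (4 * x\<^sup>2)))) (at x within {a..b})"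
        unfolding E_def by (rule has_vector_derivative_at_within)
    qed
    then show ?thesis by (simp add: integral_unique right_diff_distrib)
  qed
  \<comment> \<open>This bound is uniform in the endpoints. It provides the majorant
    \<open>B / w\<close> for the later exchange of limit and torus integral.\<close>
  have V_bound: "norm (V w t x) \<le> 2 * B" for w t x
  proof -
    have "norm (V w t x) \<le> norm (\<Phi> (w * x - t / (2 * x))) + norm (\<Phi> (w * x + t / (2 * x)))"
      unfolding V_def by (rule order_trans[OF norm_triangle_ineq]) (simp add: norm_mult)
    then show ?thesis using \<Phi>(5)[of "w * x - t / (2 * x)"] \<Phi>(5)[of "w * x + t / (2 * x)"] by simp
  qed
  show thesis
  proof (rule that[of \<kappa> "2 * B"])
    show "\<kappa> \<noteq> 0" by (rule \<Phi>(4))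
  next
    fix w t a b :: real assume *: "w > 0" "t > 0" "0 < a" "a \<le> b"
    have "norm (V w t b - V w t a) \<le> 4 * B"
      using norm_triangle_ineq4[of "V w t b" "V w t a"] V_bound[of w t a] V_bound[of w t b] by simp
    then show "norm (integral {a..b} (\<lambda>x. cis (- (w\<^sup>2 * x\<^sup>2 + t\<^sup>2 / (4 * x\<^sup>2))))) \<le> 2 * B / w"
      unfolding formula[OF *] norm_mult norm_divide norm_cis norm_of_real
      using *(1) divide_right_mono[of _ "4 * B" "2 * w"] by simp
  next
    fix w t :: real assume *: "w > 0" "t > 0"
    \<comment> \<open>Only the first argument changes sign between 0 and infinity, so its term
      contributes \<open>2 * \<kappa>\<close> while the contributions of the second cancel.\<close>
    have "filterlim (\<lambda>n. w * n - t / (2 * n)) at_top at_top" "filterlim (\<lambda>n. w * n + t / (2 * n)) at_top at_top"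
      "filterlim (\<lambda>n. w * (1 / n) - t / (2 * (1 / n))) at_bot at_top" "filterlim (\<lambda>n. w * (1 / n) + t / (2 * (1 / n))) at_top at_top"
      using * by real_asymp+
    note lims = filterlim_compose[OF \<Phi>(2) this(1)] filterlim_compose[OF \<Phi>(2) this(2)]
      filterlim_compose[OF \<Phi>(3) this(3)] filterlim_compose[OF \<Phi>(2) this(4)]
    have L: "((\<lambda>n. cis (- (w * t)) / of_real (2 * w) * (V w t n - V w t (1 / n))) \<longlongrightarrow>
       cis (- (w * t)) / of_real (2 * w) * ((\<kappa> + cis (2 * w * t) * \<kappa>) - (- \<kappa> + cis (2 * w * t) * \<kappa>))) at_top"
      unfolding V_def by (intro tendsto_intros lims)
    have e: "cis (- (w * t)) / of_real (2 * w) * ((\<kappa> + cis (2 * w * t) * \<kappa>) - (- \<kappa> + cis (2 * w * t) * \<kappa>)) =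
        \<kappa> * cis (- (w * t)) / of_real w" using * by simp
    have ev: "\<forall>\<^sub>F n in at_top. cis (- (w * t)) / of_real (2 * w) * (V w t n - V w t (1 / n)) =
       integral {1/n..n} (\<lambda>x. cis (- (w\<^sup>2 * x\<^sup>2 + t\<^sup>2 / (4 * x\<^sup>2))))"
      using eventually_ge_at_top[of 1]
    proof eventually_elim
      case (elim n)
      have "1 / n \<le> 1" using elim by simp
      then have "1 / n \<le> n" using elim by linarith
      then show ?case using formula[OF *, of "1 / n" n] elim by simp
    qed
    show "((\<lambda>n. integral {1/n..n} (\<lambda>x. cis (- (w\<^sup>2 * x\<^sup>2 + t\<^sup>2 / (4 * x\<^sup>2))))) \<longlongrightarrow> \<kappa> * cis (- (w * t)) / of_real w) at_top"
      by (rule Lim_transform_eventually[OF L[unfolded e] ev])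
  qed
qed

section \<open>Reduction of the torus integral\<close>

text \<open>Lebesgue measure on the vector type is the image of the product measure indexed by
  \<open>Basis\<close>; coordinates correspond to basis vectors through
  \<open>axis j 1\<close>.\<close>

lemma lborel_integral_prod_component:
  fixes f :: "real \<Rightarrow> 'b::{real_normed_field,banach,second_countable_topology}"
  assumes f: "integrable lborel f"
  shows "integrable lborel (\<lambda>x::real^'n. \<Prod>j\<in>UNIV. f (x $ j))"
    and "(LINT x|lborel. (\<Prod>j\<in>UNIV. f ((x::real^'n) $ j))) = (LINT x|lborel. f x) ^ CARD('n)"
proof -
  interpret product_sigma_finite "\<lambda>_::real^'n. lborel :: real measure" ..
  define T where "T = (\<lambda>g::(real^'n) \<Rightarrow> real. \<Sum>b\<in>Basis. g b *\<^sub>R b)"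
  define P where "P = (\<lambda>x::real^'n. \<Prod>j\<in>UNIV. f (x $ j))"
  have T: "T \<in> measurable (\<Pi>\<^sub>M b\<in>Basis. lborel) borel"
    unfolding T_def by measurable
  have [measurable]: "f \<in> borel_measurable borel" using borel_measurable_integrable[OF f] by simp
  have "(\<lambda>x::real^'n. x $ j) \<in> borel_measurable borel" for j
    by (intro borel_measurable_continuous_onI continuous_intros)
  then have P: "P \<in> borel_measurable borel" unfolding P_def by measurable
  have card: "card (Basis :: (real^'n) set) = CARD('n)" by simp
  have bij: "bij_betw (\<lambda>j. axis j 1) UNIV (Basis :: (real^'n) set)"
    by (auto simp: bij_betw_def inj_on_def Basis_vec_def axis_eq_axis)
  have PT: "P (T g) = (\<Prod>b\<in>Basis. f (g b))" for g
  proof -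
    have "T g $ j = g (axis j 1)" for j
    proof -
      have "T g $ j = T g \<bullet> axis j 1" by (simp add: inner_axis)
      also have "\<dots> = g (axis j 1)"
        unfolding T_def by (rule inner_sum_left_Basis) (auto simp: Basis_vec_def)
      finally show ?thesis .
    qed
    then show ?thesis unfolding P_def using prod.reindex_bij_betw[OF bij, of "\<lambda>b. f (g b)"] by simp
  qed
  have eq: "(lborel :: (real^'n) measure) = distr (\<Pi>\<^sub>M b\<in>Basis. lborel) borel T"
    unfolding T_def by (rule lborel_eq)
  have "integrable (\<Pi>\<^sub>M b\<in>Basis. lborel) (\<lambda>g. P (T g))"
    unfolding PT by (rule product_integrable_prod) (use f in auto)
  then show "integrable lborel (\<lambda>x::real^'n. \<Prod>j\<in>UNIV. f (x $ j))"
    unfolding P_def[symmetric] by (subst eq) (simp add: integrable_distr_eq[OF T P])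
  have "(LINT x|lborel. P x) = (LINT g|(\<Pi>\<^sub>M b\<in>Basis. lborel). P (T g))"
    by (subst eq) (rule integral_distr[OF T P])
  also have "\<dots> = (\<Prod>b\<in>(Basis :: (real^'n) set). LINT x|lborel. f x)"
    unfolding PT by (rule product_integral_prod) (use f in auto)
  also have "\<dots> = (LINT x|lborel. f x) ^ CARD('n)" by (simp add: card)
  finally show "(LINT x|lborel. (\<Prod>j\<in>UNIV. f ((x::real^'n) $ j))) = (LINT x|lborel. f x) ^ CARD('n)"
    by (simp add: P_def)
qed

section \<open>The torus and the dispersion relation near its zero\<close>

lemma continuous_on_omega: "continuous_on A (omega :: real^'n \<Rightarrow> real)"
  unfolding omega_def[abs_def] by (intro continuous_intros)

lemma omega_measurable [measurable]: "(omega :: real^'n \<Rightarrow> real) \<in> borel_measurable borel"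
  by (rule borel_measurable_continuous_onI[OF continuous_on_omega])

lemma omega_nonneg: "omega \<xi> \<ge> 0"
  unfolding omega_def by (intro real_sqrt_ge_zero sum_nonneg) (simp add: cos_le_one)

lemma omega_square: "(omega \<xi>)\<^sup>2 = (\<Sum>j\<in>UNIV. 2 - 2 * cos (\<xi> $ j))"
  unfolding omega_def by (intro real_sqrt_pow2 sum_nonneg) (simp add: cos_le_one)

lemma torus_eq_cbox: "(torus :: (real^'n) set) = cbox (\<chi> j. - pi) (\<chi> j. pi)"
  by (auto simp: torus_def mem_box_cart)

lemma torus_measurable [measurable]: "(torus :: (real^'n) set) \<in> sets borel"
  by (simp add: torus_eq_cbox)

text \<open>A linear lower bound for \<open>omega\<close>, from
  \<open>2 - 2 * cos x = 4 * (sin (x / 2))\<^sup>2\<close>. The angle is halved once more because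
  \<open>sin_ge_half\<close> reaches only up to 1.\<close>

lemma abs_component_le_omega:
  assumes "\<xi> \<in> torus"
  shows "\<bar>\<xi> $ j\<bar> \<le> 8 * omega \<xi>"
proof (rule power2_le_imp_le)
  define x where "x = \<xi> $ j"
  have x: "\<bar>x\<bar> \<le> pi" using assms by (auto simp: torus_def x_def abs_le_iff minus_le_iff)
  have "\<bar>x\<bar> / 4 \<le> 1" using x pi_less_4 by simp
  then have "\<bar>x\<bar> / 4 / 2 \<le> sin (\<bar>x\<bar> / 4)" by (intro sin_ge_half) auto
  have s: "\<bar>x\<bar> / 8 \<le> \<bar>sin (x / 2)\<bar>"
  proof -
    have "cos (pi / 3) \<le> cos (\<bar>x\<bar> / 4)" using x pi_gt_zero by (intro cos_monotone_0_pi_le) auto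
    then have "1 / 2 \<le> cos (\<bar>x\<bar> / 4)" by (simp add: cos_60)
    moreover have "sin (\<bar>x\<bar> / 2) = 2 * sin (\<bar>x\<bar> / 4) * cos (\<bar>x\<bar> / 4)"
      using sin_double[of "\<bar>x\<bar> / 4"] by simp
    moreover have "(\<bar>x\<bar> / 8) * (1 / 2) \<le> sin (\<bar>x\<bar> / 4) * cos (\<bar>x\<bar> / 4)"
      using \<open>\<bar>x\<bar> / 4 / 2 \<le> sin (\<bar>x\<bar> / 4)\<close> calculation(1) by (intro mult_mono) auto
    ultimately have "\<bar>x\<bar> / 8 \<le> sin (\<bar>x\<bar> / 2)" by simp
    also have "\<dots> \<le> \<bar>sin (x / 2)\<bar>" by (auto simp: abs_if)
    finally show ?thesis .
  qed
  have "(\<bar>x\<bar> / 8)\<^sup>2 \<le> \<bar>sin (x / 2)\<bar>\<^sup>2" using s by (intro power_mono) auto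
  then have "x\<^sup>2 \<le> 64 * (sin (x / 2))\<^sup>2" by (simp add: power_divide)
  also have "\<dots> \<le> 64 * (2 - 2 * cos x)" using cos_double_sin[of "x / 2"] by simp
  also have "2 - 2 * cos x \<le> (omega \<xi>)\<^sup>2"
    unfolding omega_square x_def by (rule member_le_sum[of j]) (auto simp: cos_le_one)
  finally have "x\<^sup>2 \<le> 64 * (omega \<xi>)\<^sup>2" by simp
  then show "\<bar>\<xi> $ j\<bar>\<^sup>2 \<le> (8 * omega \<xi>)\<^sup>2" by (simp add: x_def power_mult_distrib)
qed (use omega_nonneg[of \<xi>] in simp)

lemma AE_component_nonzero: "AE \<xi> in lborel. \<forall>j. (\<xi> :: real^'n) $ j \<noteq> 0"
proof (rule AE_finite_allI[OF finite_class.finite_UNIV, simplified])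
  fix j :: 'n
  have "negligible {\<xi> :: real^'n. \<xi> $ j = 0}"
    by (rule negligible_standard_hyperplane_cart)
  then have "{\<xi> :: real^'n. \<xi> $ j = 0} \<in> null_sets lebesgue" by (simp add: negligible_iff_null_sets)
  moreover have "{\<xi> :: real^'n. \<xi> $ j = 0} \<in> sets borel"
    by (intro borel_closed closed_Collect_eq continuous_intros)
  ultimately have "{\<xi> :: real^'n. \<xi> $ j = 0} \<in> null_sets lborel"
    by (simp add: null_sets_def)
  then show "AE \<xi> in lborel. (\<xi> :: real^'n) $ j \<noteq> 0"
    by (rule AE_not_in[THEN AE_mp]) auto
qed

text \<open>Splitting \<open>1 / (8 * omega \<xi>)\<close> into five equal powers and bounding each
  by one coordinate to the power -1/5 gives a product majorant, integrable coordinate by coordinate;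
  polar coordinates are avoided.\<close>

lemma integrable_inverse_omega:
  "set_integrable lborel (torus :: (real^5) set) (\<lambda>\<xi>. 1 / omega \<xi>)"
proof -
  define g where "g = (\<lambda>x::real. indicator {-pi..pi} x * \<bar>x\<bar> powr (- (1 / 5)))"
  have 1: "integrable lborel (\<lambda>x::real. indicator {0..pi} x *\<^sub>R x powr (- (1 / 5)))"
    using integrable_lborel_nonneg_has_integral[OF has_integral_powr_from_0[of "- (1 / 5)" pi]]
    unfolding set_integrable_def by simp
  have 2: "integrable lborel (\<lambda>x::real. indicator {0..pi} (- x) *\<^sub>R (- x) powr (- (1 / 5)))"
    using lborel_integrable_real_affine[OF 1, of "-1" 0] by simp
  have g: "integrable lborel g"
  proof (rule Bochner_Integration.integrable_bound[OF Bochner_Integration.integrable_add[OF 1 2]])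
    show "AE x in lborel. norm (g x) \<le> norm (indicator {0..pi} x *\<^sub>R x powr (- (1 / 5)) + indicator {0..pi} (- x) *\<^sub>R (- x) powr (- (1 / 5)))"
      by (intro AE_I2) (auto simp: g_def indicator_def abs_if)
  qed (unfold g_def, measurable)
  show ?thesis unfolding set_integrable_def
  proof (rule Bochner_Integration.integrable_bound)
    show "integrable lborel (\<lambda>\<xi>::real^5. 8 * (\<Prod>j\<in>UNIV. g (\<xi> $ j)))"
      by (intro integrable_mult_right lborel_integral_prod_component(1) g)
    \<comment> \<open>On the hyperplanes where a coordinate vanishes \<open>powr\<close> takes the
      value 0 and the majorant collapses, so these null sets are removed.\<close>
    show "AE \<xi> in lborel. norm (indicator torus \<xi> *\<^sub>R (1 / omega \<xi>)) \<le> norm (8 * (\<Prod>j\<in>UNIV. g ((\<xi>::real^5) $ j)))"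
      using AE_component_nonzero
    proof eventually_elim
      case (elim \<xi>)
      show ?case
      proof (cases "\<xi> \<in> torus")
        case True
        have w: "omega \<xi> > 0"
          using abs_component_le_omega[OF True, of 0] elim[rule_format, of 0] by (smt (verit) zero_less_abs_iff)
        have "(8 * omega \<xi>) powr (- (1 / 5)) \<le> g (\<xi> $ j)" for j
        proof -
          have "(8 * omega \<xi>) powr (- (1 / 5)) \<le> \<bar>\<xi> $ j\<bar> powr (- (1 / 5))"
            using abs_component_le_omega[OF True, of j] elim by (intro powr_mono2') auto
          then show ?thesis using True by (simp add: g_def torus_def)
        qed
        then have "(\<Prod>j\<in>(UNIV :: 5 set). (8 * omega \<xi>) powr (- (1 / 5))) \<le> (\<Prod>j\<in>UNIV. g (\<xi> $ j))"
          by (intro prod_mono) auto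
        also have "(\<Prod>j\<in>(UNIV :: 5 set). (8 * omega \<xi>) powr (- (1 / 5))) = 1 / (8 * omega \<xi>)"
        proof -
          have "((8 * omega \<xi>) powr (- (1 / 5))) ^ 5 = (8 * omega \<xi>) powr (- 1)"
            by (subst powr_power) (use w in auto)
          then show ?thesis using w by (simp add: powr_minus_divide)
        qed
        finally have "1 / omega \<xi> \<le> 8 * (\<Prod>j\<in>UNIV. g (\<xi> $ j))" by (simp add: field_simps)
        then show ?thesis using True w by simp
      qed simp
    qed
    show "(\<lambda>\<xi>::real^5. indicator torus \<xi> *\<^sub>R (1 / omega \<xi>)) \<in> borel_measurable lborel" by measurable
  qed
qed

text \<open>The factor 10 is the constant term of \<open>(omega \<xi>)\<^sup>2\<close> as well as
  the ratio of \<open>t\<^sup>2\<close> to \<open>\<tau>\<^sup>2\<close>, which is why a single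
  expression collects both.\<close>

definition line_integrand :: "real \<Rightarrow> real \<Rightarrow> complex" where
  "line_integrand \<tau> x = cis (- (10 * (x\<^sup>2 + \<tau>\<^sup>2 / (4 * x\<^sup>2)))) * anger \<tau> (2 * x\<^sup>2) ^ 5"

lemma line_integrand_measurable [measurable]: "line_integrand \<tau> \<in> borel_measurable borel"
  unfolding line_integrand_def[abs_def] cis_conv_exp by measurable

lemma cis_sum: "finite A \<Longrightarrow> cis (\<Sum>j\<in>A. f j) = (\<Prod>j\<in>A. cis (f j))"
  by (induction A rule: finite_induct) (auto simp: cis_mult[symmetric])

lemma v5_inner: "v5 \<bullet> \<xi> = (\<Sum>j\<in>UNIV. \<xi> $ j) / sqrt 10"
  by (simp add: v5_def inner_vec_def sum_divide_distrib)

text \<open>For fixed \<open>x\<close> the exponent is a sum over coordinates, since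
  \<open>(omega \<xi>)\<^sup>2\<close> is one and \<open>v5\<close> has equal components; the
  integral is then a fifth power. At \<open>x = 0\<close> both sides give the quotient the value
  0.\<close>

lemma torus_slice:
  "(LINT \<xi>:torus|lborel. cis (t * (v5 \<bullet> \<xi>)) * cis (- ((omega \<xi>)\<^sup>2 * x\<^sup>2 + t\<^sup>2 / (4 * x\<^sup>2))))
     = line_integrand (t / sqrt 10) x"
proof -
  define \<tau> where "\<tau> = t / sqrt 10"
  have t: "t = sqrt 10 * \<tau>" "t\<^sup>2 = 10 * \<tau>\<^sup>2" by (simp_all add: \<tau>_def power_divide)
  define f where "f = (\<lambda>y. indicator {-pi..pi} y *\<^sub>R cis (\<tau> * y + 2 * x\<^sup>2 * cos y))"
  have cont: "continuous_on {-pi..pi} (\<lambda>y. cis (\<tau> * y + 2 * x\<^sup>2 * cos y))" by (intro continuous_intros)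
  have f: "integrable lborel f"
    using borel_integrable_atLeastAtMost'[OF cont] unfolding f_def set_integrable_def .
  have If: "(LINT y|lborel. f y) = anger \<tau> (2 * x\<^sup>2)"
    using set_borel_integral_eq_integral(2)[OF borel_integrable_atLeastAtMost'[OF cont]]
    unfolding f_def set_lebesgue_integral_def anger_def .
  have eq: "indicator torus \<xi> *\<^sub>R (cis (t * (v5 \<bullet> \<xi>)) * cis (- ((omega \<xi>)\<^sup>2 * x\<^sup>2 + t\<^sup>2 / (4 * x\<^sup>2))))
     = cis (- (10 * (x\<^sup>2 + \<tau>\<^sup>2 / (4 * x\<^sup>2)))) * (\<Prod>j\<in>UNIV. f (\<xi> $ j))" for \<xi> :: "real^5"
  proof (cases "\<xi> \<in> torus")
    case True
    then have "f (\<xi> $ j) = cis (\<tau> * \<xi> $ j + 2 * x\<^sup>2 * cos (\<xi> $ j))" for j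
      by (simp add: f_def torus_def)
    then have "(\<Prod>j\<in>UNIV. f (\<xi> $ j)) = cis (\<tau> * (\<Sum>j\<in>UNIV. \<xi> $ j) + 2 * x\<^sup>2 * (\<Sum>j\<in>UNIV. cos (\<xi> $ j)))"
      by (simp add: cis_sum[symmetric] sum.distrib sum_distrib_left)
    moreover have "(omega \<xi>)\<^sup>2 = 10 - 2 * (\<Sum>j\<in>UNIV. cos (\<xi> $ j))"
      by (simp add: omega_square sum_subtractf sum_distrib_left)
    moreover have "t * (v5 \<bullet> \<xi>) = \<tau> * (\<Sum>j\<in>UNIV. \<xi> $ j)" by (simp add: v5_inner \<tau>_def)
    moreover have "a + - ((10 - 2 * c) * x\<^sup>2 + 10 * \<tau>\<^sup>2 / (4 * x\<^sup>2)) =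
        - (10 * (x\<^sup>2 + \<tau>\<^sup>2 / (4 * x\<^sup>2))) + (a + 2 * x\<^sup>2 * c)" for a c :: real
      by (simp add: algebra_simps)
    ultimately show ?thesis using True by (simp only: t(2) cis_mult indicator_simps scaleR_one)
  next
    case False
    then obtain j where "\<not> (- pi \<le> \<xi> $ j \<and> \<xi> $ j \<le> pi)" by (auto simp: torus_def)
    then have "f (\<xi> $ j) = 0" by (auto simp: f_def)
    then have "(\<Prod>j\<in>UNIV. f (\<xi> $ j)) = 0" by (intro prod_zero) auto
    then show ?thesis using False by simp
  qed
  have "(LINT \<xi>:torus|lborel. cis (t * (v5 \<bullet> \<xi>)) * cis (- ((omega \<xi>)\<^sup>2 * x\<^sup>2 + t\<^sup>2 / (4 * x\<^sup>2))))
     = cis (- (10 * (x\<^sup>2 + \<tau>\<^sup>2 / (4 * x\<^sup>2)))) * (LINT \<xi>|lborel. (\<Prod>j\<in>UNIV. f ((\<xi> :: real^5) $ j)))"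
    unfolding set_lebesgue_integral_def eq by (rule integral_mult_right_zero)
  also have "\<dots> = line_integrand \<tau> x"
    unfolding lborel_integral_prod_component(2)[OF f] If line_integrand_def by simp
  finally show ?thesis by (simp add: \<tau>_def)
qed

text \<open>The integrand has modulus 1, so absolute integrability, and with it Fubini, holds only
  for a bounded range of \<open>x\<close>.\<close>

lemma torus_fubini:
  assumes ab: "0 < a" "a \<le> b"
  shows "(LINT \<xi>:torus|lborel. cis (t * (v5 \<bullet> \<xi>)) * integral {a..b} (\<lambda>x. cis (- ((omega \<xi>)\<^sup>2 * x\<^sup>2 + t\<^sup>2 / (4 * x\<^sup>2)))))
     = (LINT x:{a..b}|lborel. line_integrand (t / sqrt 10) x)"
proof -
  define k where "k = (\<lambda>(\<xi>::real^5) x. cis (t * (v5 \<bullet> \<xi>)) * cis (- ((omega \<xi>)\<^sup>2 * x\<^sup>2 + t\<^sup>2 / (4 * x\<^sup>2))))"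
  define h where "h = (\<lambda>(\<xi>::real^5) x. (indicator torus \<xi> * indicator {a..b} x) *\<^sub>R k \<xi> x)"
  have nk: "norm (k \<xi> x) = 1" for \<xi> x by (simp add: k_def norm_mult)
  have int: "integrable (lborel \<Otimes>\<^sub>M lborel) (case_prod h)"
  proof (rule Bochner_Integration.integrable_bound)
    have "bounded ((torus :: (real^5) set) \<times> {a..b})"
      by (intro bounded_Times) (auto simp: torus_eq_cbox)
    moreover have "(torus :: (real^5) set) \<times> {a..b} \<in> sets borel"
      by (intro borel_closed closed_Times) (auto simp: torus_eq_cbox)
    ultimately have "integrable lborel (indicator ((torus :: (real^5) set) \<times> {a..b}) :: _ \<Rightarrow> real)"
      using emeasure_bounded_finite by (intro integrable_real_indicator) auto
    then show "integrable (lborel \<Otimes>\<^sub>M lborel) (indicator ((torus :: (real^5) set) \<times> {a..b}) :: _ \<Rightarrow> real)"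
      by (simp add: lborel_prod)
    show "case_prod h \<in> borel_measurable (lborel \<Otimes>\<^sub>M lborel)"
      unfolding h_def k_def cis_conv_exp by measurable
    show "AE z in lborel \<Otimes>\<^sub>M lborel. norm (case_prod h z) \<le> norm (indicator ((torus :: (real^5) set) \<times> {a..b}) z :: real)"
      by (intro AE_I2) (auto simp: h_def nk indicator_def)
  qed
  have "(LINT \<xi>|lborel. LINT x|lborel. h \<xi> x) = (LINT x|lborel. LINT \<xi>|lborel. h \<xi> x)"
    using lborel_pair.Fubini_integral[OF int] by simp
  moreover have "(LINT x|lborel. h \<xi> x) = indicator torus \<xi> *\<^sub>R (cis (t * (v5 \<bullet> \<xi>)) *
      integral {a..b} (\<lambda>x. cis (- ((omega \<xi>)\<^sup>2 * x\<^sup>2 + t\<^sup>2 / (4 * x\<^sup>2)))))" for \<xi>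
  proof -
    have "continuous_on {a..b} (\<lambda>x. cis (- ((omega \<xi>)\<^sup>2 * x\<^sup>2 + t\<^sup>2 / (4 * x\<^sup>2))))"
      using ab by (intro continuous_intros) auto
    from set_borel_integral_eq_integral(2)[OF borel_integrable_atLeastAtMost'[OF this]]
    have "(LINT x|lborel. indicator {a..b} x *\<^sub>R cis (- ((omega \<xi>)\<^sup>2 * x\<^sup>2 + t\<^sup>2 / (4 * x\<^sup>2)))) =
      integral {a..b} (\<lambda>x. cis (- ((omega \<xi>)\<^sup>2 * x\<^sup>2 + t\<^sup>2 / (4 * x\<^sup>2))))"
      unfolding set_lebesgue_integral_def .
    moreover have "h \<xi> x = (indicator torus \<xi> *\<^sub>R cis (t * (v5 \<bullet> \<xi>))) *
        (indicator {a..b} x *\<^sub>R cis (- ((omega \<xi>)\<^sup>2 * x\<^sup>2 + t\<^sup>2 / (4 * x\<^sup>2))))" for x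
      by (simp add: h_def k_def scaleR_conv_of_real mult_ac)
    ultimately show ?thesis by (simp only: integral_mult_right_zero integral_scaleR_right mult_scaleR_left)
  qed
  moreover have "(LINT \<xi>|lborel. h \<xi> x) = indicator {a..b} x *\<^sub>R line_integrand (t / sqrt 10) x" for x
  proof -
    have "h \<xi> x = indicator {a..b} x *\<^sub>R (indicator torus \<xi> *\<^sub>R k \<xi> x)" for \<xi> by (simp add: h_def)
    then show ?thesis
      using torus_slice[of t x] unfolding set_lebesgue_integral_def k_def
      by (simp only: integral_scaleR_right)
  qed
  ultimately show ?thesis unfolding set_lebesgue_integral_def by simp
qed

text \<open>\<open>X\<close> is the stationary point of the outer phase. Completing the square about
  it with \<open>x = X * r\<close> gives \<open>5 * l ^ 3 * (r - 1 / r)\<^sup>2\<close> plus a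
  constant, and \<open>2 * x\<^sup>2\<close> becomes \<open>l ^ 3 * r\<^sup>2\<close>.\<close>

lemma line_integrand_scaled:
  fixes l s :: real
  assumes l: "l \<ge> 1"
  defines "X \<equiv> sqrt (l ^ 3 / 2)"
  shows "indicator {0<..} (X + X / l\<^sup>2 * s) *\<^sub>R line_integrand (l ^ 3) (X + X / l\<^sup>2 * s) =
    (cis (- (10 * l ^ 3)) * cis (5 * (l ^ 3 * (pi / 2))) / of_real (l ^ 5)) * scaled_integrand l s"
proof -
  define r where "r = 1 + s / l\<^sup>2"
  have X: "X > 0" "X\<^sup>2 = l ^ 3 / 2" using l by (auto simp: X_def)
  have x: "X + X / l\<^sup>2 * s = X * r" using l by (simp add: r_def field_simps)
  show ?thesis
  proof (cases "r > 0")
    case True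
    have "10 * ((X * r)\<^sup>2 + (l ^ 3)\<^sup>2 / (4 * (X * r)\<^sup>2)) = 5 * l ^ 3 * (r - 1 / r)\<^sup>2 + 10 * l ^ 3"
    proof -
      have e1: "l ^ 3 * (r - 1 / r)\<^sup>2 = l ^ 3 * r\<^sup>2 + l ^ 3 / r\<^sup>2 - 2 * l ^ 3"
        using True by (simp add: power2_diff power_divide algebra_simps)
      have e2: "(X * r)\<^sup>2 = l ^ 3 * r\<^sup>2 / 2" by (simp add: power_mult_distrib X)
      have e3: "(l ^ 3)\<^sup>2 / (4 * (l ^ 3 * r\<^sup>2 / 2)) = l ^ 3 / r\<^sup>2 / 2"
      proof -
        have *: "L\<^sup>2 / (4 * (L * R / 2)) = L / R / 2" if "L \<noteq> 0" for L R :: real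
          using that by (simp add: power2_eq_square)
        show ?thesis by (rule *) (use l in simp)
      qed
      have "5 * l ^ 3 * (r - 1 / r)\<^sup>2 = 5 * (l ^ 3 * (r - 1 / r)\<^sup>2)" by simp
      then show ?thesis unfolding e1 e2 e3 by simp
    qed
    moreover have "2 * (X * r)\<^sup>2 = l ^ 3 * r\<^sup>2" by (simp add: power_mult_distrib X)
    ultimately have A: "line_integrand (l ^ 3) (X * r) =
        cis (- (5 * l ^ 3 * (r - 1 / r)\<^sup>2)) * cis (- (10 * l ^ 3)) * anger (l ^ 3) (l ^ 3 * r\<^sup>2) ^ 5"
      unfolding line_integrand_def by (simp add: cis_mult)
    define \<theta> where "\<theta> = l ^ 3 * (pi / 2)"
    have B: "scaled_anger l s ^ 5 = of_real (l ^ 5) * cis (- (5 * \<theta>)) * anger (l ^ 3) (l ^ 3 * r\<^sup>2) ^ 5"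
      unfolding scaled_anger_def r_def[symmetric] \<theta>_def[symmetric]
      by (simp add: power_mult_distrib Complex.DeMoivre)
    have C: "cis (5 * \<theta>) * cis (- (5 * \<theta>)) = 1" by (simp add: cis_mult)
    have "scaled_integrand l s = cis (- (5 * l ^ 3 * (r - 1 / r)\<^sup>2)) *
        (of_real (l ^ 5) * cis (- (5 * \<theta>)) * anger (l ^ 3) (l ^ 3 * r\<^sup>2) ^ 5)"
      using True unfolding scaled_integrand_def r_def[symmetric] B by simp
    moreover have cancel: "(c10 * c5 / L) * (cr * (L * c5' * a)) = cr * c10 * a"
      if "c5 * c5' = 1" "L \<noteq> 0" for c10 c5 c5' L cr a :: complex
    proof -
      have "(c10 * c5 / L) * (cr * (L * c5' * a)) = cr * c10 * a * (c5 * c5')"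
        using that(2) by simp
      then show ?thesis using that(1) by simp
    qed
    have "(cis (- (10 * l ^ 3)) * cis (5 * \<theta>) / of_real (l ^ 5)) * (cis (- (5 * l ^ 3 * (r - 1 / r)\<^sup>2)) *
        (of_real (l ^ 5) * cis (- (5 * \<theta>)) * anger (l ^ 3) (l ^ 3 * r\<^sup>2) ^ 5)) = line_integrand (l ^ 3) (X * r)"
      unfolding A by (rule cancel[OF C]) (use l in simp)
    ultimately show ?thesis using True X unfolding x \<theta>_def by simp
  next
    case False
    then have "X * r \<le> 0" using X by (simp add: mult_le_0_iff)
    then show ?thesis using False unfolding x scaled_integrand_def r_def[symmetric] by simp
  qed
qed

text \<open>The substitution has derivative \<open>X / l\<^sup>2\<close> and the normalization of
  the five inner integrals costs \<open>l ^ 5\<close>; all other constants are phases.\<close>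

lemma line_integral_scaled:
  assumes l: "l \<ge> 1"
  shows "set_integrable lborel {0<..} (line_integrand (l ^ 3))"
    and "norm (LINT x:{0<..}|lborel. line_integrand (l ^ 3) x) =
       sqrt (l ^ 3 / 2) / l ^ 7 * norm (LINT s|lborel. scaled_integrand l s)"
proof -
  define X where "X = sqrt (l ^ 3 / 2)"
  define F where "F = (\<lambda>x. indicator {0<..} x *\<^sub>R line_integrand (l ^ 3) x)"
  define c where "c = X / l\<^sup>2"
  define K where "K = cis (- (10 * l ^ 3)) * cis (5 * (l ^ 3 * (pi / 2))) / of_real (l ^ 5)"
  have c: "c > 0" using l by (simp add: c_def X_def)
  have F: "F (X + c * s) = K * scaled_integrand l s" for s
    unfolding F_def X_def c_def K_def by (rule line_integrand_scaled[OF l])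
  have "integrable lborel (\<lambda>s. F (X + c * s))"
    unfolding F by (intro integrable_mult_right integrable_scaled_integrand l)
  then have "integrable lborel F"
    using lborel_integrable_real_affine_iff[of c F X] c by simp
  then show "set_integrable lborel {0<..} (line_integrand (l ^ 3))"
    by (simp add: set_integrable_def F_def)
  have "(LINT x|lborel. F x) = c *\<^sub>R (K * (LINT s|lborel. scaled_integrand l s))"
    using lborel_integral_real_affine[of c F X] c unfolding F by simp
  then have "norm (LINT x|lborel. F x) = c * norm K * norm (LINT s|lborel. scaled_integrand l s)"
    using c by (simp add: norm_mult)
  also have "norm K = 1 / l ^ 5" using l by (simp add: K_def norm_mult norm_divide norm_power)
  also have "c * (1 / l ^ 5) = X / l ^ 7" by (simp add: c_def flip: power_add)
  finally show "norm (LINT x:{0<..}|lborel. line_integrand (l ^ 3) x) =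
       sqrt (l ^ 3 / 2) / l ^ 7 * norm (LINT s|lborel. scaled_integrand l s)"
    unfolding set_lebesgue_integral_def F_def X_def .
qed

text \<open>Both sides are limits of the same truncated double integral: on the torus the majorant
  is \<open>B / omega\<close>, on the half-line it is the integrand itself, whose integrability is
  therefore assumed.\<close>

lemma osc_int_eq_line_integral:
  obtains \<kappa> :: complex where "\<kappa> \<noteq> 0"
    "\<And>t. \<lbrakk>t > 0; set_integrable lborel {0<..} (line_integrand (t / sqrt 10))\<rbrakk> \<Longrightarrow>
       \<kappa> * ((2 * pi) ^ 5 * osc_int v5 t) = (LINT x:{0<..}|lborel. line_integrand (t / sqrt 10) x)"
proof -
  obtain \<kappa> :: complex and B :: real where \<kappa>: "\<kappa> \<noteq> 0" and bound:
    "\<And>w t a b. \<lbrakk>w > 0; t > 0; 0 < a; a \<le> b\<rbrakk> \<Longrightarrow>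
       norm (integral {a..b} (\<lambda>x. cis (- (w\<^sup>2 * x\<^sup>2 + t\<^sup>2 / (4 * x\<^sup>2))))) \<le> B / w" and lim:
    "\<And>w t. \<lbrakk>w > 0; t > 0\<rbrakk> \<Longrightarrow>
       ((\<lambda>n. integral {1/n..n} (\<lambda>x. cis (- (w\<^sup>2 * x\<^sup>2 + t\<^sup>2 / (4 * x\<^sup>2))))) \<longlongrightarrow> \<kappa> * cis (- (w * t)) / of_real w) at_top"
    using subordination by blast
  \<comment> \<open>Starting at 1 keeps the truncation interval from \<open>1 / N m\<close> to
    \<open>N m\<close> nonempty.\<close>
  define N where "N = (\<lambda>m. real (Suc m))"
  have N: "N m \<ge> 1" "0 < 1 / N m" "1 / N m \<le> N m" for m
  proof -
    show 1: "N m \<ge> 1" by (simp add: N_def)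
    then have "1 / N m \<le> 1" by simp
    then show "1 / N m \<le> N m" using 1 by linarith
    show "0 < 1 / N m" using 1 by simp
  qed
  have N_lim: "filterlim N at_top sequentially"
    unfolding N_def by (rule filterlim_compose[OF filterlim_real_sequentially filterlim_Suc])
  show thesis
  proof (rule that[OF \<kappa>])
    fix t :: real
    assume t: "t > 0" and int: "set_integrable lborel {0<..} (line_integrand (t / sqrt 10))"
    define k where "k = (\<lambda>m w. integral {1 / N m..N m} (\<lambda>x. cis (- (w\<^sup>2 * x\<^sup>2 + t\<^sup>2 / (4 * x\<^sup>2)))))"
    have k_meas: "k m \<in> borel_measurable borel" for m
    proof (rule borel_measurable_continuous_onI)
      have "continuous_on UNIV (\<lambda>w. integral (cbox (1 / N m) (N m)) (\<lambda>x. cis (- (w\<^sup>2 * x\<^sup>2 + t\<^sup>2 / (4 * x\<^sup>2)))))"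
      proof (rule integral_continuous_on_param)
        show "continuous_on (UNIV \<times> cbox (1 / N m) (N m)) (\<lambda>(w, x). cis (- (w\<^sup>2 * x\<^sup>2 + t\<^sup>2 / (4 * x\<^sup>2))))"
          unfolding case_prod_unfold using N(2)[of m] by (intro continuous_intros) auto
      qed
      then show "continuous_on UNIV (k m)" by (simp add: k_def)
    qed
    have L1: "(\<lambda>m. LINT \<xi>|lborel. indicator torus \<xi> *\<^sub>R (cis (t * (v5 \<bullet> \<xi>)) * k m (omega \<xi>))) \<longlonglongrightarrow>
       (LINT \<xi>|lborel. indicator torus \<xi> *\<^sub>R (cis (t * (v5 \<bullet> \<xi>)) * (\<kappa> * cis (- (omega \<xi> * t)) / of_real (omega \<xi>))))"
    proof (rule integral_dominated_convergence[where w = "\<lambda>\<xi>. B * (indicator torus \<xi> *\<^sub>R (1 / omega \<xi>))"])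
      show "integrable lborel (\<lambda>\<xi>::real^5. B * (indicator torus \<xi> *\<^sub>R (1 / omega \<xi>)))"
        using integrable_inverse_omega unfolding set_integrable_def by (intro integrable_mult_right)
      show "(\<lambda>\<xi>. indicator torus \<xi> *\<^sub>R (cis (t * (v5 \<bullet> \<xi>)) * k m (omega \<xi>))) \<in> borel_measurable lborel" for m
        using k_meas[of m] unfolding cis_conv_exp by measurable
      show "(\<lambda>\<xi>. indicator torus \<xi> *\<^sub>R (cis (t * (v5 \<bullet> \<xi>)) * (\<kappa> * cis (- (omega \<xi> * t)) / of_real (omega \<xi>)))) \<in> borel_measurable lborel"
        unfolding cis_conv_exp by measurable
      have w: "omega \<xi> > 0" if "\<forall>j. \<xi> $ j \<noteq> 0" "\<xi> \<in> torus" for \<xi> :: "real^5"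
        using abs_component_le_omega[OF that(2), of 0] that(1)[rule_format, of 0]
        by (smt (verit) zero_less_abs_iff)
      show "AE \<xi> in lborel. (\<lambda>m. indicator torus \<xi> *\<^sub>R (cis (t * (v5 \<bullet> \<xi>)) * k m (omega \<xi>))) \<longlonglongrightarrow>
         indicator torus \<xi> *\<^sub>R (cis (t * (v5 \<bullet> \<xi>)) * (\<kappa> * cis (- (omega \<xi> * t)) / of_real (omega \<xi>)))"
        using AE_component_nonzero
      proof eventually_elim
        case (elim \<xi>)
        show ?case
        proof (cases "\<xi> \<in> torus")
          case True
          have "(\<lambda>m. k m (omega \<xi>)) \<longlonglongrightarrow> \<kappa> * cis (- (omega \<xi> * t)) / of_real (omega \<xi>)"
            unfolding k_def by (rule filterlim_compose[OF lim[OF w[OF elim True] t] N_lim])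
          then show ?thesis by (intro tendsto_intros)
        qed simp
      qed
      show "AE \<xi> in lborel. norm (indicator torus \<xi> *\<^sub>R (cis (t * (v5 \<bullet> \<xi>)) * k m (omega \<xi>))) \<le>
         B * (indicator torus \<xi> *\<^sub>R (1 / omega \<xi>))" for m
        using AE_component_nonzero
      proof eventually_elim
        case (elim \<xi>)
        show ?case
          using bound[OF w[OF elim] t N(2,3)[of m]]
          by (cases "\<xi> \<in> torus") (auto simp: k_def norm_mult)
      qed
    qed
    have L2: "(\<lambda>m. LINT x|lborel. indicator {1 / N m..N m} x *\<^sub>R line_integrand (t / sqrt 10) x) \<longlonglongrightarrow>
       (LINT x|lborel. indicator {0<..} x *\<^sub>R line_integrand (t / sqrt 10) x)"
    proof (rule integral_dominated_convergence[where w = "\<lambda>x. norm (indicator {0<..} x *\<^sub>R line_integrand (t / sqrt 10) x)"])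
      show "integrable lborel (\<lambda>x. norm (indicator {0<..} x *\<^sub>R line_integrand (t / sqrt 10) x))"
        using int unfolding set_integrable_def by (rule integrable_norm)
      show "AE x in lborel. (\<lambda>m. indicator {1 / N m..N m} x *\<^sub>R line_integrand (t / sqrt 10) x) \<longlonglongrightarrow>
        indicator {0<..} x *\<^sub>R line_integrand (t / sqrt 10) x"
      proof (rule AE_I2, rule tendsto_eventually)
        fix x :: real
        have "\<forall>\<^sub>F m in sequentially. N m \<ge> max \<bar>x\<bar> (1 / x)"
          using N_lim unfolding filterlim_at_top by blast
        then show "\<forall>\<^sub>F m in sequentially. indicator {1 / N m..N m} x *\<^sub>R line_integrand (t / sqrt 10) x =
          indicator {0<..} x *\<^sub>R line_integrand (t / sqrt 10) x"
        proof eventually_elim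
          case (elim m)
          have "x \<in> {1 / N m..N m} \<longleftrightarrow> x > 0"
          proof
            assume "x > 0"
            then show "x \<in> {1 / N m..N m}" using elim N(1)[of m] by (simp add: field_simps)
          next
            assume "x \<in> {1 / N m..N m}"
            then have "1 / N m \<le> x" by simp
            then show "x > 0" using N(2)[of m] by linarith
          qed
          then show ?case by (simp add: indicator_def)
        qed
      qed
      show "AE x in lborel. norm (indicator {1 / N m..N m} x *\<^sub>R line_integrand (t / sqrt 10) x) \<le>
        norm (indicator {0<..} x *\<^sub>R line_integrand (t / sqrt 10) x)" for m
      proof (rule AE_I2)
        fix x :: real
        have "x > 0" if "x \<in> {1 / N m..N m}"
        proof -
          have "1 / N m \<le> x" using that by simp
          then show ?thesis using N(2)[of m] by linarith
        qed
        then show "norm (indicator {1 / N m..N m} x *\<^sub>R line_integrand (t / sqrt 10) x) \<le>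
          norm (indicator {0<..} x *\<^sub>R line_integrand (t / sqrt 10) x)"
          by (auto simp: indicator_def)
      qed
    qed simp_all
    have "(LINT \<xi>|lborel. indicator torus \<xi> *\<^sub>R (cis (t * (v5 \<bullet> \<xi>)) * k m (omega \<xi>))) =
       (LINT x|lborel. indicator {1 / N m..N m} x *\<^sub>R line_integrand (t / sqrt 10) x)" for m
      using torus_fubini[OF N(2)[of m] N(3)[of m], of t] unfolding set_lebesgue_integral_def k_def .
    with L1 L2 have A: "(LINT \<xi>|lborel. indicator torus \<xi> *\<^sub>R (cis (t * (v5 \<bullet> \<xi>)) * (\<kappa> * cis (- (omega \<xi> * t)) / of_real (omega \<xi>))))
       = (LINT x|lborel. indicator {0<..} x *\<^sub>R line_integrand (t / sqrt 10) x)"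
      using LIMSEQ_unique by simp
    have B: "indicator torus \<xi> *\<^sub>R (cis (t * (v5 \<bullet> \<xi>)) * (\<kappa> * cis (- (omega \<xi> * t)) / of_real (omega \<xi>))) =
       \<kappa> * (indicator torus \<xi> *\<^sub>R (exp (\<i> * complex_of_real (t * phase v5 \<xi>)) * complex_of_real (1 / omega \<xi>)))" for \<xi>
    proof -
      have "exp (\<i> * complex_of_real (t * phase v5 \<xi>)) = cis (t * (v5 \<bullet> \<xi>)) * cis (- (omega \<xi> * t))"
        unfolding cis_mult cis_conv_exp[symmetric] by (simp add: phase_def algebra_simps)
      then show ?thesis by (simp add: scaleR_conv_of_real)
    qed
    have "\<kappa> * (LINT \<xi>:torus|lborel. exp (\<i> * complex_of_real (t * phase v5 \<xi>)) * complex_of_real (1 / omega \<xi>)) =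
       (LINT x:{0<..}|lborel. line_integrand (t / sqrt 10) x)"
      using A unfolding B integral_mult_right_zero set_lebesgue_integral_def .
    then show "\<kappa> * ((2 * pi) ^ 5 * osc_int v5 t) = (LINT x:{0<..}|lborel. line_integrand (t / sqrt 10) x)"
      unfolding osc_int_def by simp
  qed
qed

theorem mainTheorem2:
  "\<exists>c0::real. c0 \<noteq> 0 \<and>
     ((\<lambda>t::real. cmod (complex_of_real (t powr (11 / 6)) * osc_int v5 t)) \<longlongrightarrow> c0) at_top"
proof -
  obtain \<kappa> where \<kappa>: "\<kappa> \<noteq> 0" and eq:
    "\<And>t. \<lbrakk>t > 0; set_integrable lborel {0<..} (line_integrand (t / sqrt 10))\<rbrakk> \<Longrightarrow>
       \<kappa> * ((2 * pi) ^ 5 * osc_int v5 t) = (LINT x:{0<..}|lborel. line_integrand (t / sqrt 10) x)"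
    using osc_int_eq_line_integral by blast
  define G where "G = (\<lambda>l. LINT s|lborel. scaled_integrand l s)"
  \<comment> \<open>\<open>sqrt 10\<close> comes from \<open>t = sqrt 10 * l ^ 3\<close>,
    \<open>sqrt 2\<close> from \<open>X\<close>, and the denominator from subordination and the
    normalization of \<open>osc_int\<close>.\<close>
  define C where "C = sqrt 10 powr (11 / 6) / sqrt 2 / (norm \<kappa> * (2 * pi) ^ 5)"
  define J where "J = (LINT s|lborel. airy_moment 0 (2 * s) ^ 5)"
  define lt where "lt = (\<lambda>t. (t / sqrt 10) powr (1 / 3))"
  have C: "C > 0" using \<kappa> by (simp add: C_def)
  have J: "J > 0" using airy_fifth_power_integral_nonzero by (simp add: J_def)
  have scaled: "cmod (complex_of_real (t powr (11 / 6)) * osc_int v5 t) = C * norm (G (lt t))"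
    if t: "t \<ge> sqrt 10" for t
  proof -
    define l where "l = lt t"
    have t0: "t > 0" using t by (smt (verit) real_sqrt_gt_zero)
    have t1: "t / sqrt 10 \<ge> 1" using t by (simp add: le_divide_eq)
    have l: "l \<ge> 1" unfolding l_def lt_def using t1 by (intro ge_one_powr_ge_zero) auto
    have l3: "l ^ 3 = t / sqrt 10" unfolding l_def lt_def using t0 by (subst powr_power) auto
    have te: "t = sqrt 10 * l ^ 3" by (simp add: l3)
    have n0: "norm \<kappa> * ((2 * pi) ^ 5 * norm (osc_int v5 t)) = sqrt (l ^ 3 / 2) / l ^ 7 * norm (G l)"
    proof -
      have "\<kappa> * ((2 * pi) ^ 5 * osc_int v5 t) = (LINT x:{0<..}|lborel. line_integrand (l ^ 3) x)"
        using eq[OF t0] line_integral_scaled(1)[OF l] unfolding l3 by simp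
      then have "norm (\<kappa> * ((2 * pi) ^ 5 * osc_int v5 t)) = sqrt (l ^ 3 / 2) / l ^ 7 * norm (G l)"
        using line_integral_scaled(2)[OF l] by (simp add: G_def)
      then show ?thesis by (simp add: norm_mult norm_power)
    qed
    have n: "norm (osc_int v5 t) = sqrt (l ^ 3 / 2) / l ^ 7 * norm (G l) / (norm \<kappa> * (2 * pi) ^ 5)"
    proof -
      have "c = d / (a * b)" if "a * (b * c) = d" "a \<noteq> 0" "b \<noteq> 0" for a b c d :: real
        using that by auto
      from this[OF n0] show ?thesis using \<kappa> by simp
    qed
    \<comment> \<open>The exponents cancel exactly: 11/2 from \<open>t\<close>, 3/2 from
      \<open>X\<close>, against 7.\<close>
    have "t powr (11 / 6) * (sqrt (l ^ 3 / 2) / l ^ 7) = sqrt 10 powr (11 / 6) / sqrt 2"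
    proof -
      have f1: "t powr (11 / 6) = sqrt 10 powr (11 / 6) * l powr (11 / 2)"
      proof -
        have "(l ^ 3) powr (11 / 6) = l powr (11 / 2)"
          using l by (simp add: powr_powr flip: powr_numeral)
        then show ?thesis unfolding te using l by (simp add: powr_mult)
      qed
      have f2: "sqrt (l ^ 3 / 2) = l powr (3 / 2) / sqrt 2"
        using l by (simp add: real_sqrt_divide powr_half_sqrt[symmetric] powr_powr flip: powr_numeral)
      have f3: "l powr (11 / 2) * l powr (3 / 2) = l ^ 7"
        using l by (simp add: flip: powr_add powr_numeral)
      have "t powr (11 / 6) * (sqrt (l ^ 3 / 2) / l ^ 7) =
          sqrt 10 powr (11 / 6) / sqrt 2 * (l powr (11 / 2) * l powr (3 / 2) / l ^ 7)"
        unfolding f1 f2 by simp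
      then show ?thesis unfolding f3 using l by simp
    qed
    then have "t powr (11 / 6) * norm (osc_int v5 t) = C * norm (G l)"
      unfolding n C_def by (metis (no_types, lifting) mult.assoc times_divide_eq_left times_divide_eq_right)
    then show ?thesis using t0 by (simp add: norm_mult l_def)
  qed
  have "filterlim lt at_top at_top" unfolding lt_def by real_asymp
  from filterlim_compose[OF tendsto_integral_scaled_integrand this]
  have "((\<lambda>t. G (lt t)) \<longlongrightarrow> of_real J) at_top" by (simp only: G_def J_def)
  then have "((\<lambda>t. C * norm (G (lt t))) \<longlongrightarrow> C * norm (complex_of_real J)) at_top"
    by (intro tendsto_intros)
  moreover have "\<forall>\<^sub>F t in at_top. C * norm (G (lt t)) = cmod (complex_of_real (t powr (11 / 6)) * osc_int v5 t)"
    using eventually_ge_at_top[of "sqrt 10"] by eventually_elim (simp only: scaled)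
  ultimately have "((\<lambda>t. cmod (complex_of_real (t powr (11 / 6)) * osc_int v5 t)) \<longlongrightarrow> C * norm (complex_of_real J)) at_top"
    by (rule Lim_transform_eventually)
  moreover have "C * norm (complex_of_real J) \<noteq> 0" using C J by simp
  ultimately show ?thesis by blast
qed

end
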